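(* Let $m\in\mathbb{N}$, $c\in\mathbb{R}$, and let $P,Q,R:[c,\infty)\to\mathbb{C}^{m\times m}$ be (Lebesgue) measurable matrix-valued functions such that $P>0$ and $R>0$ (positive definite) a.e. on $[c,\infty)$, $Q=Q^*$ is self-adjoint, and $P^{-1},\,Q,\,R\in L^1([c,d];dx)^{m\times m}$ for all $d\in[c,\infty)$. Assume that $P\in AC([c,c+\rho])^{m\times m}$ for all $\rho>0$ and that $\|P'R^{-1}P'\|,\ \|R^{-1}\|\in L^1_{\mathrm{loc}}((c,\infty))$. Let $L=R^{-1}\left(-\frac{d}{dx}P\frac{d}{dx}+Q\right)$ on $[c,\infty)$, and suppose that the associated minimal operator $T_{\min,c,\infty}$ in $L^2((c,\infty);R\,dx)^m$ (with Dirichlet boundary condition at $c$) is bounded from below. If $$\operatorname*{ess\,sup}_{x\in[\rho/2,\rho]}\left\|R(x)^{-1/2}P(x)R(x)^{-1/2}\right\|=O(\rho^2)\quad\text{as }\rho\uparrow\infty,$$ then $L$ is in the limit point case at $\infty$.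
   Context: $\|M\|$ denotes the operator norm of an $m\times m$ matrix $M$, and $M^*$ its conjugate transpose. $AC([c,d])^m$ (resp. $AC([c,d])^{m\times m}$) denotes $\mathbb{C}^m$-valued (resp. $\mathbb{C}^{m\times m}$-valued) functions with absolutely continuous entries on $[c,d]$. With $(f,g)_{\mathbb{C}^m}=\sum_{k=1}^m\overline{f_k}g_k$, the space $L^2([c,\infty);R\,dx)^m$ is the Hilbert space of measurable $\mathbb{C}^m$-valued functions with scalar product $(u,v)=\int_c^\infty (u(x),R(x)v(x))_{\mathbb{C}^m}\,dx$. For $u$ with $u,Pu'\in AC([c,d])^m$ for all $d\in[c,\infty)$, set $Lu=R^{-1}\left(-(Pu')'+Qu\right)$. Define $$\mathcal{D}_{\max,c,\infty}=\{u\in L^2([c,\infty);R\,dx)^m\,:\,u,Pu'\in AC([c,d])^m\text{ for all }d\in[c,\infty);\ u(c)=0;\ Lu\in L^2([c,\infty);R\,dx)^m\},$$ $$\mathcal{D}_{\min,c,\infty}=\{u\in\mathcal{D}_{\max,c,\infty}\,:\,\mathrm{supp}(u)\subset[c,\infty)\text{ is compact}\}.$$ The minimal operator is $T_{\min,c,\infty}u=Lu$ with domain $\mathcal{D}_{\min,c,\infty}$, and the maximal operator is $T_{\max,c,\infty}u=Lu$ with domain $\mathcal{D}_{\max,c,\infty}$; both act in $L^2((c,\infty);R\,dx)^m$. The operator $T_{\min,c,\infty}$ is densely defined and $T_{\min,c,\infty}^*=T_{\max,c,\infty}$. Bounded from below means that there is $\gamma\in\mathbb{R}$ such that $(u,T_{\min,c,\infty}u)\ge\gamma\,(u,u)$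 for all $u\in\mathcal{D}_{\min,c,\infty}$. The expression $L$ is in the limit point case at $\infty$ if, for every $z\in\mathbb{C}\setminus\mathbb{R}$, the space of $\mathbb{C}^m$-valued solutions $u$ of $Lu=zu$ (with $u,Pu'\in AC([c,d])^m$ for all $d\in[c,\infty)$) lying in $L^2([c,\infty);R\,dx)^m$ has dimension exactly $m$ (the minimal possible value); equivalently, $T_{\min,c,\infty}$ is essentially self-adjoint, i.e. its closure, which then equals $T_{\max,c,\infty}$, is self-adjoint. *)

theory Defs
  imports "HOL-Probability.Essential_Supremum" "HOL-Library.Function_Algebras"
begin

text \<open>
  The size m of the matrices is \<open>CARD('m)\<close> for a finite index type \<open>'m\<close>. Functions on the half-line
  \<open>[c, \<infinity>)\<close> are total functions on \<^typ>\<open>real\<close> whose values to the left of \<open>c\<close> are irrelevant.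
  Measurability and integrability are with respect to Lebesgue measure.
\<close>

subsection \<open>Complex matrices\<close>

definition cdot :: "complex^'m \<Rightarrow> complex^'m \<Rightarrow> complex" where
  "cdot f g = (\<Sum>k\<in>UNIV. cnj (f $ k) * g $ k)"

definition conj_transpose :: "complex^'m^'m \<Rightarrow> complex^'m^'m" where
  "conj_transpose M = (\<chi> i j. cnj (M $ j $ i))"

definition self_adjoint :: "complex^'m^'m \<Rightarrow> bool" where
  "self_adjoint M \<longleftrightarrow> conj_transpose M = M"

definition pos_def :: "complex^'m^'m \<Rightarrow> bool" where
  "pos_def M \<longleftrightarrow> self_adjoint M \<and> (\<forall>v. v \<noteq> 0 \<longrightarrow> Re (cdot v (M *v v)) > 0)"

text \<open>The positive definite square root; meaningful (and unique) when \<open>M\<close> is positive definite.\<close>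

definition mat_sqrt :: "complex^'m^'m \<Rightarrow> complex^'m^'m" where
  "mat_sqrt M = (THE S. pos_def S \<and> S ** S = M)"

definition mat_inv_sqrt :: "complex^'m^'m \<Rightarrow> complex^'m^'m" where
  "mat_inv_sqrt M = matrix_inv (mat_sqrt M)"

definition op_norm :: "complex^'m^'m \<Rightarrow> real" where
  "op_norm M = onorm ((*v) M)"

subsection \<open>Function spaces\<close>

definition abs_continuous_on :: "real \<Rightarrow> real \<Rightarrow> (real \<Rightarrow> complex) \<Rightarrow> bool" where
  "abs_continuous_on a b f \<longleftrightarrow>
    (\<forall>\<epsilon>>0. \<exists>\<delta>>0. \<forall>(n::nat) l r.
       (\<forall>i<n. a \<le> l i \<and> l i \<le> r i \<and> r i \<le> b) \<longrightarrow>
       (\<forall>i<n. \<forall>j<n. i \<noteq> j \<longrightarrow> {l i<..<r i} \<inter> {l j<..<r j} = {}) \<longrightarrow>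
       (\<Sum>i<n. r i - l i) < \<delta> \<longrightarrow>
       (\<Sum>i<n. norm (f (r i) - f (l i))) < \<epsilon>)"

definition AC_vec :: "real \<Rightarrow> real \<Rightarrow> (real \<Rightarrow> complex^'m) \<Rightarrow> bool" where
  "AC_vec a b u \<longleftrightarrow> (\<forall>k. abs_continuous_on a b (\<lambda>x. u x $ k))"

definition AC_mat :: "real \<Rightarrow> real \<Rightarrow> (real \<Rightarrow> complex^'m^'m) \<Rightarrow> bool" where
  "AC_mat a b M \<longleftrightarrow> (\<forall>i j. abs_continuous_on a b (\<lambda>x. M x $ i $ j))"

definition L1_mat :: "real \<Rightarrow> real \<Rightarrow> (real \<Rightarrow> complex^'m^'m) \<Rightarrow> bool" where
  "L1_mat a b M \<longleftrightarrow> (\<forall>i j. set_integrable lebesgue {a..b} (\<lambda>x. M x $ i $ j))"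

definition L1_loc :: "real set \<Rightarrow> (real \<Rightarrow> real) \<Rightarrow> bool" where
  "L1_loc S f \<longleftrightarrow> (\<forall>K. compact K \<and> K \<subseteq> S \<longrightarrow> set_integrable lebesgue K f)"

definition L2_ip :: "real \<Rightarrow> (real \<Rightarrow> complex^'m^'m) \<Rightarrow> (real \<Rightarrow> complex^'m) \<Rightarrow> (real \<Rightarrow> complex^'m) \<Rightarrow> complex" where
  "L2_ip c R u v = (LINT x|lebesgue_on {c..}. cdot (u x) (R x *v v x))"

definition L2_space :: "real \<Rightarrow> (real \<Rightarrow> complex^'m^'m) \<Rightarrow> (real \<Rightarrow> complex^'m) set" where
  "L2_space c R = {u. u \<in> borel_measurable (lebesgue_on {c..}) \<and>
                      integrable (lebesgue_on {c..}) (\<lambda>x. cdot (u x) (R x *v u x))}"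

subsection \<open>The differential expression and its operators\<close>

text \<open>The (almost everywhere defined) derivative of a function on \<open>[c, \<infinity>)\<close>.\<close>

definition hderiv :: "real \<Rightarrow> (real \<Rightarrow> 'a::real_normed_vector) \<Rightarrow> real \<Rightarrow> 'a" where
  "hderiv c f x = vector_derivative f (at x within {c..})"

text \<open>
  For absolutely continuous \<open>u\<close> the product \<open>P u'\<close> is defined only almost everywhere; that it is
  absolutely continuous means that it agrees almost everywhere with such a function. That function
  is unique on \<open>[c, \<infinity>)\<close>, by continuity, and it is what \<open>P u'\<close> denotes.
\<close>

definition is_quasi_deriv :: "real \<Rightarrow> (real \<Rightarrow> complex^'m^'m) \<Rightarrow> (real \<Rightarrow> complex^'m) \<Rightarrow> (real \<Rightarrow> complex^'m) \<Rightarrow> bool" where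
  "is_quasi_deriv c P u v \<longleftrightarrow> (\<forall>d\<ge>c. AC_vec c d v) \<and>
     (AE x in lebesgue_on {c..}. v x = P x *v hderiv c u x)"

definition quasi_deriv :: "real \<Rightarrow> (real \<Rightarrow> complex^'m^'m) \<Rightarrow> (real \<Rightarrow> complex^'m) \<Rightarrow> real \<Rightarrow> complex^'m" where
  "quasi_deriv c P u = (SOME v. is_quasi_deriv c P u v)"

definition L_admissible :: "real \<Rightarrow> (real \<Rightarrow> complex^'m^'m) \<Rightarrow> (real \<Rightarrow> complex^'m) set" where
  "L_admissible c P = {u. (\<forall>d\<ge>c. AC_vec c d u) \<and> (\<exists>v. is_quasi_deriv c P u v)}"

definition L_expr :: "real \<Rightarrow> (real \<Rightarrow> complex^'m^'m) \<Rightarrow> (real \<Rightarrow> complex^'m^'m) \<Rightarrow> (real \<Rightarrow> complex^'m^'m)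
    \<Rightarrow> (real \<Rightarrow> complex^'m) \<Rightarrow> real \<Rightarrow> complex^'m" where
  "L_expr c P Q R u x = matrix_inv (R x) *v (- hderiv c (quasi_deriv c P u) x + Q x *v u x)"

definition D_max :: "real \<Rightarrow> (real \<Rightarrow> complex^'m^'m) \<Rightarrow> (real \<Rightarrow> complex^'m^'m) \<Rightarrow> (real \<Rightarrow> complex^'m^'m)
    \<Rightarrow> (real \<Rightarrow> complex^'m) set" where
  "D_max c P Q R = {u \<in> L2_space c R. u \<in> L_admissible c P \<and> u c = 0 \<and> L_expr c P Q R u \<in> L2_space c R}"

definition D_min :: "real \<Rightarrow> (real \<Rightarrow> complex^'m^'m) \<Rightarrow> (real \<Rightarrow> complex^'m^'m) \<Rightarrow> (real \<Rightarrow> complex^'m^'m)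
    \<Rightarrow> (real \<Rightarrow> complex^'m) set" where
  "D_min c P Q R = {u \<in> D_max c P Q R. compact (closure {x \<in> {c..}. u x \<noteq> 0})}"

text \<open>
  The scalar product of \<open>u\<close> with \<open>L u\<close> is real on the minimal domain, so comparing real parts is
  the same as the inequality between the scalar products themselves.
\<close>

definition T_min_bounded_below :: "real \<Rightarrow> (real \<Rightarrow> complex^'m^'m) \<Rightarrow> (real \<Rightarrow> complex^'m^'m)
    \<Rightarrow> (real \<Rightarrow> complex^'m^'m) \<Rightarrow> bool" where
  "T_min_bounded_below c P Q R \<longleftrightarrow>
    (\<exists>\<gamma>::real. \<forall>u \<in> D_min c P Q R. Re (L2_ip c R u (L_expr c P Q R u)) \<ge> \<gamma> * Re (L2_ip c R u u))"

text \<open>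
  Requiring solutions to vanish to the left of \<open>c\<close> identifies functions on \<open>[c, \<infinity>)\<close> with total
  functions, so that the dimension below is the one of a space of functions on \<open>[c, \<infinity>)\<close>.
\<close>

definition L2_solutions :: "real \<Rightarrow> (real \<Rightarrow> complex^'m^'m) \<Rightarrow> (real \<Rightarrow> complex^'m^'m) \<Rightarrow> (real \<Rightarrow> complex^'m^'m)
    \<Rightarrow> complex \<Rightarrow> (real \<Rightarrow> complex^'m) set" where
  "L2_solutions c P Q R z =
    {u \<in> L_admissible c P. (AE x in lebesgue_on {c..}. L_expr c P Q R u x = z *s u x) \<and>
       u \<in> L2_space c R \<and> (\<forall>x<c. u x = 0)}"

definition cfun_scale :: "complex \<Rightarrow> (real \<Rightarrow> complex^'m) \<Rightarrow> real \<Rightarrow> complex^'m" where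
  "cfun_scale a u = (\<lambda>x. a *s u x)"

lemma vector_space_cfun: "vector_space (cfun_scale :: complex \<Rightarrow> (real \<Rightarrow> complex^'m) \<Rightarrow> _)"
  by unfold_locales (auto simp: cfun_scale_def fun_eq_iff vec_eq_iff algebra_simps)

text \<open>
  \<open>vector_space.dim\<close> is 0 for a space of infinite dimension; as \<open>CARD('m)\<close> is positive, the
  equation below does assert finite dimension.
\<close>

definition limit_point_case :: "real \<Rightarrow> (real \<Rightarrow> complex^'m^'m) \<Rightarrow> (real \<Rightarrow> complex^'m^'m)
    \<Rightarrow> (real \<Rightarrow> complex^'m^'m) \<Rightarrow> bool" where
  "limit_point_case c P Q R \<longleftrightarrow>
    (\<forall>z. z \<notin> \<real> \<longrightarrow> vector_space.dim cfun_scale (L2_solutions c P Q R z) = CARD('m))"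

end

theory Submission
  imports Defs
begin

text \<open>
  Let \<open>\<mu> < \<gamma>\<close>, where \<open>\<gamma>\<close> is a lower bound of the minimal operator. If \<open>w\<close> is square integrable with
  \<open>L w = \<mu> w\<close> and \<open>w(c) = 0\<close>, then for a cutoff function \<open>\<eta>\<close> the function \<open>\<eta> w\<close> is in the minimal domain and
  \<open>(\<eta> w, (L - \<mu>) \<eta> w) = \<integral> \<eta>'\<^sup>2 (w, P w)\<close>. The growth condition makes the right hand side small, while the left
  hand side dominates \<open>(\<gamma> - \<mu>) \<parallel>\<eta> w\<parallel>\<^sup>2\<close>; hence \<open>w = 0\<close> (Povzner--Wienholtz).

  Now let \<open>u\<close> be square integrable with \<open>L u = z u\<close>, \<open>u(c) = 0\<close> and \<open>z\<close> not real. For suitable \<open>b\<close> choose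
  \<open>w\<^sub>b\<close> with \<open>L w\<^sub>b = \<mu> w\<^sub>b\<close>, \<open>w\<^sub>b(c) = 0\<close> and \<open>w\<^sub>b(b) = u(b)\<close>. Semiboundedness on \<open>[c, b]\<close> bounds \<open>u - w\<^sub>b\<close>, hence
  \<open>w\<^sub>b\<close>, by \<open>u\<close>. A limit of the \<open>w\<^sub>b\<close> for \<open>b \<rightarrow> \<infinity>\<close> is a solution as in the first step, so \<open>w\<^sub>b \<rightarrow> 0\<close>. Symmetry of
  \<open>L\<close> on \<open>[c, b]\<close> with Dirichlet conditions gives \<open>Im ((z - \<mu>) (u - w\<^sub>b, u)) = 0\<close>, and in the limit
  \<open>Im z \<parallel>u\<parallel>\<^sup>2 = 0\<close>. So \<open>u \<mapsto> u(c)\<close> is injective on the space of square integrable solutions; that it is onto is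
  Weyl's construction, a limit of solutions vanishing at \<open>b\<close>.
\<close>

section \<open>Absolutely continuous functions\<close>

text \<open>The cutoff argument compares the real part of the spectral parameter with \<gamma>, so
  it says nothing about non-real z whose real part is at least \<gamma>, yet the limit point case
  quantifies over all of them. The comparison functions w_b carry the information from the real
  point \<mu> to z, in place of a theory of self-adjoint extensions: only compact intervals with
  Dirichlet conditions occur, and b tends to infinity by compactness in the finite-dimensional space
  of initial values. Two obstacles shape the rest. The product \<eta> w has to lie in the operator
  domain, not just in the form domain, so \<eta>' must be absolutely continuous and L (\<eta> w)
  square integrable. And u - w_b, extended by zero past b, in general leaves that domain because its
  quasi-derivative jumps, so the lower bound reaches it only as a limit of cutoffs. The rate
  \<rho>^2 fits a cutoff on [\<rho>/2, \<rho>]: there (\<eta>')^2 is of order 1/\<rho>^2, and the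
  energy is at most a constant times the mass of w on that interval. As the coefficients are merely
  integrable, all calculus is done with absolutely continuous functions, seen as primitives of their
  derivatives.\<close>

definition ac_on :: "real \<Rightarrow> real \<Rightarrow> (real \<Rightarrow> 'a::real_normed_vector) \<Rightarrow> bool" where
  "ac_on a b f \<longleftrightarrow>
    (\<forall>\<epsilon>>0. \<exists>\<delta>>0. \<forall>(n::nat) l r.
       (\<forall>i<n. a \<le> l i \<and> l i \<le> r i \<and> r i \<le> b) \<longrightarrow>
       (\<forall>i<n. \<forall>j<n. i \<noteq> j \<longrightarrow> {l i<..<r i} \<inter> {l j<..<r j} = {}) \<longrightarrow>
       (\<Sum>i<n. r i - l i) < \<delta> \<longrightarrow>
       (\<Sum>i<n. norm (f (r i) - f (l i))) < \<epsilon>)"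

text \<open>The copy \<open>ac_on\<close> takes values in any normed space, so vector and matrix
  valued functions can be treated as a whole; scalar hypotheses are translated here.\<close>

lemma abs_continuous_on_eq: "abs_continuous_on = ac_on"
  by (intro ext) (simp add: abs_continuous_on_def ac_on_def)

text \<open>Families of non-overlapping intervals are kept as lists, so that they can be concatenated,
  and cut at a point by clamping their end points; clamping may produce degenerate intervals.\<close>

definition family :: "real \<Rightarrow> real \<Rightarrow> (real \<times> real) list \<Rightarrow> bool" where
  "family a b xs \<longleftrightarrow> (\<forall>p\<in>set xs. a \<le> fst p \<and> fst p \<le> snd p \<and> snd p \<le> b) \<and>
     sorted_wrt (\<lambda>p q. {fst p<..<snd p} \<inter> {fst q<..<snd q} = {}) xs"

definition family_length :: "(real \<times> real) list \<Rightarrow> real" where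
  "family_length xs = (\<Sum>p\<leftarrow>xs. snd p - fst p)"

definition family_var :: "(real \<Rightarrow> 'a::real_normed_vector) \<Rightarrow> (real \<times> real) list \<Rightarrow> real" where
  "family_var f xs = (\<Sum>p\<leftarrow>xs. norm (f (snd p) - f (fst p)))"

lemma family_simps [simp]:
  "family_length [] = 0" "family_var f [] = 0"
  "family_length (p # xs) = snd p - fst p + family_length xs"
  "family_var f (p # xs) = norm (f (snd p) - f (fst p)) + family_var f xs"
  "family_length (xs @ ys) = family_length xs + family_length ys"
  "family_var f (xs @ ys) = family_var f xs + family_var f ys"
  by (auto simp: family_length_def family_var_def)

lemma family_var_nonneg [simp]: "0 \<le> family_var f xs"
  by (induction xs) auto

lemma ac_on_iff_family:
  "ac_on a b f \<longleftrightarrow> (\<forall>\<epsilon>>0. \<exists>\<delta>>0. \<forall>xs. family a b xs \<longrightarrow> family_length xs < \<delta> \<longrightarrow> family_var f xs < \<epsilon>)"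
  (is "_ = ?R")
proof
  assume ac: "ac_on a b f"
  show ?R
  proof (intro allI impI)
    fix \<epsilon> :: real assume "\<epsilon> > 0"
    with ac obtain \<delta> where "\<delta> > 0" and \<delta>: "\<And>(n::nat) l r.
       (\<forall>i<n. a \<le> l i \<and> l i \<le> r i \<and> r i \<le> b) \<Longrightarrow>
       (\<forall>i<n. \<forall>j<n. i \<noteq> j \<longrightarrow> {l i<..<r i} \<inter> {l j<..<r j} = {}) \<Longrightarrow>
       (\<Sum>i<n. r i - l i) < \<delta> \<Longrightarrow>
       (\<Sum>i<n. norm (f (r i) - f (l i))) < \<epsilon>"
      unfolding ac_on_def by blast
    have "family_var f xs < \<epsilon>" if fam: "family a b xs" and len: "family_length xs < \<delta>" for xs
    proof -
      have dis: "{fst (xs!i)<..<snd (xs!i)} \<inter> {fst (xs!j)<..<snd (xs!j)} = {}"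
        if "i < length xs" "j < length xs" "i \<noteq> j" for i j
        using fam that unfolding family_def sorted_wrt_iff_nth_less
        by (metis inf_commute nat_neq_iff)
      have "(\<Sum>i<length xs. norm (f (snd (xs!i)) - f (fst (xs!i)))) < \<epsilon>"
        using fam len dis
        by (intro \<delta>) (auto simp: family_def family_length_def sum_list_sum_nth atLeast0LessThan)
      then show ?thesis by (simp add: family_var_def sum_list_sum_nth atLeast0LessThan)
    qed
    with \<open>\<delta> > 0\<close> show "\<exists>\<delta>>0. \<forall>xs. family a b xs \<longrightarrow> family_length xs < \<delta> \<longrightarrow> family_var f xs < \<epsilon>"
      by blast
  qed
next
  assume R: ?R
  show "ac_on a b f"
    unfolding ac_on_def
  proof (intro allI impI)
    fix \<epsilon> :: real assume "\<epsilon> > 0"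
    with R obtain \<delta> where "\<delta> > 0" and \<delta>: "\<And>xs. family a b xs \<Longrightarrow> family_length xs < \<delta> \<Longrightarrow> family_var f xs < \<epsilon>"
      by blast
    have "(\<Sum>i<n. norm (f (r i) - f (l i))) < \<epsilon>"
      if "\<forall>i<n. a \<le> l i \<and> l i \<le> r i \<and> r i \<le> b"
        "\<forall>i<n. \<forall>j<n. i \<noteq> j \<longrightarrow> {l i<..<r i} \<inter> {l j<..<r j} = {}" "(\<Sum>i<n. r i - l i) < \<delta>" for n :: nat and l r
      using \<delta>[of "map (\<lambda>i. (l i, r i)) [0..<n]"] that
      by (auto simp: family_def family_length_def family_var_def sorted_wrt_map sorted_wrt_iff_nth_less
          sum_list_sum_nth atLeast0LessThan)
    with \<open>\<delta> > 0\<close> show "\<exists>\<delta>>0. \<forall>(n::nat) l r.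
       (\<forall>i<n. a \<le> l i \<and> l i \<le> r i \<and> r i \<le> b) \<longrightarrow>
       (\<forall>i<n. \<forall>j<n. i \<noteq> j \<longrightarrow> {l i<..<r i} \<inter> {l j<..<r j} = {}) \<longrightarrow>
       (\<Sum>i<n. r i - l i) < \<delta> \<longrightarrow>
       (\<Sum>i<n. norm (f (r i) - f (l i))) < \<epsilon>" by blast
  qed
qed

lemma family_append:
  assumes "family a b xs" "family b d ys" "a \<le> b" "b \<le> d"
  shows "family a d (xs @ ys)"
  using assms unfolding family_def sorted_wrt_append
  by (fastforce simp: min_le_iff_disj le_max_iff_disj intro: order.trans)

lemma family_mono: "family a b xs \<Longrightarrow> a' \<le> a \<Longrightarrow> b \<le> b' \<Longrightarrow> family a' b' xs"
  unfolding family_def by (meson order.trans)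

lemma family_measure:
  assumes "family a b xs"
  shows "measure lborel (\<Union>p\<in>set xs. {fst p<..<snd p}) = family_length xs"
  using assms
proof (induction xs)
  case (Cons p xs)
  have "measure lborel ({fst p<..<snd p} \<union> (\<Union>p\<in>set xs. {fst p<..<snd p}))
     = measure lborel {fst p<..<snd p} + measure lborel (\<Union>p\<in>set xs. {fst p<..<snd p})"
    using Cons.prems
    by (intro measure_Un_AE AE_I2 fmeasurable.finite_UN)
      (auto simp: family_def fmeasurable_def emeasure_lborel_box_eq min_le_iff_disj le_max_iff_disj dest!: bspec)
  then show ?case using Cons by (simp add: family_def)
qed auto

lemma family_length_le: assumes "family a b xs" "a \<le> b" shows "family_length xs \<le> b - a"
proof -
  have "family_length xs \<le> measure lborel {a..b}"
    unfolding family_measure[OF assms(1), symmetric]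
    using assms by (intro measure_mono_fmeasurable) (auto simp: family_def fmeasurable_def)
  then show ?thesis using assms by simp
qed

definition clamp_family :: "real \<Rightarrow> real \<Rightarrow> (real \<times> real) list \<Rightarrow> (real \<times> real) list" where
  "clamp_family x y = map (\<lambda>p. (max x (min y (fst p)), max x (min y (snd p))))"

lemma family_clamp:
  assumes "family a b xs" "x \<le> y"
  shows "family x y (clamp_family x y xs)"
proof -
  have "{max x (min y (fst p))<..<max x (min y (snd p))} \<subseteq> {fst p <..<snd p}" for p :: "real \<times> real"
    by (auto simp: max_def min_def split: if_splits)
  then show ?thesis
    using assms unfolding family_def clamp_family_def sorted_wrt_map
    apply (intro conjI)
    subgoal by (auto simp: max_def min_def)
    subgoal by (rule sorted_wrt_mono_rel[rotated], blast) fastforce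
    done
qed

lemma family_length_clamp_le:
  assumes "family a b xs" shows "family_length (clamp_family x y xs) \<le> family_length xs"
  using assms by (induction xs) (auto simp: family_def clamp_family_def max_def min_def)

lemma ac_on_subset: "ac_on a b f \<Longrightarrow> a \<le> a' \<Longrightarrow> b' \<le> b \<Longrightarrow> ac_on a' b' f"
  unfolding ac_on_iff_family by (meson family_mono)

lemma ac_on_continuous: 
  assumes "ac_on a b f" shows "continuous_on {a..b} f"
  unfolding continuous_on_iff
proof (intro ballI allI impI)
  fix x and e :: real assume x: "x \<in> {a..b}" and "e > 0"
  with assms obtain \<delta> where "\<delta> > 0" and \<delta>: "\<And>xs. family a b xs \<Longrightarrow> family_length xs < \<delta> \<Longrightarrow> family_var f xs < e"
    unfolding ac_on_iff_family by blast
  have "dist (f x') (f x) < e" if "x' \<in> {a..b}" "dist x' x < \<delta>" for x'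
  proof (cases "x \<le> x'")
    case True
    then show ?thesis using \<delta>[of "[(x, x')]"] x that by (auto simp: family_def dist_norm)
  next
    case False
    then show ?thesis using \<delta>[of "[(x', x)]"] x that by (auto simp: family_def dist_norm norm_minus_commute)
  qed
  with \<open>\<delta> > 0\<close> show "\<exists>d>0. \<forall>x'\<in>{a..b}. dist x' x < d \<longrightarrow> dist (f x') (f x) < e" by blast
qed

section \<open>Total variation and the splitting into monotone functions\<close>

definition variation :: "(real \<Rightarrow> real) \<Rightarrow> real \<Rightarrow> real \<Rightarrow> ennreal" where
  "variation f a b = (SUP xs\<in>Collect (family a b). ennreal (family_var f xs))"

lemma variation_upper: "family a b xs \<Longrightarrow> ennreal (family_var f xs) \<le> variation f a b"
  unfolding variation_def by (auto intro: SUP_upper)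

text \<open>Clamping a family to each of the two pieces cuts an interval around y at y, and turns an
  interval on one side into a degenerate one for the other side, which costs nothing.\<close>

lemma variation_subadd:
  assumes "x \<le> y" "y \<le> z"
  shows "variation f x z \<le> variation f x y + variation f y z"
  unfolding variation_def[of f x z]
proof (rule SUP_least)
  fix xs assume "xs \<in> Collect (family x z)"
  then have fam: "family x z xs" by simp
  have "family_var f xs \<le> family_var f (clamp_family x y xs) + family_var f (clamp_family y z xs)"
    using fam
  proof (induction xs)
    case (Cons p xs)
    have p: "x \<le> fst p" "fst p \<le> snd p" "snd p \<le> z" using Cons.prems by (auto simp: family_def)
    have "\<bar>f (snd p) - f (fst p)\<bar> \<le> \<bar>f (max x (min y (snd p))) - f (max x (min y (fst p)))\<bar>
       + \<bar>f (max y (min z (snd p))) - f (max y (min z (fst p)))\<bar>"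
      using p assms by (auto simp: max_def min_def)
    then show ?case using Cons by (auto simp: clamp_family_def family_def)
  qed (auto simp: clamp_family_def)
  then have "ennreal (family_var f xs) \<le> ennreal (family_var f (clamp_family x y xs)) + ennreal (family_var f (clamp_family y z xs))"
    by (simp flip: ennreal_plus)
  also have "\<dots> \<le> variation f x y + variation f y z"
    using assms by (intro add_mono variation_upper family_clamp[OF fam])
  finally show "ennreal (family_var f xs) \<le> variation f x y + variation f y z" .
qed

lemma variation_mono_add:
  assumes "a \<le> x" "x \<le> y"
  shows "variation f a x + ennreal \<bar>f y - f x\<bar> \<le> variation f a y"
proof -
  have "variation f a x + ennreal \<bar>f y - f x\<bar> = (SUP xs\<in>Collect (family a x). ennreal (family_var f xs) + ennreal \<bar>f y - f x\<bar>)"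
    unfolding variation_def 
    by (subst ennreal_SUP_add_left[symmetric]) (auto intro!: exI[of _ "[]"] simp: family_def)
  also have "\<dots> \<le> variation f a y"
  proof (rule SUP_least)
    fix xs assume "xs \<in> Collect (family a x)"
    then have "family a y (xs @ [(x,y)])"
      using assms by (intro family_append) (auto simp: family_def)
    from variation_upper[OF this, of f]
    show "ennreal (family_var f xs) + ennreal \<bar>f y - f x\<bar> \<le> variation f a y"
      by (simp flip: ennreal_plus)
  qed
  finally show ?thesis .
qed

text \<open>Absolute continuity with \<epsilon> = 1 bounds the variation by 1 on every interval
  shorter than \<delta>; finitely many steps of length \<delta>/2 exhaust [a, b].\<close>

lemma variation_finite:
  assumes "ac_on a b f" "a \<le> b"
  shows "variation f a b < \<infinity>"
proof -
  obtain \<delta> where "\<delta> > 0" and \<delta>: "\<And>xs. family a b xs \<Longrightarrow> family_length xs < \<delta> \<Longrightarrow> family_var f xs < 1"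
    using assms(1) unfolding ac_on_iff_family by (meson zero_less_one)
  have small: "variation f x y \<le> 1" if "a \<le> x" "x \<le> y" "y \<le> b" "y - x < \<delta>" for x y
    unfolding variation_def
  proof (rule SUP_least)
    fix xs assume "xs \<in> Collect (family x y)"
    then have "family_var f xs < 1"
      using that by (intro \<delta>) (auto intro: family_mono le_less_trans[OF family_length_le])
    then show "ennreal (family_var f xs) \<le> 1" by (simp add: ennreal_le_1)
  qed
  have "variation f a (min b (a + real n * (\<delta>/2))) \<le> of_nat (n + 1)" for n
  proof (induction n)
    case 0
    show ?case using assms \<open>\<delta> > 0\<close> small[of a a] by simp
  next
    case (Suc n)
    let ?y = "min b (a + real n * (\<delta>/2))" and ?z = "min b (a + real (Suc n) * (\<delta>/2))"
    have le: "a \<le> ?y" "?y \<le> ?z" "?z - ?y < \<delta>"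
      using assms \<open>\<delta> > 0\<close> by (auto simp: min_def algebra_simps add_divide_distrib)
    have "variation f a ?z \<le> variation f a ?y + variation f ?y ?z"
      using le by (intro variation_subadd)
    also have "\<dots> \<le> of_nat (n + 1) + 1"
      using le by (intro add_mono Suc small) auto
    finally show ?case by (simp add: add.commute)
  qed
  moreover obtain n where "(b - a) / (\<delta>/2) < real n" using reals_Archimedean2 by blast
  then have "min b (a + real n * (\<delta>/2)) = b" using \<open>\<delta> > 0\<close> by (simp add: field_simps)
  ultimately show ?thesis
    by (metis ennreal_of_nat_eq_real_of_nat ennreal_less_top infinity_ennreal_def le_less_trans)
qed

text \<open>The bound passes from f to its variation by replacing the intervals of
  \<open>xs\<close>, one at a time, by arbitrary families inside them and taking the supremum. The
  accumulator \<open>zs\<close> holds the families already chosen; without it the induction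
  hypothesis could not see them.\<close>

lemma variation_sum_le:
  assumes \<delta>: "\<And>xs. family a b xs \<Longrightarrow> family_length xs < \<delta> \<Longrightarrow> family_var f xs < \<epsilon>"
    and "family a b (zs @ xs)" "family_length (zs @ xs) < \<delta>"
  shows "ennreal (family_var f zs) + (\<Sum>p\<leftarrow>xs. variation f (fst p) (snd p)) \<le> ennreal \<epsilon>"
  using assms(2,3)
proof (induction xs arbitrary: zs)
  case Nil
  then show ?case using \<delta>[of zs] by (auto intro!: ennreal_leI)
next
  case (Cons p xs)
  let ?S = "\<Sum>p\<leftarrow>xs. variation f (fst p) (snd p)"
  have p: "fst p \<le> snd p" using Cons.prems by (auto simp: family_def)
  have "ennreal (family_var f zs) + (variation f (fst p) (snd p) + ?S) =
    variation f (fst p) (snd p) + (ennreal (family_var f zs) + ?S)"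
    by (simp add: ac_simps)
  also have "\<dots> = (SUP ys\<in>Collect (family (fst p) (snd p)). ennreal (family_var f ys) + (ennreal (family_var f zs) + ?S))"
    unfolding variation_def[of f "fst p" "snd p"]
    by (subst ennreal_SUP_add_left[symmetric]) (auto intro!: exI[of _ "[]"] simp: family_def)
  also have "\<dots> \<le> ennreal \<epsilon>"
  proof (rule SUP_least)
    fix ys assume "ys \<in> Collect (family (fst p) (snd p))"
    then have ys: "family (fst p) (snd p) ys" by simp
    have "family a b ys" using ys Cons.prems(1) by (auto intro!: family_mono[OF ys] simp: family_def)
    moreover have "{fst q<..<snd q} \<subseteq> {fst p<..<snd p}" if "q \<in> set ys" for q
      using ys that unfolding family_def by fastforce
    then have "{fst q<..<snd q} \<inter> {fst r<..<snd r} = {}" if "q \<in> set ys" "r \<in> set zs \<union> set xs" for q r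
      using Cons.prems(1) that unfolding family_def sorted_wrt_append by (simp del: Int_greaterThanLessThan) blast
    then have "\<forall>q\<in>set ys. \<forall>r\<in>set zs. {fst r<..<snd r} \<inter> {fst q<..<snd q} = {}"
      "\<forall>q\<in>set ys. \<forall>r\<in>set xs. {fst q<..<snd q} \<inter> {fst r<..<snd r} = {}"
      by (blast, blast)
    ultimately have "family a b ((zs @ ys) @ xs)"
      using Cons.prems(1) unfolding family_def sorted_wrt_append by (simp add: ball_Un)
    moreover have "family_length ((zs @ ys) @ xs) < \<delta>"
      using Cons.prems(2) family_length_le[OF ys p] by simp
    ultimately have "ennreal (family_var f (zs @ ys)) + ?S \<le> ennreal \<epsilon>" by (rule Cons.IH)
    then show "ennreal (family_var f ys) + (ennreal (family_var f zs) + ?S) \<le> ennreal \<epsilon>"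
      by (simp add: ac_simps ennreal_plus)
  qed
  finally show ?case by simp
qed

text \<open>V is the variation function of f. The inequality makes both V and V - f nondecreasing,
  so f becomes a difference of monotone absolutely continuous functions.\<close>

lemma ac_on_diff_of_mono:
  fixes f :: "real \<Rightarrow> real"
  assumes ac: "ac_on a b f" and "a \<le> b"
  obtains V where "ac_on a b V" "\<And>x y. a \<le> x \<Longrightarrow> x \<le> y \<Longrightarrow> y \<le> b \<Longrightarrow> \<bar>f y - f x\<bar> \<le> V y - V x"
proof
  define V where "V x = enn2real (variation f a x)" for x
  have fin: "variation f a x < \<infinity>" if "a \<le> x" "x \<le> b" for x
    using that by (intro variation_finite ac_on_subset[OF ac]) auto
  have V: "variation f a x = ennreal (V x)" if "a \<le> x" "x \<le> b" for x
    using fin[OF that] by (simp add: V_def)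
  have V0: "V x \<ge> 0" for x by (simp add: V_def)
  show mono: "\<bar>f y - f x\<bar> \<le> V y - V x" if "a \<le> x" "x \<le> y" "y \<le> b" for x y
    using variation_mono_add[OF that(1,2), of f] that V0 by (simp add: V flip: ennreal_plus)
  have sub: "ennreal (V y - V x) \<le> variation f x y" if "a \<le> x" "x \<le> y" "y \<le> b" for x y
  proof -
    have "ennreal (V y) \<le> ennreal (V x) + variation f x y"
      using variation_subadd[OF that(1,2), of f] that by (simp add: V)
    then have "ennreal (V y) - ennreal (V x) \<le> variation f x y"
      by (simp add: ennreal_minus_le_iff)
    then show ?thesis by (simp add: ennreal_minus V0)
  qed
  show "ac_on a b V"
    unfolding ac_on_iff_family
  proof (intro allI impI)
    fix e :: real assume "e > 0"
    \<comment> \<open>Half of e is used because \<open>variation_sum_le\<close> only returns a weak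
      inequality.\<close>
    with ac obtain \<delta> where "\<delta> > 0" and \<delta>: "\<And>xs. family a b xs \<Longrightarrow> family_length xs < \<delta> \<Longrightarrow> family_var f xs < e/2"
      unfolding ac_on_iff_family by (meson half_gt_zero)
    have "family_var V xs < e" if fam: "family a b xs" and len: "family_length xs < \<delta>" for xs
    proof -
      have "ennreal (family_var V xs) \<le> (\<Sum>p\<leftarrow>xs. variation f (fst p) (snd p))"
        using fam
      proof (induction xs)
        case (Cons p xs)
        have p: "a \<le> fst p" "fst p \<le> snd p" "snd p \<le> b" using Cons.prems by (auto simp: family_def)
        have "V (fst p) \<le> V (snd p)" using mono[OF p] by linarith
        then show ?case using Cons sub[OF p] by (auto simp: family_def ennreal_plus intro!: add_mono)
      qed auto
      also have "\<dots> \<le> ennreal (e/2)"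
        using variation_sum_le[of a b \<delta> f "e/2" "[]" xs, OF \<delta>] fam len by simp
      finally have "family_var V xs \<le> e/2" using \<open>e > 0\<close> by (simp add: ennreal_le_iff)
      then show ?thesis using \<open>e > 0\<close> by simp
    qed
    with \<open>\<delta> > 0\<close> show "\<exists>\<delta>>0. \<forall>xs. family a b xs \<longrightarrow> family_length xs < \<delta> \<longrightarrow> family_var V xs < e" by blast
  qed
qed

section \<open>Densities of absolutely continuous functions by the Radon-Nikodym theorem\<close>

lemma ac_on_clamp_uniform:
  assumes "ac_on a b f" "a \<le> b" "\<epsilon> > 0"
  obtains \<delta> where "\<delta> > 0" "\<And>x y xs. family x y xs \<Longrightarrow> family_length xs < \<delta> \<Longrightarrow> family_var (\<lambda>t. f (max a (min b t))) xs < \<epsilon>"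
proof -
  have eq: "family_var (\<lambda>t. f (max a (min b t))) xs = family_var f (clamp_family a b xs)" for xs
    by (induction xs) (auto simp: clamp_family_def)
  obtain \<delta> where "\<delta> > 0" "\<And>xs. family a b xs \<Longrightarrow> family_length xs < \<delta> \<Longrightarrow> family_var f xs < \<epsilon>"
    using assms unfolding ac_on_iff_family by blast
  then show ?thesis
    by (intro that[of \<delta>]) (auto simp: eq intro!: family_clamp assms le_less_trans[OF family_length_clamp_le])
qed

text \<open>Outer regularity puts a null set into an open U of Lebesgue measure below \<delta>. U is
  an increasing union of finite unions of boxes, each of which is a finite family of non-overlapping
  intervals of total length below \<delta>; its Stieltjes measure is the variation sum of F, hence
  below \<epsilon>. Continuity from below carries the bound to U.\<close>

lemma absolutely_continuous_interval_measure:
  fixes F :: "real \<Rightarrow> real"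
  assumes mono: "\<And>x y. x \<le> y \<Longrightarrow> F x \<le> F y" and cont: "continuous_on UNIV F"
    and ac: "\<And>\<epsilon>. \<epsilon> > 0 \<Longrightarrow> \<exists>\<delta>>0. \<forall>x y xs. family x y xs \<longrightarrow> family_length xs < \<delta> \<longrightarrow> family_var F xs < \<epsilon>"
  shows "absolutely_continuous lborel (interval_measure F)"
  unfolding absolutely_continuous_def
proof
  let ?\<mu> = "interval_measure F"
  fix N assume N: "N \<in> null_sets (lborel :: real measure)"
  then have Nb: "N \<in> sets borel" by (simp add: null_sets_def)
  have "emeasure ?\<mu> N \<le> 0 + ennreal \<epsilon>" if "\<epsilon> > 0" for \<epsilon> :: real
  proof -
    obtain \<delta> where "\<delta> > 0" and \<delta>: "\<And>x y xs. family x y xs \<Longrightarrow> family_length xs < \<delta> \<Longrightarrow> family_var F xs < \<epsilon>"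
      using ac[OF \<open>\<epsilon> > 0\<close>] by metis
    obtain U where U: "open U" "N \<subseteq> U" "emeasure lborel (U - N) < ennreal \<delta>"
      using outer_regular_lborel[OF Nb \<open>\<delta> > 0\<close>] by metis
    have Ud: "emeasure lborel U < ennreal \<delta>"
      using U N Nb emeasure_Diff_null_set[of N lborel U] by auto
    have fin: "emeasure ?\<mu> (\<Union>\<C>) \<le> ennreal \<epsilon>"
      if \<C>: "finite \<C>" "\<And>k. k \<in> \<C> \<Longrightarrow> \<exists>l r. k = cbox l r" "\<Union>\<C> \<subseteq> U" for \<C> :: "real set set"
    proof -
      \<comment> \<open>The boxes may overlap; a division of their union consists of intervals with
        disjoint interiors, as a family requires.\<close>
      obtain p where p: "p division_of \<Union>\<C>"
        using elementary_unions_intervals[OF \<C>(1,2)] by metis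
      have finp: "finite p" using p by auto
      have k: "Inf k \<le> Sup k \<and> k = {Inf k..Sup k}" if "k \<in> p" for k
      proof -
        obtain l r where "k = cbox l r" "k \<noteq> {}" using division_ofD(3,4)[OF p \<open>k \<in> p\<close>] by blast
        then show ?thesis by (auto simp: cbox_interval)
      qed
      obtain ks where ks: "set ks = p" "distinct ks"
        using finite_distinct_list[OF finp] by blast
      define xs where "xs = map (\<lambda>k. (Inf k, Sup k)) ks"
      have bd: "\<exists>x y. \<forall>k\<in>p. x \<le> Inf k \<and> Sup k \<le> y"
      proof -
        have "Min (insert 0 (Inf ` p)) \<le> Inf k \<and> Sup k \<le> Max (insert 0 (Sup ` p))" if "k \<in> p" for k
          using finp that by auto
        then show ?thesis by blast
      qed
      then obtain x y where xy: "\<And>k. k \<in> p \<Longrightarrow> x \<le> Inf k \<and> Sup k \<le> y" by blast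
      have sw: "sorted_wrt (\<lambda>k k'. interior k \<inter> interior k' = {}) ks"
        unfolding sorted_wrt_iff_nth_less
      proof (intro allI impI)
        fix i j assume ij: "i < j" "j < length ks"
        show "interior (ks ! i) \<inter> interior (ks ! j) = {}"
          by (rule division_ofD(5)[OF p]) (use ij ks in \<open>auto simp: nth_eq_iff_index_eq\<close>)
      qed
      have "sorted_wrt (\<lambda>k k'. {Inf k<..<Sup k} \<inter> {Inf k'<..<Sup k'} = {}) ks"
      proof (rule sorted_wrt_mono_rel[OF _ sw])
        fix k k' assume kk: "k \<in> set ks" "k' \<in> set ks" "interior k \<inter> interior k' = {}"
        have "interior k = {Inf k<..<Sup k}" "interior k' = {Inf k'<..<Sup k'}"
          using k[of k] k[of k'] kk ks interior_atLeastAtMost_real[of "Inf k" "Sup k"] interior_atLeastAtMost_real[of "Inf k'" "Sup k'"] by auto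
        then show "{Inf k<..<Sup k} \<inter> {Inf k'<..<Sup k'} = {}" using kk by simp
      qed
      then have fam: "family x y xs"
        unfolding family_def xs_def using ks xy k by (auto simp: sorted_wrt_map)
      have "family_length xs = (\<Sum>k\<in>p. Sup k - Inf k)"
        using ks by (simp add: family_length_def xs_def o_def sum_list_distinct_conv_sum_set)
      also have "\<dots> = (\<Sum>k\<in>p. measure lebesgue k)"
      proof (intro sum.cong refl)
        fix kk assume "kk \<in> p"
        then have *: "Inf kk \<le> Sup kk" "kk = {Inf kk..Sup kk}" using k by auto
        have "measure lebesgue {Inf kk..Sup kk} = Sup kk - Inf kk" using *(1) by simp
        then show "Sup kk - Inf kk = measure lebesgue kk" using *(2) by simp
      qed
      also have "\<dots> = measure lebesgue (\<Union>\<C>)" by (rule content_division[OF p])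
      also have "\<dots> < \<delta>"
      proof -
        have "emeasure lebesgue (\<Union>\<C>) \<le> emeasure lebesgue U"
          using \<C> U by (intro emeasure_mono) (auto simp: borel_open)
        also have "\<dots> < ennreal \<delta>" using Ud U by (simp add: borel_open)
        finally show ?thesis
          using \<open>\<delta> > 0\<close> by (simp add: emeasure_eq_measure2[OF lmeasurable_division[OF p]] ennreal_less_iff)
      qed
      finally have len: "family_length xs < \<delta>" .
      have "emeasure ?\<mu> (\<Union>\<C>) = emeasure ?\<mu> (\<Union>k\<in>p. k)" using division_ofD(6)[OF p] by simp
      also have "\<dots> \<le> (\<Sum>k\<in>p. emeasure ?\<mu> k)"
      proof (rule emeasure_subadditive_finite[OF finp])
        show "(\<lambda>k. k) ` p \<subseteq> sets ?\<mu>"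
        proof clarsimp
          fix kk assume "kk \<in> p"
          then have "kk = {Inf kk..Sup kk}" using k by blast
          also have "\<dots> \<in> sets borel" by simp
          finally show "kk \<in> sets borel" .
        qed
      qed
      also have "\<dots> = (\<Sum>k\<in>p. ennreal (norm (F (Sup k) - F (Inf k))))"
      proof (intro sum.cong refl)
        fix kk assume "kk \<in> p"
        then have *: "Inf kk \<le> Sup kk" "kk = {Inf kk..Sup kk}" using k by auto
        have "emeasure ?\<mu> {Inf kk..Sup kk} = ennreal (F (Sup kk) - F (Inf kk))"
          using emeasure_interval_measure_Icc[OF *(1) mono cont] by simp
        then show "emeasure ?\<mu> kk = ennreal (norm (F (Sup kk) - F (Inf kk)))"
          using * mono[OF *(1)] by simp
      qed
      also have "\<dots> = ennreal (family_var F xs)"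
        using ks by (simp add: family_var_def xs_def o_def sum_list_distinct_conv_sum_set)
      also have "\<dots> \<le> ennreal \<epsilon>" using \<delta>[OF fam len] by (intro ennreal_leI) simp
      finally show ?thesis .
    qed
    obtain \<D> where \<D>: "countable \<D>" "\<D> \<subseteq> Pow U" "\<And>X. X \<in> \<D> \<Longrightarrow> \<exists>l r. X = cbox l r" "\<Union>\<D> = U"
      using open_countable_Union_open_cbox[OF U(1)] by metis
    define f where "f n = (if \<D> = {} then {} else from_nat_into \<D> n)" for n :: nat
    have f: "\<exists>l r. f n = cbox l r" "f n \<subseteq> U" for n
    proof -
      have "{} = cbox 1 (0::real)" by simp
      then show "\<exists>l r. f n = cbox l r"
        using \<D>(3) from_nat_into[of \<D> n] unfolding f_def by metis
      show "f n \<subseteq> U" using \<D>(2) from_nat_into[of \<D> n] by (auto simp: f_def)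
    qed
    have "(\<Union>n. f n) = U"
    proof (cases "\<D> = {}")
      case False
      then have "range f = \<D>" using \<D>(1) by (simp add: f_def[abs_def] range_from_nat_into)
      then show ?thesis using \<D>(4) by simp
    qed (use \<D>(4) in \<open>simp add: f_def\<close>)
    then have Uf: "(\<Union>n. \<Union>i<n. f i) = U" using UN_UN_finite_eq[of f] by (simp add: atLeast0LessThan)
    have fb: "f n \<in> sets borel" for n using f(1)[of n] by auto
    have "emeasure ?\<mu> N \<le> emeasure ?\<mu> U" using U by (intro emeasure_mono) (auto simp: borel_open)
    also have "\<dots> = (SUP n. emeasure ?\<mu> (\<Union>i<n. f i))"
      unfolding Uf[symmetric]
    proof (rule SUP_emeasure_incseq[symmetric])
      show "range (\<lambda>n. \<Union>i<n. f i) \<subseteq> sets ?\<mu>" using fb by (simp add: image_subset_iff sets.finite_UN)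
      show "incseq (\<lambda>n. \<Union>i<n. f i)" by (rule incseq_SucI) (simp add: lessThan_Suc subset_insertI Un_upper2)
    qed
    also have "\<dots> \<le> ennreal \<epsilon>"
    proof (rule SUP_least)
      fix n show "emeasure ?\<mu> (\<Union>i<n. f i) \<le> ennreal \<epsilon>"
        by (rule fin) (use f in auto)
    qed
    finally show ?thesis by simp
  qed
  then have "emeasure ?\<mu> N \<le> 0" by (rule ennreal_le_epsilon)
  then show "N \<in> null_sets ?\<mu>" using Nb by (auto simp: null_sets_def)
qed

text \<open>The density is the Radon-Nikodym derivative of the Stieltjes measure of F with respect
  to Lebesgue measure.\<close>

lemma mono_ac_density:
  fixes F :: "real \<Rightarrow> real"
  assumes ac: "ac_on a b F" and "a \<le> b" and mono: "\<And>x y. a \<le> x \<Longrightarrow> x \<le> y \<Longrightarrow> y \<le> b \<Longrightarrow> F x \<le> F y"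
  obtains g where "g absolutely_integrable_on {a..b}" "\<And>x. x \<in> {a..b} \<Longrightarrow> F x = F a + integral {a..x} g"
proof -
  \<comment> \<open>Continuation of F by constants, since \<open>interval_measure\<close> wants a
    function that is monotone on the whole line.\<close>
  define G where "G t = F (max a (min b t))" for t
  have monoG: "x \<le> y \<Longrightarrow> G x \<le> G y" for x y unfolding G_def using \<open>a \<le> b\<close> by (intro mono) auto
  have "continuous_on UNIV (\<lambda>t. F (max a (min b t)))"
    by (rule continuous_on_compose2[OF ac_on_continuous[OF ac]]) (use \<open>a \<le> b\<close> in \<open>auto intro!: continuous_intros\<close>)
  then have contG: "continuous_on UNIV G" by (simp add: G_def[abs_def])
  have "absolutely_continuous lborel (interval_measure G)"
    using monoG contG
  proof (rule absolutely_continuous_interval_measure)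
    fix \<epsilon> :: real assume "\<epsilon> > 0"
    from ac_on_clamp_uniform[OF ac \<open>a \<le> b\<close> this]
    show "\<exists>\<delta>>0. \<forall>x y xs. family x y xs \<longrightarrow> family_length xs < \<delta> \<longrightarrow> family_var G xs < \<epsilon>"
      unfolding G_def[abs_def] by metis
  qed
  from sigma_finite_measure.Radon_Nikodym[OF sigma_finite_lborel this] obtain f where f[measurable]: "f \<in> borel_measurable borel"
    and dens: "density lborel f = interval_measure G" by auto
  have nn: "(\<integral>\<^sup>+t\<in>{a..x}. f t \<partial>lborel) = ennreal (F x - F a)" if "x \<in> {a..b}" for x
  proof -
    have "(\<integral>\<^sup>+t\<in>{a..x}. f t \<partial>lborel) = emeasure (density lborel f) {a..x}"
      by (simp add: emeasure_density)
    also have "\<dots> = ennreal (G x - G a)" unfolding dens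
      using that emeasure_interval_measure_Icc[OF _ monoG contG] by simp
    finally show ?thesis using that by (simp add: G_def)
  qed
  \<comment> \<open>On [a, b] the density is infinite only on a null set, because its integral there
    is finite; the value that \<open>enn2real\<close> assigns on that set is harmless.\<close>
  define g where "g t = enn2real (f t)" for t
  have [measurable]: "g \<in> borel_measurable borel" unfolding g_def[abs_def] by measurable
  have "AE t in lborel. f t * indicator {a..b} t \<noteq> \<infinity>"
    using nn[of b] \<open>a \<le> b\<close> by (intro nn_integral_PInf_AE) auto
  then have fg: "AE t in lborel. t \<in> {a..b} \<longrightarrow> f t = ennreal (g t)"
    by eventually_elim (auto simp: g_def less_top)
  have hi: "set_integrable lborel {a..x} g" "(LINT t:{a..x}|lborel. g t) = F x - F a" if x: "x \<in> {a..b}" for x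
  proof -
    have "(\<integral>\<^sup>+t. ennreal (indicator {a..x} t *\<^sub>R g t) \<partial>lborel) = (\<integral>\<^sup>+t\<in>{a..x}. f t \<partial>lborel)"
      using fg x by (intro nn_integral_cong_AE) (auto elim!: eventually_mono simp: indicator_def)
    then have *: "(\<integral>\<^sup>+t. ennreal (indicator {a..x} t *\<^sub>R g t) \<partial>lborel) = ennreal (F x - F a)" using nn[OF x] by simp
    have g0: "AE t in lborel. 0 \<le> indicator {a..x} t *\<^sub>R g t" by (auto simp: g_def indicator_def)
    have "F x - F a \<ge> 0" using mono[of a x] x by auto
    have m: "(\<lambda>t. indicator {a..x} t *\<^sub>R g t) \<in> borel_measurable lborel" by measurable
    show "set_integrable lborel {a..x} g"
      unfolding set_integrable_def by (rule integrableI_nn_integral_finite[OF m g0 *])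
    show "(LINT t:{a..x}|lborel. g t) = F x - F a"
      unfolding set_lebesgue_integral_def using \<open>F x - F a \<ge> 0\<close> by (subst integral_eq_nn_integral[OF m g0]) (simp only: * enn2real_ennreal)
  qed
  show ?thesis
  proof
    show "g absolutely_integrable_on {a..b}" using hi(1)[of b] \<open>a \<le> b\<close>
      unfolding set_integrable_def by (simp add: integrable_completion)
    show "F x = F a + integral {a..x} g" if "x \<in> {a..b}" for x
      using set_borel_integral_eq_integral(2)[OF hi(1)[OF that]] hi(2)[OF that] by simp
  qed
qed

lemma ac_on_by_variation:
  assumes "ac_on a b f" "ac_on a b g"
    and le: "\<And>xs. family a b xs \<Longrightarrow> family_var h xs \<le> K * (family_var f xs + family_var g xs)"
  shows "ac_on a b h"
  unfolding ac_on_iff_family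
proof (intro allI impI)
  fix e :: real assume "e > 0"
  \<comment> \<open>The factor \<open>\<bar>K\<bar> + 1\<close> is positive whatever the sign of
    K.\<close>
  define e' where "e' = e / (2 * (\<bar>K\<bar> + 1))"
  have "e' > 0" using \<open>e > 0\<close> by (simp add: e'_def field_simps add_pos_nonneg)
  obtain d1 where "d1 > 0" and d1: "\<And>xs. family a b xs \<Longrightarrow> family_length xs < d1 \<Longrightarrow> family_var f xs < e'"
    using assms(1) \<open>e' > 0\<close> unfolding ac_on_iff_family by blast
  obtain d2 where "d2 > 0" and d2: "\<And>xs. family a b xs \<Longrightarrow> family_length xs < d2 \<Longrightarrow> family_var g xs < e'"
    using assms(2) \<open>e' > 0\<close> unfolding ac_on_iff_family by blast
  have "family_var h xs < e" if xs: "family a b xs" "family_length xs < min d1 d2" for xs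
  proof -
    have "family_var h xs \<le> K * (family_var f xs + family_var g xs)" by (rule le[OF xs(1)])
    also have "\<dots> \<le> (\<bar>K\<bar> + 1) * (family_var f xs + family_var g xs)" by (intro mult_right_mono) auto
    also have "\<dots> < (\<bar>K\<bar> + 1) * (e' + e')"
      using d1[of xs] d2[of xs] xs by (intro mult_strict_left_mono add_strict_mono) auto
    also have "\<dots> = e" unfolding e'_def by (simp add: field_simps add_nonneg_eq_0_iff)
    finally show ?thesis .
  qed
  then show "\<exists>d>0. \<forall>xs. family a b xs \<longrightarrow> family_length xs < d \<longrightarrow> family_var h xs < e"
    using \<open>d1 > 0\<close> \<open>d2 > 0\<close> by (intro exI[of _ "min d1 d2"]) auto
qed

lemma real_ac_density:
  fixes f :: "real \<Rightarrow> real"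
  assumes ac: "ac_on a b f" and "a \<le> b"
  obtains g where "g absolutely_integrable_on {a..b}" "\<And>x. x \<in> {a..b} \<Longrightarrow> f x = f a + integral {a..x} g"
proof -
  obtain V where V: "ac_on a b V" and mono: "\<And>x y. a \<le> x \<Longrightarrow> x \<le> y \<Longrightarrow> y \<le> b \<Longrightarrow> \<bar>f y - f x\<bar> \<le> V y - V x"
    using ac_on_diff_of_mono[OF assms] by metis
  have acW: "ac_on a b (\<lambda>x. V x - f x)"
  proof (rule ac_on_by_variation[OF ac V])
    show "family_var (\<lambda>x. V x - f x) xs \<le> 1 * (family_var f xs + family_var V xs)" for xs
      by (induction xs) auto
  qed
  have monoV: "V x \<le> V y" and monoW: "V x - f x \<le> V y - f y" if "a \<le> x" "x \<le> y" "y \<le> b" for x y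
    using mono[OF that] by linarith+
  obtain g1 where g1: "g1 absolutely_integrable_on {a..b}" "\<And>x. x \<in> {a..b} \<Longrightarrow> V x = V a + integral {a..x} g1"
    using mono_ac_density[OF V \<open>a \<le> b\<close> monoV] by blast
  obtain g2 where g2: "g2 absolutely_integrable_on {a..b}" "\<And>x. x \<in> {a..b} \<Longrightarrow> V x - f x = V a - f a + integral {a..x} g2"
    using mono_ac_density[OF acW \<open>a \<le> b\<close> monoW] by blast
  show ?thesis
  proof
    show "(\<lambda>x. g1 x - g2 x) absolutely_integrable_on {a..b}" by (rule set_integral_diff(1)[OF g1(1) g2(1)])
    fix x assume x: "x \<in> {a..b}"
    have "g1 integrable_on {a..x}" "g2 integrable_on {a..x}"
      using g1(1) g2(1) x by (auto intro: integrable_on_subinterval set_lebesgue_integral_eq_integral(1))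
    then have "integral {a..x} (\<lambda>x. g1 x - g2 x) = integral {a..x} g1 - integral {a..x} g2"
      by (rule integral_diff)
    then show "f x = f a + integral {a..x} (\<lambda>x. g1 x - g2 x)" using g1(2)[OF x] g2(2)[OF x] by simp
  qed
qed

section \<open>Lebesgue differentiation\<close>

text \<open>Truncate the norm of h at height n. Dominated convergence makes the part above n
  contribute less than e/2, and the truncated function contributes at most n times the measure of
  T.\<close>

lemma absolute_continuity_integral:
  fixes h :: "real \<Rightarrow> 'a::euclidean_space"
  assumes h: "h absolutely_integrable_on {a..b}" and "e > 0"
  obtains d where "d > 0"
    "\<And>T. T \<in> lmeasurable \<Longrightarrow> T \<subseteq> {a..b} \<Longrightarrow> measure lebesgue T < d \<Longrightarrow> integral T (\<lambda>x. norm (h x)) < e"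
proof -
  let ?k = "\<lambda>x. norm (h x)"
  let ?f = "\<lambda>n x. min (?k x) (real n)"
  have k: "?k absolutely_integrable_on {a..b}" by (rule absolutely_integrable_norm[unfolded o_def, OF h])
  have f: "?f n absolutely_integrable_on {a..b}" for n
    by (intro absolutely_integrable_min_1 k) (simp add: absolutely_integrable_on_const)
  have conv: "(\<lambda>n. integral {a..b} (?f n)) \<longlonglongrightarrow> integral {a..b} ?k"
  proof (rule dominated_convergence(2)[where h="?k"])
    show "(\<lambda>n. ?f n x) \<longlonglongrightarrow> ?k x" for x
    proof (rule tendsto_eventually)
      obtain n0 where "?k x \<le> real n0" using real_arch_simple by blast
      then show "\<forall>\<^sub>F n in sequentially. ?f n x = ?k x"
        by (intro eventually_sequentiallyI[of n0]) (auto simp: min_def)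
    qed
  qed (use k f in \<open>auto simp: absolutely_integrable_on_def\<close>)
  then obtain n where n: "\<bar>integral {a..b} (?f n) - integral {a..b} ?k\<bar> < e/2"
    using \<open>e > 0\<close> unfolding lim_sequentially dist_real_def by (meson half_gt_zero le_refl)
  \<comment> \<open>\<open>Suc n\<close> keeps the divisor nonzero when n = 0.\<close>
  define d where "d = e / 2 / real (Suc n)"
  have "d > 0" using \<open>e > 0\<close> by (simp add: d_def)
  show ?thesis
  proof
    fix T assume T: "T \<in> lmeasurable" "T \<subseteq> {a..b}" "measure lebesgue T < d"
    have Ts: "T \<in> sets lebesgue" using T by auto
    have kT: "?k integrable_on T" and fT: "?f n integrable_on T"
      using set_integrable_subset[OF k Ts T(2)] set_integrable_subset[OF f Ts T(2)]
      by (auto simp: absolutely_integrable_on_def)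
    have "integral T ?k - integral T (?f n) = integral T (\<lambda>x. ?k x - ?f n x)"
      by (rule integral_diff[symmetric, OF kT fT])
    also have "\<dots> \<le> integral {a..b} (\<lambda>x. ?k x - ?f n x)"
      by (intro integral_subset_le T integrable_diff kT fT) (use k f in \<open>auto simp: absolutely_integrable_on_def intro: integrable_diff\<close>)
    also have "\<dots> = integral {a..b} ?k - integral {a..b} (?f n)"
      by (intro integral_diff) (use k f in \<open>auto simp: absolutely_integrable_on_def\<close>)
    also have "\<dots> < e/2" using n unfolding abs_less_iff by linarith
    finally have 1: "integral T ?k < integral T (?f n) + e/2" by simp
    have "integral T (?f n) \<le> integral T (\<lambda>x. real n)"
      by (intro integral_le fT integrable_on_const T) auto
    also have "\<dots> = real n * measure lebesgue T"
      using integral_mult_right[of T "real n" "\<lambda>x. 1"] by (simp add: lmeasure_integral[OF T(1)])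
    also have "\<dots> \<le> real (Suc n) * d" using T(3) by (intro mult_mono) auto
    also have "\<dots> = e/2" by (simp add: d_def del: of_nat_Suc)
    finally show "integral T ?k < e" using 1 by simp
  qed fact
qed

text \<open>Let E be the zero set of h and U an open set slightly larger than E. The integral of h
  over U is small, since only U - E contributes. Each point of the set lies in an interval inside U
  on which the mean of h exceeds e; disjoint such intervals have small total length, and by Vitali's
  covering lemma their fivefold enlargements cover the set.\<close>

lemma negligible_upper_density:
  fixes h :: "real \<Rightarrow> real"
  assumes h: "h absolutely_integrable_on {a..b}" and h0: "\<And>x. 0 \<le> h x" and "e > 0"
  shows "negligible {x \<in> {a<..<b}. h x = 0 \<and>
    (\<forall>d>0. \<exists>y z. a \<le> y \<and> y \<le> x \<and> x \<le> z \<and> z \<le> b \<and> y < z \<and> z - y < d \<and> integral {y..z} h > e * (z - y))}"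
    (is "negligible ?A")
  unfolding negligible_outer_le
proof (intro allI impI)
  fix \<eta> :: real assume "\<eta> > 0"
  \<comment> \<open>Disjoint intervals with means above e have total length at most \<eta>'/e =
    \<eta>/5; the 5 is the enlargement factor of Vitali's lemma.\<close>
  define \<eta>' where "\<eta>' = e * \<eta> / 5"
  have "\<eta>' > 0" using \<open>e > 0\<close> \<open>\<eta> > 0\<close> by (simp add: \<eta>'_def)
  obtain d where "d > 0" and
    d: "\<And>T. T \<in> lmeasurable \<Longrightarrow> T \<subseteq> {a..b} \<Longrightarrow> measure lebesgue T < d \<Longrightarrow> integral T (\<lambda>x. norm (h x)) < \<eta>'"
    by (rule absolute_continuity_integral[OF h \<open>\<eta>' > 0\<close>]) blast
  define E where "E = {x \<in> {a..b}. h x = 0}"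
  have "h \<in> borel_measurable (lebesgue_on {a..b})"
    using h by (intro integrable_imp_measurable) (simp add: absolutely_integrable_on_def)
  then have "{x \<in> space (lebesgue_on {a..b}). h x = 0} \<in> sets (lebesgue_on {a..b})"
    by measurable
  then have E: "E \<in> sets lebesgue" by (auto simp: E_def sets_restrict_space_iff)
  obtain U where U: "open U" "E \<subseteq> U" "U - E \<in> lmeasurable" "emeasure lebesgue (U - E) < ennreal d"
    using sets_lebesgue_outer_open[OF E \<open>d > 0\<close>] by metis
  have UEd: "measure lebesgue (U - E) < d"
    using U(3,4) \<open>d > 0\<close> by (simp add: emeasure_eq_measure2 ennreal_less_iff)
  define V where "V = U \<inter> {a..b}"
  have V: "V \<in> sets lebesgue" using U(1) by (auto simp: V_def borel_open)
  have VE: "V - E \<in> lmeasurable" "V - E \<subseteq> {a..b}" "measure lebesgue (V - E) < d"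
  proof -
    show "V - E \<subseteq> {a..b}" by (auto simp: V_def)
    show "V - E \<in> lmeasurable"
      by (rule fmeasurableI2[OF U(3)]) (use V E in \<open>auto simp: V_def\<close>)
    then show "measure lebesgue (V - E) < d"
    proof -
      have "V - E \<subseteq> U - E" by (auto simp: V_def)
      then have "measure lebesgue (V - E) \<le> measure lebesgue (U - E)"
        by (rule measure_mono_fmeasurable) (use V E U(3) in auto)
      then show ?thesis using UEd by simp
    qed
  qed
  have hV: "h integrable_on V"
    using set_integrable_subset[OF h V] by (auto simp: V_def absolutely_integrable_on_def)
  have "integral V h = integral (V - E) h"
  proof -
    have "(\<lambda>x. if x \<in> V then h x else 0) = (\<lambda>x. if x \<in> V - E then h x else 0)"
      by (auto simp: E_def V_def fun_eq_iff)
    then show ?thesis by (metis integral_restrict_UNIV)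
  qed
  also have "\<dots> < \<eta>'" using d[OF VE] h0 by simp
  finally have intV: "integral V h < \<eta>'" .
  define K where "K = {(y,z). y < z \<and> {y..z} \<subseteq> V \<and> integral {y..z} h > e * (z - y)}"
  let ?c = "\<lambda>p. (fst p + snd p) / 2" and ?r = "\<lambda>p. (snd p - fst p) / (2::real)"
  have ball: "cball (?c p) (?r p) = {fst p..snd p}" for p :: "real \<times> real"
    by (auto simp: cball_def dist_real_def abs_if field_simps)
  have cov: "?A \<subseteq> (\<Union>p\<in>K. cball (?c p) (?r p))"
  proof
    fix x assume x: "x \<in> ?A"
    then have "x \<in> U" using U(2) by (auto simp: E_def)
    then obtain r where "r > 0" "ball x r \<subseteq> U" using U(1) open_contains_ball by blast
    then obtain y z where yz: "a \<le> y" "y \<le> x" "x \<le> z" "z \<le> b" "y < z" "z - y < r" "integral {y..z} h > e * (z - y)"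
      using x by blast
    have "{y..z} \<subseteq> ball x r" using yz by (auto simp: ball_def dist_real_def)
    then have "(y,z) \<in> K" using yz \<open>ball x r \<subseteq> U\<close> by (auto simp: K_def V_def)
    moreover have "x \<in> cball (?c (y,z)) (?r (y,z))" unfolding ball using yz by simp
    ultimately show "x \<in> (\<Union>p\<in>K. cball (?c p) (?r p))" by blast
  qed
  have rK: "0 < ?r p \<and> ?r p \<le> \<bar>b - a\<bar>" if "p \<in> K" for p
  proof -
    have "fst p < snd p" "{fst p..snd p} \<subseteq> {a..b}" using that by (auto simp: K_def V_def)
    then show ?thesis by auto
  qed
  obtain C where C: "countable C" "C \<subseteq> K"
     "pairwise (\<lambda>i j. disjnt (cball (?c i) (?r i)) (cball (?c j) (?r j))) C"
     "?A \<subseteq> (\<Union>i\<in>C. cball (?c i) (5 * ?r i))"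
    by (rule Vitali_covering_lemma_cballs[OF cov rK]) auto
  have mball: "measure lebesgue (cball (?c p) (5 * ?r p)) = 5 * (snd p - fst p)" if "p \<in> K" for p
  proof -
    have "cball (?c p) (5 * ?r p) = {?c p - 5 * ?r p .. ?c p + 5 * ?r p}"
      by (auto simp: cball_def dist_real_def abs_if field_simps)
    then show ?thesis using rK[OF that] by (simp add: field_simps)
  qed
  have bound: "(\<Sum>p\<in>J. measure lebesgue (cball (?c p) (5 * ?r p))) \<le> \<eta>" if "J \<subseteq> C" "finite J" for J
  proof -
    have JK: "J \<subseteq> K" using that C by blast
    have hi: "(h has_integral integral {fst p..snd p} h) {fst p..snd p}" if "p \<in> J" for p
    proof -
      have "{fst p..snd p} \<subseteq> {a..b}" using JK that by (auto simp: K_def V_def)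
      then have "h absolutely_integrable_on {fst p..snd p}" using h absolutely_integrable_on_subinterval by blast
      then show ?thesis by (simp add: absolutely_integrable_on_def has_integral_integral)
    qed
    have disj: "pairwise (\<lambda>i i'. negligible ({fst i..snd i} \<inter> {fst i'..snd i'})) J"
      using C(3) that(1) unfolding ball pairwise_def disjnt_def by (metis negligible_empty subsetD)
    have U: "(h has_integral (\<Sum>p\<in>J. integral {fst p..snd p} h)) (\<Union>p\<in>J. {fst p..snd p})"
      by (rule has_integral_UN[OF that(2) hi disj])
    have sub: "(\<Union>p\<in>J. {fst p..snd p}) \<subseteq> V" using JK unfolding K_def by fastforce
    have "e * (\<Sum>p\<in>J. snd p - fst p) \<le> (\<Sum>p\<in>J. integral {fst p..snd p} h)"
      unfolding sum_distrib_left using JK by (intro sum_mono) (auto simp: K_def)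
    also have "\<dots> = integral (\<Union>p\<in>J. {fst p..snd p}) h" using U by (simp add: integral_unique)
    also have "\<dots> \<le> integral V h"
      using U sub hV h0 by (intro integral_subset_le) auto
    also have "\<dots> \<le> \<eta>'" using intV by simp
    finally have "5 * (\<Sum>p\<in>J. snd p - fst p) \<le> \<eta>" using \<open>e > 0\<close> by (simp add: \<eta>'_def field_simps)
    moreover have "(\<Sum>p\<in>J. measure lebesgue (cball (?c p) (5 * ?r p))) = (\<Sum>p\<in>J. 5 * (snd p - fst p))"
      by (intro sum.cong refl mball) (use JK in auto)
    ultimately show ?thesis by (simp add: sum_distrib_left)
  qed
  have bound': "measure lebesgue (\<Union>p\<in>J. cball (?c p) (5 * ?r p)) \<le> \<eta>" if "J \<subseteq> C" "finite J" for J
    by (rule order_trans[OF measure_UNION_le bound]) (use that in auto)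
  show "\<exists>T. ?A \<subseteq> T \<and> T \<in> lmeasurable \<and> measure lebesgue T \<le> \<eta>"
  proof (intro exI conjI)
    show "?A \<subseteq> (\<Union>i\<in>C. cball (?c i) (5 * ?r i))" by fact
    show "(\<Union>i\<in>C. cball (?c i) (5 * ?r i)) \<in> lmeasurable"
      by (rule fmeasurable_UN_bound[OF C(1) _ bound']) auto
    show "measure lebesgue (\<Union>i\<in>C. cball (?c i) (5 * ?r i)) \<le> \<eta>"
      by (rule measure_UN_bound[OF C(1) _ bound']) auto
  qed
qed

text \<open>For rational \<open>r\<close>, the mean of \<open>g\<close> over a short interval exceeds \<open>r\<close> at most by the mean of
  \<open>max (g - r) 0\<close>, and this function has density zero at almost every point of its zero set \<open>{g \<le> r}\<close>.\<close>

lemma Lebesgue_upper_derivative: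
  fixes g :: "real \<Rightarrow> real"
  assumes g: "g absolutely_integrable_on {a..b}"
  obtains N where "negligible N" "\<And>x e. x \<in> {a<..<b} - N \<Longrightarrow> e > 0 \<Longrightarrow>
    \<exists>d>0. \<forall>y z. a \<le> y \<and> y \<le> x \<and> x \<le> z \<and> z \<le> b \<and> z - y < d \<longrightarrow> integral {y..z} g \<le> (g x + e) * (z - y)"
proof
  let ?h = "\<lambda>r x. max (g x - r) 0"
  define B where "B r n = {x \<in> {a<..<b}. ?h r x = 0 \<and>
    (\<forall>d>0. \<exists>y z. a \<le> y \<and> y \<le> x \<and> x \<le> z \<and> z \<le> b \<and> y < z \<and> z - y < d \<and> integral {y..z} (?h r) > (1 / real (Suc n)) * (z - y))}" for r n
  \<comment> \<open>Countably many levels r and thresholds 1/(n+1) suffice, so the exceptional set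
    can be chosen independently of e.\<close>
  define N where "N = (\<Union>r\<in>\<rat>. \<Union>n. B r n)"
  have h: "?h r absolutely_integrable_on {a..b}" for r
    by (intro absolutely_integrable_max_1 set_integral_diff g) (simp_all add: absolutely_integrable_on_const)
  show "negligible N" unfolding N_def
    unfolding negligible_iff_null_sets
  proof (intro null_sets_UN'[OF countable_rat] null_sets_UN' countableI_type)
    show "B r n \<in> null_sets lebesgue" for r n
      unfolding negligible_iff_null_sets[symmetric] B_def by (intro negligible_upper_density h) auto
  qed
  fix x e :: real assume x: "x \<in> {a<..<b} - N" and "e > 0"
  obtain r where r: "r \<in> \<rat>" "g x < r" "r < g x + e/2"
    using Rats_dense_in_real[of "g x" "g x + e/2"] \<open>e > 0\<close> by auto
  obtain n where n: "1 / real (Suc n) < e/2" using \<open>e > 0\<close> nat_approx_posE[of "e/2"] by auto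
  have "x \<notin> B r n" using x r(1) unfolding N_def by blast
  moreover have "?h r x = 0" using r by simp
  ultimately obtain d where "d > 0" and
    d: "\<And>y z. a \<le> y \<Longrightarrow> y \<le> x \<Longrightarrow> x \<le> z \<Longrightarrow> z \<le> b \<Longrightarrow> y < z \<Longrightarrow> z - y < d \<Longrightarrow> integral {y..z} (?h r) \<le> (1 / real (Suc n)) * (z - y)"
    using x unfolding B_def mem_Collect_eq by (metis DiffD1 not_less)
  have "integral {y..z} g \<le> (g x + e) * (z - y)" if yz: "a \<le> y" "y \<le> x" "x \<le> z" "z \<le> b" "z - y < d" for y z
  proof (cases "y < z")
    case True
    have "g absolutely_integrable_on {y..z}" "?h r absolutely_integrable_on {y..z}"
      using absolutely_integrable_on_subinterval[OF g] absolutely_integrable_on_subinterval[OF h] yz by auto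
    then have i: "g integrable_on {y..z}" "?h r integrable_on {y..z}" by (auto simp: absolutely_integrable_on_def)
    have "integral {y..z} g \<le> integral {y..z} (\<lambda>x. r + ?h r x)"
      using i by (intro integral_le integrable_add) auto
    also have "\<dots> = r * (z - y) + integral {y..z} (?h r)"
      using i True by (subst integral_add) auto
    also have "\<dots> \<le> r * (z - y) + (1 / real (Suc n)) * (z - y)"
      using d[of y z] yz True by simp
    also have "\<dots> \<le> (g x + e) * (z - y)"
      unfolding distrib_right[symmetric] using True r n by (intro mult_right_mono) auto
    finally show ?thesis .
  next
    case False
    then have "y = z" using yz by auto
    then show ?thesis by simp
  qed
  with \<open>d > 0\<close> show "\<exists>d>0. \<forall>y z. a \<le> y \<and> y \<le> x \<and> x \<le> z \<and> z \<le> b \<and> z - y < d \<longrightarrow> integral {y..z} g \<le> (g x + e) * (z - y)"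
    by blast
qed

text \<open>The upper estimate for the means of g and the one for the means of -g enclose the
  difference quotient from both sides.\<close>

lemma Lebesgue_differentiation_real:
  fixes g :: "real \<Rightarrow> real"
  assumes g: "g absolutely_integrable_on {a..b}"
  obtains N where "negligible N"
    "\<And>x. x \<in> {a<..<b} - N \<Longrightarrow> ((\<lambda>x. integral {a..x} g) has_vector_derivative g x) (at x)"
proof -
  have ng: "(\<lambda>x. - g x) absolutely_integrable_on {a..b}" using g by (simp add: set_integrable_def)
  obtain N1 where N1: "negligible N1" "\<And>x e. x \<in> {a<..<b} - N1 \<Longrightarrow> e > 0 \<Longrightarrow>
    \<exists>d>0. \<forall>y z. a \<le> y \<and> y \<le> x \<and> x \<le> z \<and> z \<le> b \<and> z - y < d \<longrightarrow> integral {y..z} g \<le> (g x + e) * (z - y)"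
    using Lebesgue_upper_derivative[OF g] by metis
  obtain N2 where N2: "negligible N2" "\<And>x e. x \<in> {a<..<b} - N2 \<Longrightarrow> e > 0 \<Longrightarrow>
    \<exists>d>0. \<forall>y z. a \<le> y \<and> y \<le> x \<and> x \<le> z \<and> z \<le> b \<and> z - y < d \<longrightarrow> integral {y..z} (\<lambda>x. - g x) \<le> (- g x + e) * (z - y)"
    using Lebesgue_upper_derivative[OF ng] by metis
  show ?thesis
  proof
    show "negligible (N1 \<union> N2)" using N1 N2 by simp
    fix x assume x: "x \<in> {a<..<b} - (N1 \<union> N2)"
    let ?F = "\<lambda>x. integral {a..x} g"
    have F: "?F z - ?F y = integral {y..z} g" if "a \<le> y" "y \<le> z" "z \<le> b" for y z
      using Henstock_Kurzweil_Integration.integral_combine[of a y z g] that absolutely_integrable_on_subinterval[OF g, of a z]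
      by (auto simp: absolutely_integrable_on_def)
    show "(?F has_vector_derivative g x) (at x)"
      unfolding has_vector_derivative_def has_derivative_within_alt
    proof (intro conjI allI impI bounded_linear_scaleR_left)
      fix e :: real assume "e > 0"
      obtain d1 where d1: "d1 > 0" "\<And>y z. a \<le> y \<and> y \<le> x \<and> x \<le> z \<and> z \<le> b \<and> z - y < d1 \<Longrightarrow> integral {y..z} g \<le> (g x + e) * (z - y)"
        using N1(2)[of x e] x \<open>e > 0\<close> by auto
      obtain d2 where d2: "d2 > 0" "\<And>y z. a \<le> y \<and> y \<le> x \<and> x \<le> z \<and> z \<le> b \<and> z - y < d2 \<Longrightarrow> integral {y..z} (\<lambda>x. - g x) \<le> (- g x + e) * (z - y)"
        using N2(2)[of x e] x \<open>e > 0\<close> by auto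
      define d where "d = min (min d1 d2) (min (x - a) (b - x))"
      have "d > 0" using d1 d2 x by (auto simp: d_def)
      moreover have "norm (?F y - ?F x - (y - x) *\<^sub>R g x) \<le> e * norm (y - x)" if "norm (y - x) < d" for y
      proof (cases "x \<le> y")
        case True
        then have "integral {x..y} g \<le> (g x + e) * (y - x)" "- integral {x..y} g \<le> (- g x + e) * (y - x)"
          using d1(2)[of x y] d2(2)[of x y] that x by (auto simp: d_def)
        moreover have "?F y - ?F x = integral {x..y} g" using that True x by (intro F) (auto simp: d_def)
        ultimately show ?thesis using True by (simp add: abs_le_iff algebra_simps)
      next
        case False
        then have "integral {y..x} g \<le> (g x + e) * (x - y)" "- integral {y..x} g \<le> (- g x + e) * (x - y)"
          using d1(2)[of y x] d2(2)[of y x] that x by (auto simp: d_def)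
        moreover have "?F x - ?F y = integral {y..x} g" using that False x by (intro F) (auto simp: d_def)
        ultimately show ?thesis using False by (simp add: abs_le_iff algebra_simps)
      qed
      ultimately show "\<exists>d>0. \<forall>y\<in>UNIV. norm (y - x) < d \<longrightarrow> norm (?F y - ?F x - (y - x) *\<^sub>R g x) \<le> e * norm (y - x)"
        by blast
    qed
  qed
qed

section \<open>Primitives of locally integrable functions\<close>

text \<open>Local absolute continuity of f with almost everywhere derivative g, in integrated form.
  Linear operations and changes of g on null sets then need no differentiation, and g is determined
  only up to null sets.\<close>

definition prim :: "real \<Rightarrow> (real \<Rightarrow> 'a::euclidean_space) \<Rightarrow> (real \<Rightarrow> 'a) \<Rightarrow> bool" where
  "prim c f g \<longleftrightarrow> (\<forall>d\<ge>c. g absolutely_integrable_on {c..d} \<and> f d = f c + integral {c..d} g)"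

lemma prim_int: "prim c f g \<Longrightarrow> c \<le> d \<Longrightarrow> g absolutely_integrable_on {c..d}"
  and prim_eq: "prim c f g \<Longrightarrow> c \<le> d \<Longrightarrow> f d = f c + integral {c..d} g"
  unfolding prim_def by blast+

lemma primD:
  assumes "prim c f g" "c \<le> a" "a \<le> b"
  shows "g absolutely_integrable_on {a..b}" "integral {a..b} g = f b - f a"
proof -
  have cb: "g absolutely_integrable_on {c..b}" using assms by (auto intro: prim_int)
  then show "g absolutely_integrable_on {a..b}"
    by (rule absolutely_integrable_on_subinterval) (use assms in auto)
  have "integral {c..a} g + integral {a..b} g = integral {c..b} g"
    using cb assms by (intro Henstock_Kurzweil_Integration.integral_combine) (auto simp: absolutely_integrable_on_def)
  moreover have "f b = f c + integral {c..b} g" "f a = f c + integral {c..a} g"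
    by (rule prim_eq[OF assms(1)]; use assms(2,3) in linarith)+
  ultimately show "integral {a..b} g = f b - f a" by (simp add: algebra_simps)
qed

lemma prim_has_integral:
  assumes "prim c f g" "c \<le> a" "a \<le> b"
  shows "(g has_integral f b - f a) {a..b}"
proof -
  have "g integrable_on {a..b}" by (rule set_lebesgue_integral_eq_integral(1)[OF primD(1)[OF assms]])
  then have "(g has_integral integral {a..b} g) {a..b}" by (rule integrable_integral)
  then show ?thesis unfolding primD(2)[OF assms] .
qed

lemma prim_ac_on:
  assumes "prim c f g" "c \<le> a"
  shows "ac_on a b f"
proof (cases "a \<le> b")
  case False
  have "\<not> family a b xs \<or> xs = []" for xs
    using False by (cases xs) (auto simp: family_def)
  then show ?thesis unfolding ac_on_iff_family by (metis family_simps(2) zero_less_one)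
next
  case True
  note g = primD(1)[OF assms True]
  show ?thesis unfolding ac_on_iff_family
  proof (intro allI impI)
    fix e :: real assume "e > 0"
    obtain d where "d > 0" and d: "\<And>T. T \<in> lmeasurable \<Longrightarrow> T \<subseteq> {a..b} \<Longrightarrow> measure lebesgue T < d \<Longrightarrow> integral T (\<lambda>x. norm (g x)) < e"
      by (rule absolute_continuity_integral[OF g \<open>e > 0\<close>]) blast
    have "family_var f xs < e" if fam: "family a b xs" and len: "family_length xs < d" for xs
    proof -
      let ?U = "\<lambda>xs. \<Union>p\<in>set xs. {fst p<..<snd p}"
      have "family_var f xs \<le> integral (?U xs) (\<lambda>x. norm (g x)) \<and> (\<lambda>x. norm (g x)) integrable_on (?U xs)"
        using fam
      proof (induction xs)
        case (Cons p xs)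
        then have p: "a \<le> fst p" "fst p \<le> snd p" "snd p \<le> b" and fam: "family a b xs" by (auto simp: family_def)
        have disj: "{fst p<..<snd p} \<inter> ?U xs = {}"
          using Cons.prems unfolding family_def sorted_wrt.simps by blast
        have gp: "(\<lambda>x. norm (g x)) integrable_on {fst p..snd p}" "g integrable_on {fst p..snd p}"
          using primD(1)[OF assms(1), of "fst p" "snd p"] assms(2) p by (auto simp: absolutely_integrable_on_def)
        have "norm (f (snd p) - f (fst p)) = norm (integral {fst p..snd p} g)"
          using primD(2)[OF assms(1), of "fst p" "snd p"] assms(2) p by simp
        also have "\<dots> \<le> integral {fst p..snd p} (\<lambda>x. norm (g x))"
          by (intro integral_norm_bound_integral gp) auto
        also have "\<dots> = integral {fst p<..<snd p} (\<lambda>x. norm (g x))"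
          using integral_open_interval_real by metis
        finally have 1: "norm (f (snd p) - f (fst p)) \<le> integral {fst p<..<snd p} (\<lambda>x. norm (g x))" .
        have gp': "(\<lambda>x. norm (g x)) integrable_on {fst p<..<snd p}" using gp(1) by (simp add: integrable_on_open_interval_real)
        have "((\<lambda>x. norm (g x)) has_integral (integral {fst p<..<snd p} (\<lambda>x. norm (g x)) + integral (?U xs) (\<lambda>x. norm (g x)))) ({fst p<..<snd p} \<union> ?U xs)"
          using Cons.IH[OF fam] gp' disj by (intro has_integral_Un) auto
        then show ?case using 1 Cons.IH[OF fam] by (auto simp: has_integral_iff)
      qed auto
      moreover have "integral (?U xs) (\<lambda>x. norm (g x)) < e"
      proof (rule d)
        show "?U xs \<in> lmeasurable" by (intro fmeasurable.finite_UN) auto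
        show "?U xs \<subseteq> {a..b}" using fam unfolding family_def by fastforce
        have "measure lborel (?U xs) = family_length xs" by (rule family_measure[OF fam])
        moreover have "?U xs \<in> sets borel" by (intro sets.finite_UN) auto
        ultimately show "measure lebesgue (?U xs) < d" using len by simp
      qed
      ultimately show ?thesis by simp
    qed
    with \<open>d > 0\<close> show "\<exists>d>0. \<forall>xs. family a b xs \<longrightarrow> family_length xs < d \<longrightarrow> family_var f xs < e" by blast
  qed
qed

lemma prim_continuous: "prim c f g \<Longrightarrow> continuous_on {c..} f"
proof -
  assume p: "prim c f g"
  have cont: "continuous_on {c..d} f" for d by (rule ac_on_continuous[OF prim_ac_on[OF p order_refl]])
  show ?thesis unfolding continuous_on_eq_continuous_within
  proof
    fix x assume "x \<in> {c..}"
    then have "continuous (at x within {c..x+1}) f"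
      using cont[of "x+1"] by (auto simp: continuous_on_eq_continuous_within)
    moreover have "at x within {c..} = at x within {c..x+1}"
      by (rule at_within_nhd[of _ "{..<x+1}"]) auto
    ultimately show "continuous (at x within {c..}) f" by simp
  qed
qed

section \<open>Almost everywhere derivatives of primitives\<close>

lemma AE_lebesgue_on_halfline_iff:
  fixes c :: real
  shows "(AE x in lebesgue_on {c..}. P x) \<longleftrightarrow> (\<exists>N. negligible N \<and> (\<forall>x\<ge>c. x \<notin> N \<longrightarrow> P x))"
proof
  assume "AE x in lebesgue_on {c..}. P x"
  moreover have "{c..} \<inter> space lebesgue \<in> sets lebesgue" by (intro sets_completionI_sets) simp
  ultimately have "AE x in lebesgue. x \<in> {c..} \<longrightarrow> P x" using AE_restrict_space_iff by blast
  then show "\<exists>N. negligible N \<and> (\<forall>x\<ge>c. x \<notin> N \<longrightarrow> P x)"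
    unfolding negligible_iff_null_sets eventually_ae_filter by auto
next
  assume "\<exists>N. negligible N \<and> (\<forall>x\<ge>c. x \<notin> N \<longrightarrow> P x)"
  then obtain N where "N \<in> null_sets lebesgue" "\<And>x. x \<ge> c \<Longrightarrow> x \<notin> N \<Longrightarrow> P x"
    unfolding negligible_iff_null_sets by blast
  then have "AE x in lebesgue. x \<in> {c..} \<longrightarrow> P x" by (intro AE_I'[of N]) auto
  then show "AE x in lebesgue_on {c..}. P x" by (simp add: AE_restrict_space_iff)
qed

lemma negligible_countable_cover:
  assumes "\<And>n::nat. negligible (N n)" shows "negligible (\<Union>n. N n)"
  using assms unfolding negligible_iff_null_sets by (intro null_sets_UN) auto

lemma prim_real_derivative:
  fixes f :: "real \<Rightarrow> real"
  assumes "prim c f g"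
  obtains N where "negligible N" "\<And>x. x > c \<Longrightarrow> x \<notin> N \<Longrightarrow> (f has_vector_derivative g x) (at x)"
proof -
  have "\<exists>N. negligible N \<and> (\<forall>x. x \<in> {c<..<c + real n} - N \<longrightarrow> ((\<lambda>x. integral {c..x} g) has_vector_derivative g x) (at x))" for n
  proof -
    have "g absolutely_integrable_on {c..c + real n}" by (rule prim_int[OF assms]) simp
    from Lebesgue_differentiation_real[OF this] show ?thesis by metis
  qed
  then obtain N where N: "\<And>n. negligible (N n)"
    "\<And>n x. x \<in> {c<..<c + real n} - N n \<Longrightarrow> ((\<lambda>x. integral {c..x} g) has_vector_derivative g x) (at x)" by metis
  show ?thesis
  proof
    show "negligible (\<Union>n. N n)" by (intro negligible_countable_cover N)
    fix x assume x: "x > c" "x \<notin> (\<Union>n. N n)"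
    obtain n where "x - c < real n" using reals_Archimedean2 by blast
    then have "((\<lambda>x. integral {c..x} g) has_vector_derivative g x) (at x)"
      using x by (intro N(2)[of _ n]) auto
    then have "((\<lambda>x. f c + integral {c..x} g) has_vector_derivative g x) (at x)"
      by (auto intro!: derivative_eq_intros)
    then show "(f has_vector_derivative g x) (at x)"
      by (rule has_vector_derivative_transform_within_open[of _ _ _ "{c<..}"])
        (use x prim_eq[OF assms, symmetric] in \<open>simp_all add: less_imp_le\<close>)
  qed
qed

lemma prim_component:
  assumes "prim c f g" shows "prim c (\<lambda>x. f x \<bullet> i) (\<lambda>x. g x \<bullet> i)"
  unfolding prim_def
proof (intro allI impI conjI)
  fix d assume "d \<ge> c"
  then have g: "g absolutely_integrable_on {c..d}" "f d = f c + integral {c..d} g" using assms by (blast intro: prim_int prim_eq)+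
  show "(\<lambda>x. g x \<bullet> i) absolutely_integrable_on {c..d}"
    using absolutely_integrable_linear[OF g(1) bounded_linear_inner_left[of i]] by (simp add: o_def)
  show "f d \<bullet> i = f c \<bullet> i + integral {c..d} (\<lambda>x. g x \<bullet> i)"
    using g integral_linear[OF _ bounded_linear_inner_left[of i], of g "{c..d}"]
    by (simp add: o_def absolutely_integrable_on_def inner_add_left)
qed

lemma prim_derivative:
  fixes f :: "real \<Rightarrow> 'a::euclidean_space"
  assumes "prim c f g"
  obtains N where "negligible N" "\<And>x. x > c \<Longrightarrow> x \<notin> N \<Longrightarrow> (f has_vector_derivative g x) (at x)"
proof -
  have "\<exists>N. negligible N \<and> (\<forall>x. x > c \<longrightarrow> x \<notin> N \<longrightarrow> ((\<lambda>x. f x \<bullet> i) has_vector_derivative g x \<bullet> i) (at x))" for i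
    using prim_real_derivative[OF prim_component[OF assms]] by metis
  then obtain N where N: "\<And>i. negligible (N i)"
    "\<And>i x. x > c \<Longrightarrow> x \<notin> N i \<Longrightarrow> ((\<lambda>x. f x \<bullet> i) has_vector_derivative g x \<bullet> i) (at x)" by metis
  show ?thesis
  proof
    show "negligible (\<Union>i\<in>Basis. N i)" using N(1) by (intro negligible_Union finite_imageI finite_Basis) blast
    fix x assume x: "x > c" "x \<notin> (\<Union>i\<in>Basis. N i)"
    have "((\<lambda>x. f x \<bullet> i) has_vector_derivative g x \<bullet> i) (at x)" if "i \<in> Basis" for i
      using x that by (intro N) auto
    then show "(f has_vector_derivative g x) (at x)"
      unfolding has_vector_derivative_def has_derivative_componentwise_within[of f] by simp
  qed
qed

lemma prim_AE_derivative:
  fixes f :: "real \<Rightarrow> 'a::euclidean_space"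
  assumes "prim c f g"
  shows "AE x in lebesgue_on {c..}. (f has_vector_derivative g x) (at x within {c..})"
proof -
  obtain N where N: "negligible N" "\<And>x. x > c \<Longrightarrow> x \<notin> N \<Longrightarrow> (f has_vector_derivative g x) (at x)"
    using prim_derivative[OF assms] by metis
  show ?thesis unfolding AE_lebesgue_on_halfline_iff
  proof (intro exI[of _ "insert c N"] conjI allI impI)
    show "negligible (insert c N)" using N by simp
    fix x assume "x \<ge> c" "x \<notin> insert c N"
    then have "(f has_vector_derivative g x) (at x)" by (intro N) auto
    then show "(f has_vector_derivative g x) (at x within {c..})"
      by (rule has_vector_derivative_at_within)
  qed
qed

lemma hderiv_eqI:
  assumes "(f has_vector_derivative f') (at x within {c..})" "x \<ge> c"
  shows "hderiv c f x = f'"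
  unfolding hderiv_def
proof (rule vector_derivative_within[OF _ assms(1)])
  have "x islimpt {x<..<x+1}" by (simp add: islimpt_greaterThanLessThan1)
  then have "x islimpt {c..}" by (rule islimpt_subset) (use assms in auto)
  then show "at x within {c..} \<noteq> bot" by (simp add: trivial_limit_within)
qed

lemma prim_hderiv:
  fixes f :: "real \<Rightarrow> 'a::euclidean_space"
  assumes "prim c f g"
  shows "AE x in lebesgue_on {c..}. hderiv c f x = g x"
proof -
  have "AE x in lebesgue_on {c..}. x \<ge> c" by (auto simp: AE_lebesgue_on_halfline_iff intro!: exI[of _ "{}"])
  with prim_AE_derivative[OF assms] show ?thesis by eventually_elim (rule hderiv_eqI)
qed

lemma prim_cong_AE:
  assumes "prim c f g" "AE x in lebesgue_on {c..}. g x = g' x"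
  shows "prim c f g'"
proof -
  obtain N where N: "negligible N" "\<And>x. x \<ge> c \<Longrightarrow> x \<notin> N \<Longrightarrow> g x = g' x"
    using assms(2) unfolding AE_lebesgue_on_halfline_iff by blast
  show ?thesis unfolding prim_def
  proof (intro allI impI conjI)
    fix d assume d: "d \<ge> c"
    then have g: "g absolutely_integrable_on {c..d}" "f d = f c + integral {c..d} g" using assms(1) by (blast intro: prim_int prim_eq)+
    show "g' absolutely_integrable_on {c..d}"
      by (rule absolutely_integrable_spike[OF g(1) N(1)]) (use N(2) in auto)
    have "integral {c..d} g = integral {c..d} g'"
      by (rule integral_spike[OF N(1)]) (use N(2) in auto)
    then show "f d = f c + integral {c..d} g'" using g by simp
  qed
qed

lemma prim_cong_left: "prim c f g \<Longrightarrow> (\<And>x. x \<ge> c \<Longrightarrow> f x = f' x) \<Longrightarrow> prim c f' g"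
  unfolding prim_def by (metis order_refl)

text \<open>Converse of \<open>prim_ac_on\<close>, coordinate by coordinate. The densities supplied
  by \<open>real_ac_density\<close> depend on the compact interval and have to be glued to one
  function on the half-line.\<close>

lemma ac_prim:
  fixes f :: "real \<Rightarrow> 'a::euclidean_space"
  assumes ac: "\<And>d. d \<ge> c \<Longrightarrow> ac_on c d f"
  obtains g where "prim c f g"
proof -
  have "\<exists>g. prim c (\<lambda>x. f x \<bullet> i) g" for i
  proof -
    have aci: "ac_on c d (\<lambda>x. f x \<bullet> i)" if "d \<ge> c" for d
    proof (rule ac_on_by_variation[OF ac ac, OF that that])
      show "family_var (\<lambda>x. f x \<bullet> i) xs \<le> norm i * (family_var f xs + family_var f xs)" for xs
      proof (induction xs)
        case (Cons p xs)
        have "\<bar>f (snd p) \<bullet> i - f (fst p) \<bullet> i\<bar> \<le> norm i * norm (f (snd p) - f (fst p))"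
          by (metis Cauchy_Schwarz_ineq2 inner_diff_left mult.commute)
        moreover have "0 \<le> norm i * norm (f (snd p) - f (fst p))" by simp
        ultimately show ?case using Cons by (simp add: distrib_left)
      qed auto
    qed
    define n where "n k = c + real (Suc k)" for k
    have "\<exists>g. g absolutely_integrable_on {c..n k} \<and> (\<forall>x\<in>{c..n k}. f x \<bullet> i = f c \<bullet> i + integral {c..x} g)" for k
      using real_ac_density[OF aci[of "n k"]] by (metis n_def le_add_same_cancel1 of_nat_0_le_iff)
    then obtain G where G: "\<And>k. G k absolutely_integrable_on {c..n k}"
       "\<And>k x. x \<in> {c..n k} \<Longrightarrow> f x \<bullet> i = f c \<bullet> i + integral {c..x} (G k)" by metis
    have "\<exists>N. negligible N \<and> (\<forall>x. x \<in> {c<..<n k} - N \<longrightarrow> ((\<lambda>x. integral {c..x} (G k)) has_vector_derivative G k x) (at x))" for k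
      using Lebesgue_differentiation_real[OF G(1)[of k]] by metis
    then obtain N where N: "\<And>k. negligible (N k)"
      "\<And>k x. x \<in> {c<..<n k} - N k \<Longrightarrow> ((\<lambda>x. integral {c..x} (G k)) has_vector_derivative G k x) (at x)" by metis
    \<comment> \<open>By Lebesgue differentiation this single function agrees almost everywhere with
      every local density \<open>G k\<close>, which glues them.\<close>
    define g where "g = hderiv c (\<lambda>x. f x \<bullet> i)"
    have eq: "g x = G k x" if "x \<in> {c<..<n k} - N k" for x k
    proof -
      have "((\<lambda>x. f c \<bullet> i + integral {c..x} (G k)) has_vector_derivative G k x) (at x)"
        using N(2)[OF that] by (auto intro!: derivative_eq_intros)
      then have "((\<lambda>x. f x \<bullet> i) has_vector_derivative G k x) (at x)"
        by (rule has_vector_derivative_transform_within_open[of _ _ _ "{c<..<n k}"])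
          (use that in \<open>auto intro!: G(2)[symmetric]\<close>)
      then have "((\<lambda>x. f x \<bullet> i) has_vector_derivative G k x) (at x within {c..})"
        by (rule has_vector_derivative_at_within)
      then show ?thesis unfolding g_def using that by (intro hderiv_eqI) auto
    qed
    have "prim c (\<lambda>x. f x \<bullet> i) g" unfolding prim_def
    proof (intro allI impI)
      fix d assume d: "d \<ge> c"
      obtain k where k: "d - c < real k" using reals_Archimedean2 by blast
      have neg: "negligible (insert c (N k))" using N(1) by simp
      have eq': "g x = G k x" if "x \<in> {c..d} - insert c (N k)" for x
        using that k by (intro eq) (auto simp: n_def)
      have sub: "{c..d} \<subseteq> {c..n k}" using k by (auto simp: n_def)
      have Gd: "G k absolutely_integrable_on {c..d}"
        by (rule absolutely_integrable_on_subinterval[OF G(1) sub])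
      have "integral {c..d} (G k) = integral {c..d} g"
        by (rule integral_spike[OF neg eq'])
      moreover have "d \<in> {c..n k}" using d k by (auto simp: n_def)
      ultimately show "g absolutely_integrable_on {c..d} \<and> f d \<bullet> i = f c \<bullet> i + integral {c..d} g"
        using absolutely_integrable_spike[OF Gd neg eq'] G(2)[of d k] by simp
    qed
    then show ?thesis by blast
  qed
  then obtain g where g: "\<And>i. prim c (\<lambda>x. f x \<bullet> i) (g i)" by metis
  have "prim c f (\<lambda>x. \<Sum>i\<in>Basis. g i x *\<^sub>R i)"
    unfolding prim_def
  proof (intro allI impI conjI)
    fix d assume d: "d \<ge> c"
    have gi: "g i absolutely_integrable_on {c..d}" "f d \<bullet> i = f c \<bullet> i + integral {c..d} (g i)" for i
      by (rule prim_int[OF g d], rule prim_eq[OF g d])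
    have 1: "(\<lambda>x. (\<Sum>i\<in>Basis. g i x *\<^sub>R i) \<bullet> j) = g j" if "j \<in> Basis" for j
      using that by (auto simp: inner_sum_left inner_Basis if_distrib[of "\<lambda>x. _ * x"] cong: if_cong)
    show 2: "(\<lambda>x. \<Sum>i\<in>Basis. g i x *\<^sub>R i) absolutely_integrable_on {c..d}"
      by (rule absolutely_integrable_componentwise) (simp only: 1 gi(1))
    show "f d = f c + integral {c..d} (\<lambda>x. \<Sum>i\<in>Basis. g i x *\<^sub>R i)"
    proof (rule euclidean_eqI)
      fix j :: 'a assume j: "j \<in> Basis"
      have "integral {c..d} (\<lambda>x. \<Sum>i\<in>Basis. g i x *\<^sub>R i) \<bullet> j = integral {c..d} (g j)"
        using integral_linear[OF _ bounded_linear_inner_left[of j], of "\<lambda>x. \<Sum>i\<in>Basis. g i x *\<^sub>R i" "{c..d}"] 2 1[OF j]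
        by (simp add: o_def absolutely_integrable_on_def)
      then show "f d \<bullet> j = (f c + integral {c..d} (\<lambda>x. \<Sum>i\<in>Basis. g i x *\<^sub>R i)) \<bullet> j"
        using gi(2)[of j] by (simp add: inner_add_left)
    qed
  qed
  then show ?thesis by (rule that)
qed

text \<open>Reduces an integral identity to a derivative computed almost everywhere; the product
  rule and the ramp function are obtained in this way.\<close>

lemma ac_prim_derivative:
  fixes f :: "real \<Rightarrow> 'a::euclidean_space"
  assumes ac: "\<And>d. d \<ge> c \<Longrightarrow> ac_on c d f"
    and der: "AE x in lebesgue_on {c..}. (f has_vector_derivative g x) (at x within {c..})"
  shows "prim c f g"
proof -
  obtain g0 where g0: "prim c f g0" using ac_prim[OF ac] by blast
  have "AE x in lebesgue_on {c..}. x \<ge> c" by (auto simp: AE_lebesgue_on_halfline_iff intro!: exI[of _ "{}"])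
  with der prim_hderiv[OF g0] have "AE x in lebesgue_on {c..}. g0 x = g x"
    by eventually_elim (metis hderiv_eqI)
  then show ?thesis by (rule prim_cong_AE[OF g0])
qed

lemma ac_prim_hderiv:
  fixes f :: "real \<Rightarrow> 'a::euclidean_space"
  assumes ac: "\<And>d. d \<ge> c \<Longrightarrow> ac_on c d f"
  shows "prim c f (hderiv c f)"
proof -
  obtain g0 where g0: "prim c f g0" using ac_prim[OF ac] by blast
  from prim_hderiv[OF g0] have "AE x in lebesgue_on {c..}. g0 x = hderiv c f x"
    by eventually_elim simp
  then show ?thesis by (rule prim_cong_AE[OF g0])
qed

text \<open>One product rule for all pairings that occur: scalar times vector, matrix times vector,
  and \<open>cdot\<close>. Absolute continuity holds because f and g are bounded on compact
  intervals.\<close>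

lemma prim_bilinear:
  fixes f :: "real \<Rightarrow> 'a::euclidean_space" and g :: "real \<Rightarrow> 'b::euclidean_space"
    and h :: "'a \<Rightarrow> 'b \<Rightarrow> 'c::euclidean_space"
  assumes h: "bounded_bilinear h" and f: "prim c f f'" and g: "prim c g g'"
  shows "prim c (\<lambda>x. h (f x) (g x)) (\<lambda>x. h (f x) (g' x) + h (f' x) (g x))"
proof (rule ac_prim_derivative)
  interpret bounded_bilinear h by fact
  show "ac_on c d (\<lambda>x. h (f x) (g x))" if "d \<ge> c" for d
  proof -
    have acf: "ac_on c d f" and acg: "ac_on c d g" by (auto intro: prim_ac_on f g)
    obtain K where K: "K \<ge> 0" "\<And>a b. norm (h a b) \<le> norm a * norm b * K"
      using nonneg_bounded by blast
    have "compact (f ` {c..d})" "compact (g ` {c..d})"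
      by (auto intro!: compact_continuous_image ac_on_continuous acf acg)
    then have "bounded (f ` {c..d})" "bounded (g ` {c..d})" by (auto intro: compact_imp_bounded)
    then obtain Mf Mg where M: "\<And>x. x \<in> {c..d} \<Longrightarrow> norm (f x) \<le> Mf" "\<And>x. x \<in> {c..d} \<Longrightarrow> norm (g x) \<le> Mg"
      unfolding bounded_iff ball_simps by blast
    define M where "M = max Mf Mg"
    have M: "norm (f x) \<le> M" "norm (g x) \<le> M" if "x \<in> {c..d}" for x
      using M[OF that] by (auto simp: M_def)
    have "0 \<le> M" using M(1)[of c] that by (auto intro: order_trans[OF norm_ge_zero])
    show ?thesis
    proof (rule ac_on_by_variation[OF acf acg])
      fix xs assume "family c d xs"
      then show "family_var (\<lambda>x. h (f x) (g x)) xs \<le> (M * K) * (family_var f xs + family_var g xs)"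
      proof (induction xs)
        case (Cons p xs)
        then have p: "fst p \<in> {c..d}" "snd p \<in> {c..d}" by (auto simp: family_def)
        have "h (f (snd p)) (g (snd p)) - h (f (fst p)) (g (fst p))
          = h (f (snd p) - f (fst p)) (g (snd p)) + h (f (fst p)) (g (snd p) - g (fst p))"
          by (simp add: diff_left diff_right)
        then have "norm (h (f (snd p)) (g (snd p)) - h (f (fst p)) (g (fst p)))
          \<le> norm (f (snd p) - f (fst p)) * norm (g (snd p)) * K + norm (f (fst p)) * norm (g (snd p) - g (fst p)) * K"
          by (metis K(2) add_mono norm_triangle_le)
        also have "\<dots> \<le> norm (f (snd p) - f (fst p)) * M * K + M * norm (g (snd p) - g (fst p)) * K"
          using M p K(1) \<open>0 \<le> M\<close> by (intro add_mono mult_mono) auto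
        finally show ?case using Cons by (simp add: algebra_simps family_def)
      qed simp
    qed
  qed
  show "AE x in lebesgue_on {c..}. ((\<lambda>x. h (f x) (g x)) has_vector_derivative (h (f x) (g' x) + h (f' x) (g x))) (at x within {c..})"
    using prim_AE_derivative[OF f] prim_AE_derivative[OF g]
    by eventually_elim (rule has_vector_derivative[unfolded has_vector_derivative_def, folded has_vector_derivative_def])
qed

lemma prim_linear:
  assumes h: "bounded_linear h" and f: "prim c f f'"
  shows "prim c (\<lambda>x. h (f x)) (\<lambda>x. h (f' x))"
  unfolding prim_def
proof (intro allI impI conjI)
  fix d assume "d \<ge> c"
  then have g: "f' absolutely_integrable_on {c..d}" "f d = f c + integral {c..d} f'" using f by (blast intro: prim_int prim_eq)+
  show "(\<lambda>x. h (f' x)) absolutely_integrable_on {c..d}"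
    using absolutely_integrable_linear[OF g(1) h] by (simp add: o_def)
  show "h (f d) = h (f c) + integral {c..d} (\<lambda>x. h (f' x))"
    using g integral_linear[OF _ h, of f' "{c..d}"]
    by (simp add: o_def absolutely_integrable_on_def linear_add[OF bounded_linear.linear[OF h]])
qed

lemma prim_add:
  assumes "prim c f f'" "prim c g g'"
  shows "prim c (\<lambda>x. f x + g x) (\<lambda>x. f' x + g' x)"
  unfolding prim_def
proof (intro allI impI conjI)
  fix d assume "d \<ge> c"
  then have *: "f' absolutely_integrable_on {c..d}" "f d = f c + integral {c..d} f'"
    "g' absolutely_integrable_on {c..d}" "g d = g c + integral {c..d} g'" using assms by (blast intro: prim_int prim_eq)+
  show "(\<lambda>x. f' x + g' x) absolutely_integrable_on {c..d}" by (intro set_integral_add *)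
  show "f d + g d = f c + g c + integral {c..d} (\<lambda>x. f' x + g' x)"
    using * by (subst integral_add) (auto simp: absolutely_integrable_on_def)
qed

lemma prim_diff:
  assumes "prim c f f'" "prim c g g'"
  shows "prim c (\<lambda>x. f x - g x) (\<lambda>x. f' x - g' x)"
  using prim_add[OF assms(1) prim_linear[OF bounded_linear_minus[OF bounded_linear_ident] assms(2)]] by simp

section \<open>Linear differential equations\<close>

lemma absolutely_integrable_bilinear_continuous:
  fixes h :: "'b::euclidean_space \<Rightarrow> 'a::euclidean_space \<Rightarrow> 'c::euclidean_space"
  assumes h: "bounded_bilinear h" and G: "G absolutely_integrable_on {a..b}"
    and y: "continuous_on {a..b::real} y"
  shows "(\<lambda>x. h (G x) (y x)) absolutely_integrable_on {a..b}"
proof -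
  have "bilinear (\<lambda>v M. h M v)"
    using bounded_bilinear.flip[OF h] by (simp add: bilinear_conv_bounded_bilinear)
  moreover have "y \<in> borel_measurable (lebesgue_on {a..b})"
    using y by (intro continuous_imp_measurable_on_sets_lebesgue) auto
  moreover have "bounded (y ` {a..b})"
    using y by (intro compact_imp_bounded compact_continuous_image) auto
  ultimately show ?thesis
    using G by (intro absolutely_integrable_bounded_measurable_product[of "\<lambda>v M. h M v"]) auto
qed

lemma prim_integral:
  assumes "\<And>d. d \<ge> c \<Longrightarrow> g absolutely_integrable_on {c..d}"
  shows "prim c (\<lambda>x. integral {c..x} g) g"
  using assms unfolding prim_def by simp

lemma prim_power:
  fixes a :: "real \<Rightarrow> real"
  assumes "prim c a a'"
  shows "prim c (\<lambda>x. a x ^ Suc n) (\<lambda>x. real (Suc n) * (a' x * a x ^ n))"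
proof (induction n)
  case 0
  then show ?case using assms by simp
next
  case (Suc n)
  have "prim c (\<lambda>x. a x * a x ^ Suc n)
      (\<lambda>x. a x * (real (Suc n) * (a' x * a x ^ n)) + a' x * a x ^ Suc n)"
    by (rule prim_bilinear[OF bounded_bilinear_mult assms Suc])
  moreover have "(\<lambda>x. a x * (real (Suc n) * (a' x * a x ^ n)) + a' x * a x ^ Suc n)
     = (\<lambda>x. real (Suc (Suc n)) * (a' x * a x ^ Suc n))"
    by (simp add: fun_eq_iff algebra_simps)
  ultimately show ?case by simp
qed

lemma prim_power_fact:
  fixes a :: "real \<Rightarrow> real"
  assumes "prim c a a'"
  shows "prim c (\<lambda>x. a x ^ Suc n / fact (Suc n)) (\<lambda>x. a' x * (a x ^ n / fact n))"
proof -
  have "prim c (\<lambda>x. a x ^ Suc n / fact (Suc n)) (\<lambda>x. real (Suc n) * (a' x * a x ^ n) / fact (Suc n))"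
    by (rule prim_linear[OF bounded_linear_divide prim_power[OF assms]])
  moreover have "(\<lambda>x. real (Suc n) * (a' x * a x ^ n) / fact (Suc n)) = (\<lambda>x. a' x * (a x ^ n / fact n))"
    by (simp add: fun_eq_iff fact_Suc del: of_nat_Suc)
  ultimately show ?thesis by simp
qed

text \<open>With a the primitive of \<open>K * norm (G s)\<close>, the bound \<open>a^n / n!\<close>
  reproduces itself: multiplied by a' it is the derivative of \<open>a^(n+1) / (n+1)!\<close>. This
  gives factorial decay although G is only integrable.\<close>

lemma picard_integral_bound:
  fixes y :: "real \<Rightarrow> 'a::euclidean_space" and h :: "'b::euclidean_space \<Rightarrow> 'a \<Rightarrow> 'a"
  assumes h: "bounded_bilinear h" and K: "\<And>M v. norm (h M v) \<le> norm M * norm v * K"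
    and G: "\<And>d. d \<ge> c \<Longrightarrow> G absolutely_integrable_on {c..d}"
    and y: "continuous_on {c..d} y" and "c \<le> x" "x \<le> d"
    and bnd: "\<And>t. t \<in> {c..d} \<Longrightarrow> norm (y t) \<le> B * (integral {c..t} (\<lambda>s. K * norm (G s)) ^ n / fact n)"
  shows "norm (integral {c..x} (\<lambda>t. h (G t) (y t))) \<le> B * (integral {c..x} (\<lambda>s. K * norm (G s)) ^ Suc n / fact (Suc n))"
proof -
  let ?\<alpha> = "\<lambda>s. K * norm (G s)" and ?a = "\<lambda>x. integral {c..x} (\<lambda>s. K * norm (G s))"
  have \<alpha>: "?\<alpha> absolutely_integrable_on {c..d}" if "d \<ge> c" for d
    using absolutely_integrable_norm[OF G[OF that]] by (simp add: o_def set_integrable_mult_right)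
  have pw: "prim c (\<lambda>x. B * (?a x ^ Suc n / fact (Suc n))) (\<lambda>x. B * (?\<alpha> x * (?a x ^ n / fact n)))"
    by (intro prim_linear[OF bounded_linear_mult_right] prim_power_fact prim_integral \<alpha>)
  have K0: "norm M * norm v * K \<ge> 0" for M :: 'b and v :: 'a
    using K[of M v] norm_ge_zero order_trans by blast
  have hi: "((\<lambda>x. B * (?\<alpha> x * (?a x ^ n / fact n))) has_integral
      (B * (?a x ^ Suc n / fact (Suc n)) - B * (?a c ^ Suc n / fact (Suc n)))) {c..x}"
    by (rule prim_has_integral[OF pw]) (use assms in auto)
  have "norm (integral {c..x} (\<lambda>t. h (G t) (y t))) \<le> integral {c..x} (\<lambda>x. B * (?\<alpha> x * (?a x ^ n / fact n)))"
  proof (rule integral_norm_bound_integral)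
    have "(\<lambda>t. h (G t) (y t)) absolutely_integrable_on {c..x}"
      by (intro absolutely_integrable_bilinear_continuous[OF h] G continuous_on_subset[OF y]) (use assms in auto)
    then show "(\<lambda>t. h (G t) (y t)) integrable_on {c..x}" by (rule set_lebesgue_integral_eq_integral(1))
    show "(\<lambda>x. B * (?\<alpha> x * (?a x ^ n / fact n))) integrable_on {c..x}" using hi by blast
    fix t assume t: "t \<in> {c..x}"
    have "norm (h (G t) (y t)) \<le> norm (G t) * norm (y t) * K" by (rule K)
    also have "\<dots> \<le> norm (G t) * (B * (?a t ^ n / fact n)) * K"
    proof (cases "norm (G t) = 0")
      case False
      then have "norm (G t) > 0" by simp
      show ?thesis
      proof (cases "K \<ge> 0")
        case True
        then show ?thesis using bnd[of t] t assms by (intro mult_right_mono mult_left_mono) auto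
      next
        \<comment> \<open>A negative K would force every vector to be zero, which a Euclidean space
          excludes.\<close>
        case K: False
        have "v = 0" for v :: 'a
          using K0[of "G t" v] False K by (auto simp: zero_le_mult_iff mult_le_0_iff)
        then show ?thesis using nonempty_Basis nonzero_Basis by fastforce
      qed
    qed simp
    finally show "norm (h (G t) (y t)) \<le> B * (?\<alpha> t * (?a t ^ n / fact n))" by (simp add: algebra_simps)
  qed
  also have "\<dots> = B * (?a x ^ Suc n / fact (Suc n))" unfolding integral_unique[OF hi] by simp
  finally show ?thesis .
qed

text \<open>A solution starting at 0 is its own Picard iterate, so it is bounded by
  \<open>B * a^n / n!\<close> for every n, and this tends to 0.\<close>

lemma linear_ode_unique:
  fixes y :: "real \<Rightarrow> 'a::euclidean_space" and h :: "'b::euclidean_space \<Rightarrow> 'a \<Rightarrow> 'a"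
  assumes h: "bounded_bilinear h" 
    and G: "\<And>d. d \<ge> c \<Longrightarrow> G absolutely_integrable_on {c..d}"
    and y: "prim c y (\<lambda>x. h (G x) (y x))" and "y c = 0" and "x \<ge> c"
  shows "y x = 0"
proof -
  obtain K where K: "\<And>M v. norm (h M v) \<le> norm M * norm v * K"
    using bounded_bilinear.bounded[OF h] by blast
  let ?a = "\<lambda>x. integral {c..x} (\<lambda>s. K * norm (G s))"
  have cont: "continuous_on {c..x} y" by (rule continuous_on_subset[OF prim_continuous[OF y]]) auto
  then have "bounded (y ` {c..x})" by (intro compact_imp_bounded compact_continuous_image) auto
  then obtain B where B: "\<And>t. t \<in> {c..x} \<Longrightarrow> norm (y t) \<le> B" unfolding bounded_iff by blast
  have yt: "y t = integral {c..t} (\<lambda>t. h (G t) (y t))" if "t \<ge> c" for t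
    using prim_eq[OF y that] \<open>y c = 0\<close> by simp
  have bd: "norm (y t) \<le> B * (?a t ^ n / fact n)" if "t \<in> {c..x}" for t n
    using that
  proof (induction n arbitrary: t)
    case 0
    then show ?case using B by simp
  next
    case (Suc n)
    show ?case
      by (subst yt, use Suc.prems in simp, rule picard_integral_bound[OF h K G cont _ _ Suc.IH]) (use Suc.prems in auto)
  qed
  have "(\<lambda>n. B * (?a x ^ n / fact n)) \<longlonglongrightarrow> B * 0"
    using summable_LIMSEQ_zero[OF summable_exp[of "?a x"]]
    by (intro tendsto_mult tendsto_const) (simp add: field_simps)
  then have "norm (y x) \<le> B * 0"
    by (rule LIMSEQ_le_const) (use bd[of x] \<open>x \<ge> c\<close> in auto)
  then show ?thesis by simp
qed

text \<open>These are the increments of the Picard iteration, not the approximations themselves; the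
  solution is their sum.\<close>

primrec picard :: "('b \<Rightarrow> 'a \<Rightarrow> 'a) \<Rightarrow> (real \<Rightarrow> 'b) \<Rightarrow> real \<Rightarrow> 'a \<Rightarrow> nat \<Rightarrow> real \<Rightarrow> 'a::euclidean_space" where
  "picard h G c y0 0 x = y0"
| "picard h G c y0 (Suc n) x = integral {c..x} (\<lambda>t. h (G t) (picard h G c y0 n t))"

lemma linear_ode_exists:
  fixes y0 :: "'a::euclidean_space" and h :: "'b::euclidean_space \<Rightarrow> 'a \<Rightarrow> 'a"
  assumes h: "bounded_bilinear h" 
    and G: "\<And>d. d \<ge> c \<Longrightarrow> G absolutely_integrable_on {c..d}"
  obtains y where "prim c y (\<lambda>x. h (G x) (y x))" "y c = y0"
proof -
  obtain K where "K \<ge> 0" and K: "\<And>M v. norm (h M v) \<le> norm M * norm v * K"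
    using bounded_bilinear.nonneg_bounded[OF h] by blast
  interpret h: bounded_bilinear h by fact
  let ?\<alpha> = "\<lambda>s. K * norm (G s)"
  let ?a = "\<lambda>x. integral {c..x} ?\<alpha>"
  let ?z = "picard h G c y0"
  have \<alpha>: "?\<alpha> absolutely_integrable_on {c..d}" if "d \<ge> c" for d
    using absolutely_integrable_norm[OF G[OF that]] by (simp add: o_def set_integrable_mult_right)
  have cont: "continuous_on {c..} (?z n)" for n
  proof (induction n)
    case (Suc n)
    have "prim c (\<lambda>x. integral {c..x} (\<lambda>t. h (G t) (?z n t))) (\<lambda>t. h (G t) (?z n t))"
      by (intro prim_integral absolutely_integrable_bilinear_continuous[OF h] G continuous_on_subset[OF Suc]) auto
    then show ?case unfolding picard.simps by (rule prim_continuous)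
  qed simp
  have cont': "continuous_on {c..d} (?z n)" for n d by (rule continuous_on_subset[OF cont]) auto
  have int: "(\<lambda>t. h (G t) (?z n t)) absolutely_integrable_on {c..d}" if "d \<ge> c" for n d
    by (intro absolutely_integrable_bilinear_continuous[OF h] G that cont')
  have bd: "norm (?z n x) \<le> norm y0 * (?a x ^ n / fact n)" if "x \<ge> c" for n x
    using that
  proof (induction n arbitrary: x)
    case (Suc n)
    show ?case unfolding picard.simps
      by (rule picard_integral_bound[OF h K G cont' Suc.prems order_refl Suc.IH]) auto
  qed simp
  have sums_exp: "(\<lambda>n. norm y0 * (?a x ^ n / fact n)) sums (norm y0 * exp (?a x))" for x
    using exp_converges[of "?a x"] by (intro sums_mult) (simp add: field_simps)
  define S where "S N x = (\<Sum>n<N. ?z n x)" for N x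
  define y where "y x = (\<Sum>n. ?z n x)" for x
  have sm: "summable (\<lambda>n. norm (?z n x))" if "x \<ge> c" for x
    by (rule summable_comparison_test'[OF sums_summable[OF sums_exp[of x]], of 0]) (use bd[OF that] in auto)
  have Sy: "(\<lambda>N. S N x) \<longlonglongrightarrow> y x" if "x \<ge> c" for x
    unfolding S_def y_def by (rule summable_LIMSEQ[OF summable_norm_cancel[OF sm[OF that]]])
  have Sbd: "norm (S N x) \<le> norm y0 * exp (?a x)" if "x \<ge> c" for N x
  proof -
    have "norm (S N x) \<le> (\<Sum>n<N. norm y0 * (?a x ^ n / fact n))"
      unfolding S_def by (intro sum_norm_le bd that)
    also have "\<dots> \<le> (\<Sum>n. norm y0 * (?a x ^ n / fact n))"
    proof (intro sum_le_suminf sums_summable[OF sums_exp])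
      fix n show "0 \<le> norm y0 * (?a x ^ n / fact n)" using bd[OF that, of n] norm_ge_zero order_trans by blast
    qed auto
    also have "\<dots> = norm y0 * exp (?a x)" by (rule sums_unique[symmetric, OF sums_exp])
    finally show ?thesis .
  qed
  have amono: "?a x \<le> ?a d" if "c \<le> x" "x \<le> d" for x d
    using that \<alpha> \<open>K \<ge> 0\<close> by (intro integral_subset_le) (auto intro: set_lebesgue_integral_eq_integral(1))
  have Sint: "integral {c..d} (\<lambda>t. h (G t) (S N t)) = S (Suc N) d - y0" if "d \<ge> c" for N d
  proof -
    have "integral {c..d} (\<lambda>t. h (G t) (S N t)) = integral {c..d} (\<lambda>t. \<Sum>n<N. h (G t) (?z n t))"
      by (simp add: S_def h.sum_right)
    also have "\<dots> = (\<Sum>n<N. ?z (Suc n) d)"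
      unfolding picard.simps by (intro integral_sum) (auto intro: set_lebesgue_integral_eq_integral(1)[OF int[OF that]])
    also have "\<dots> = S (Suc N) d - y0"
      unfolding S_def by (subst sum.lessThan_Suc_shift) simp
    finally show ?thesis .
  qed
  \<comment> \<open>Dominated convergence interchanges the series and the integral; the partial sums
    are bounded by the exponential series of \<open>?a d\<close>, which gives an integrable majorant
    on [c, d].\<close>
  have lim: "(\<lambda>t. h (G t) (y t)) integrable_on {c..d} \<and>
      (\<lambda>N. integral {c..d} (\<lambda>t. h (G t) (S N t))) \<longlonglongrightarrow> integral {c..d} (\<lambda>t. h (G t) (y t))" 
    and bdy: "\<And>t. t \<in> {c..d} \<Longrightarrow> norm (h (G t) (y t)) \<le> ?\<alpha> t * (norm y0 * exp (?a d))"
    if "d \<ge> c" for d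
  proof -
    let ?H = "\<lambda>t. ?\<alpha> t * (norm y0 * exp (?a d))"
    have le: "norm (h (G t) v) \<le> ?H t" if "t \<in> {c..d}" "norm v \<le> norm y0 * exp (?a t)" for t v
    proof -
      have "norm v \<le> norm y0 * exp (?a d)"
        using that amono[of t d] by (elim order_trans, intro mult_left_mono) auto
      then have "norm (G t) * norm v * K \<le> norm (G t) * (norm y0 * exp (?a d)) * K"
        using \<open>K \<ge> 0\<close> by (intro mult_right_mono mult_left_mono) auto
      then show ?thesis using K[of "G t" v] by (simp add: mult_ac)
    qed
    have "norm (y t) \<le> norm y0 * exp (?a t)" if "t \<ge> c" for t
      by (rule LIMSEQ_le_const2[OF tendsto_norm[OF Sy[OF that]]]) (use Sbd[OF that] in auto)
    then show "norm (h (G t) (y t)) \<le> ?H t" if "t \<in> {c..d}" for t using le that by auto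
    have Si: "(\<lambda>t. h (G t) (S N t)) integrable_on {c..d}" for N
      unfolding S_def h.sum_right
      by (intro integrable_sum) (auto intro: set_lebesgue_integral_eq_integral(1)[OF int[OF that]])
    have Hi: "?H integrable_on {c..d}"
      by (intro integrable_on_mult_left set_lebesgue_integral_eq_integral(1) \<alpha> that)
    have cv: "(\<lambda>N. h (G t) (S N t)) \<longlonglongrightarrow> h (G t) (y t)" if "t \<in> {c..d}" for t
      using that by (intro h.tendsto tendsto_const Sy) auto
    have le': "norm (h (G t) (S N t)) \<le> ?H t" if "t \<in> {c..d}" for N t
      using that by (intro le Sbd) auto
    show "(\<lambda>t. h (G t) (y t)) integrable_on {c..d} \<and>
      (\<lambda>N. integral {c..d} (\<lambda>t. h (G t) (S N t))) \<longlonglongrightarrow> integral {c..d} (\<lambda>t. h (G t) (y t))"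
      using dominated_convergence[OF Si Hi le' cv] by blast
  qed
  have ai: "(\<lambda>t. h (G t) (y t)) absolutely_integrable_on {c..d}" if "d \<ge> c" for d
  proof (rule absolutely_integrable_integrable_bound[of _ _ "\<lambda>t. ?\<alpha> t * (norm y0 * exp (?a d))"])
    show "(\<lambda>t. ?\<alpha> t * (norm y0 * exp (?a d))) integrable_on {c..d}"
      by (intro integrable_on_mult_left set_lebesgue_integral_eq_integral(1) \<alpha> that)
  qed (use lim bdy that in auto)
  have yd: "y d = y0 + integral {c..d} (\<lambda>t. h (G t) (y t))" if "d \<ge> c" for d
  proof -
    have "(\<lambda>N. S (Suc N) d - y0) \<longlonglongrightarrow> y d - y0"
      by (intro tendsto_diff tendsto_const LIMSEQ_Suc Sy that)
    then have "integral {c..d} (\<lambda>t. h (G t) (y t)) = y d - y0"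
      using lim[OF that] unfolding Sint[OF that] using LIMSEQ_unique by blast
    then show ?thesis by simp
  qed
  have yc: "y c = y0" using yd[of c] by simp
  have "prim c y (\<lambda>x. h (G x) (y x))"
    unfolding prim_def yc using ai yd by blast
  then show ?thesis using yc by (rule that)
qed

section \<open>Hermitian and positive definite matrices\<close>

lemma bounded_bilinear_matrix_vector_mult:
  "bounded_bilinear ((*v) :: complex^'n^'m \<Rightarrow> complex^'n \<Rightarrow> complex^'m)"
  unfolding bilinear_conv_bounded_bilinear[symmetric] bilinear_def
  by (intro conjI allI linearI)
    (auto simp: matrix_vector_mult_def vec_eq_iff algebra_simps sum.distrib scaleR_sum_right)

lemma bounded_bilinear_cdot: "bounded_bilinear (cdot :: complex^'m \<Rightarrow> complex^'m \<Rightarrow> complex)"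
  unfolding bilinear_conv_bounded_bilinear[symmetric] bilinear_def
  by (intro conjI allI linearI)
    (auto simp: cdot_def algebra_simps sum.distrib scaleR_sum_right)

interpretation mv: bounded_bilinear "(*v) :: complex^'n^'m \<Rightarrow> complex^'n \<Rightarrow> complex^'m"
  by (rule bounded_bilinear_matrix_vector_mult)

interpretation cdot: bounded_bilinear "cdot :: complex^'m \<Rightarrow> complex^'m \<Rightarrow> complex"
  by (rule bounded_bilinear_cdot)

lemma cdot_commute: "cdot v u = cnj (cdot u v)"
  by (simp add: cdot_def mult.commute)

lemma cdot_vector_scalar_left: "cdot (a *s u) v = cnj a * cdot u v"
  by (simp add: cdot_def sum_distrib_left mult_ac)

lemma cdot_vector_scalar_right: "cdot u (a *s v) = a * cdot u v"
  by (simp add: cdot_def sum_distrib_left mult_ac)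

lemma matrix_vector_scalar: "M *v (a *s v) = a *s (M *v v)" for M :: "complex^'n^'m"
  by (simp add: matrix_vector_mult_def vec_eq_iff sum_distrib_left mult_ac)

lemma Re_cdot: "Re (cdot u v) = u \<bullet> v"
  by (simp add: cdot_def inner_vec_def inner_complex_def)

lemma cdot_self: "cdot u u = of_real ((norm u)\<^sup>2)"
proof -
  have "Im (cdot u u) = 0" by (simp add: cdot_def mult.commute)
  then show ?thesis by (simp add: complex_eq_iff Re_cdot dot_square_norm)
qed

lemma norm_cdot_le: "norm (cdot u v) \<le> norm u * norm v"
proof -
  have "norm (cdot u v) \<le> (\<Sum>k\<in>UNIV. norm (u $ k) * norm (v $ k))"
    unfolding cdot_def by (rule sum_norm_le) (simp add: norm_mult)
  also have "\<dots> \<le> L2_set (\<lambda>k. norm (u $ k)) UNIV * L2_set (\<lambda>k. norm (v $ k)) UNIV"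
    using L2_set_mult_ineq[of "\<lambda>k. norm (u $ k)" "\<lambda>k. norm (v $ k)" UNIV] by simp
  finally show ?thesis by (simp add: norm_vec_def)
qed

lemma cdot_conj_transpose: "cdot (M *v u) v = cdot u (conj_transpose M *v v)"
proof -
  have "cdot (M *v u) v = (\<Sum>i\<in>UNIV. \<Sum>j\<in>UNIV. cnj (M $ i $ j) * cnj (u $ j) * v $ i)"
    by (simp add: cdot_def matrix_vector_mult_def sum_distrib_right)
  also have "\<dots> = (\<Sum>j\<in>UNIV. \<Sum>i\<in>UNIV. cnj (M $ i $ j) * cnj (u $ j) * v $ i)"
    by (rule sum.swap)
  also have "\<dots> = cdot u (conj_transpose M *v v)"
    by (simp add: cdot_def matrix_vector_mult_def conj_transpose_def sum_distrib_left mult_ac)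
  finally show ?thesis .
qed

lemma cdot_self_adjoint: "self_adjoint M \<Longrightarrow> cdot (M *v u) v = cdot u (M *v v)"
  by (simp add: cdot_conj_transpose self_adjoint_def)

lemma cdot_eqI: "(\<And>u. cdot u v = cdot u w) \<Longrightarrow> v = w"
proof -
  assume "\<And>u. cdot u v = cdot u w"
  then have "cdot (v - w) (v - w) = 0" by (simp add: cdot.diff_right)
  then show ?thesis by (simp add: cdot_self)
qed

lemma matrix_eqI: "(\<And>v. M *v v = N *v v) \<Longrightarrow> M = N" for M N :: "complex^'n^'m"
  by (simp add: matrix_eq)

lemma self_adjointI: "(\<And>u v. cdot (M *v u) v = cdot u (M *v v)) \<Longrightarrow> self_adjoint M"
  unfolding self_adjoint_def
  by (intro matrix_eqI cdot_eqI) (metis cdot_conj_transpose)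

lemma cdot_self_adjoint_real: "self_adjoint M \<Longrightarrow> cdot u (M *v u) = of_real (Re (cdot u (M *v u)))"
proof -
  assume "self_adjoint M"
  then have "cnj (cdot u (M *v u)) = cdot u (M *v u)" by (metis cdot_commute cdot_self_adjoint)
  then show ?thesis by (simp add: complex_eq_iff)
qed

lemma pos_def_self_adjoint: "pos_def M \<Longrightarrow> self_adjoint M"
  by (simp add: pos_def_def)

lemma pos_def_nonneg: "pos_def M \<Longrightarrow> 0 \<le> Re (cdot u (M *v u))"
  by (cases "u = 0") (auto simp: pos_def_def cdot.zero_left less_imp_le)

lemma pos_def_eq_0: "pos_def M \<Longrightarrow> Re (cdot u (M *v u)) = 0 \<Longrightarrow> u = 0"
  unfolding pos_def_def by (metis less_irrefl)

lemma pos_def_invertible: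
  assumes "pos_def M"
  shows "invertible M"
proof -
  have "inj ((*v) M)"
  proof (rule injI)
    fix u v assume "M *v u = M *v v"
    then have "M *v (u - v) = 0" by (simp add: mv.diff_right)
    then have "u - v = 0" by (intro pos_def_eq_0[OF assms]) (simp add: cdot.zero_right)
    then show "u = v" by simp
  qed
  then show ?thesis
    by (metis invertible_left_inverse matrix_left_invertible_injective)
qed

lemma matrix_inv_cancel:
  fixes M :: "complex^'m^'m"
  assumes "invertible M"
  shows "matrix_inv M *v (M *v u) = u" "M *v (matrix_inv M *v u) = u"
proof -
  have "M ** matrix_inv M = mat 1 \<and> matrix_inv M ** M = mat 1"
    using assms unfolding invertible_def matrix_inv_def by (rule someI_ex)
  then show "matrix_inv M *v (M *v u) = u" "M *v (matrix_inv M *v u) = u"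
    by (simp_all add: matrix_vector_mul_assoc)
qed

lemma self_adjoint_matrix_inv:
  assumes "self_adjoint M" "invertible M"
  shows "self_adjoint (matrix_inv M)"
  by (intro self_adjointI) (metis assms cdot_self_adjoint matrix_inv_cancel(2))

lemma pos_def_matrix_inv:
  assumes "pos_def M"
  shows "pos_def (matrix_inv M)"
  unfolding pos_def_def
proof (intro conjI allI impI)
  note inv = pos_def_invertible[OF assms]
  show "self_adjoint (matrix_inv M)" by (intro self_adjoint_matrix_inv inv pos_def_self_adjoint assms)
  fix v :: "complex^'a" assume "v \<noteq> 0"
  then have "matrix_inv M *v v \<noteq> 0" by (metis inv matrix_inv_cancel(2) mv.zero_right)
  then have "0 < Re (cdot (matrix_inv M *v v) (M *v (matrix_inv M *v v)))" using assms by (simp add: pos_def_def)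
  also have "\<dots> = Re (cdot v (matrix_inv M *v v))"
    using cdot_commute[of "matrix_inv M *v v" v] by (simp add: matrix_inv_cancel(2)[OF inv])
  finally show "0 < Re (cdot v (matrix_inv M *v v))" .
qed

lemma quadratic_form_add_le:
  assumes "pos_def M"
  shows "Re (cdot (u + v) (M *v (u + v))) \<le> 2 * Re (cdot u (M *v u)) + 2 * Re (cdot v (M *v v))"
  using pos_def_nonneg[OF assms, of "u - v"]
  by (simp add: mv.add_right mv.diff_right cdot.add_left cdot.add_right cdot.diff_left cdot.diff_right)

text \<open>Expand the nonnegative form at \<open>sqrt t\<close> times v minus
  \<open>e / sqrt t\<close> times u, where the phase e turns the mixed term into its
  modulus.\<close>

lemma pos_def_young:
  assumes M: "pos_def M" and "t > 0"
  shows "2 * norm (cdot v (M *v u)) \<le> t * Re (cdot v (M *v v)) + Re (cdot u (M *v u)) / t"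
proof -
  let ?w = "cdot v (M *v u)"
  define e where "e = (if ?w = 0 then 1 else cnj ?w / of_real (norm ?w))"
  have e: "e * ?w = of_real (norm ?w)" "norm e = 1"
    by (auto simp: e_def norm_divide mult.commute[of "cnj _"] complex_norm_square[symmetric] power2_eq_square)
  have ee: "cnj e * e = 1" using e(2) complex_norm_square[of e] by (simp add: mult.commute)
  define s where "s = sqrt t"
  have s: "s > 0" "s * s = t" using \<open>t > 0\<close> by (auto simp: s_def)
  let ?x = "complex_of_real s *s v" and ?y = "(e / complex_of_real s) *s u"
  have 1: "cdot ?x (M *v ?y) = of_real (norm ?w)"
    using s e(1) by (simp add: matrix_vector_scalar cdot_vector_scalar_left cdot_vector_scalar_right)
  have 2: "cdot ?y (M *v ?x) = of_real (norm ?w)"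
    using 1 cdot_self_adjoint[OF pos_def_self_adjoint[OF M], of ?x ?y]  cdot_commute[of ?y "M *v ?x"] by simp
  have 3: "cdot ?x (M *v ?x) = of_real t * cdot v (M *v v)"
    using s by (simp add: matrix_vector_scalar cdot_vector_scalar_left cdot_vector_scalar_right flip: of_real_mult mult.assoc)
  have 4: "cdot ?y (M *v ?y) = cdot u (M *v u) / of_real t"
    using s ee by (simp add: matrix_vector_scalar cdot_vector_scalar_left cdot_vector_scalar_right field_simps flip: of_real_mult)
  have "0 \<le> Re (cdot (?x - ?y) (M *v (?x - ?y)))" by (rule pos_def_nonneg[OF M])
  also have "\<dots> = Re (cdot ?x (M *v ?x)) + Re (cdot ?y (M *v ?y)) - Re (cdot ?x (M *v ?y)) - Re (cdot ?y (M *v ?x))"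
    by (simp add: mv.diff_right cdot.diff_left cdot.diff_right)
  also have "\<dots> = t * Re (cdot v (M *v v)) + Re (cdot u (M *v u)) / t - 2 * norm ?w"
    unfolding 1 2 3 4 by simp
  finally show ?thesis by simp
qed

text \<open>The form attains its minimum on the compact unit sphere, and that minimum is positive;
  homogeneity does the rest.\<close>

lemma pos_def_lower_bound:
  assumes "pos_def M"
  obtains k where "k > 0" "\<And>v. k * (norm v)\<^sup>2 \<le> Re (cdot v (M *v v))"
proof -
  have cont: "continuous_on (sphere 0 1) (\<lambda>v. Re (cdot v (M *v v)))"
    by (intro continuous_intros cdot.continuous_on mv.continuous_on)
  have "sphere (0::complex^'a) 1 \<noteq> {}" by simp
  then obtain w where w: "w \<in> sphere 0 1" "\<And>v. v \<in> sphere 0 1 \<Longrightarrow> Re (cdot w (M *v w)) \<le> Re (cdot v (M *v v))"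
    using continuous_attains_inf[OF compact_sphere _ cont] by blast
  show ?thesis
  proof
    show "Re (cdot w (M *v w)) > 0" using assms w(1) unfolding pos_def_def by (metis mem_sphere_0 norm_zero zero_neq_one)
    fix v :: "complex^'a"
    show "Re (cdot w (M *v w)) * (norm v)\<^sup>2 \<le> Re (cdot v (M *v v))"
    proof (cases "v = 0")
      case False
      define x where "x = (1 / norm v) *\<^sub>R v"
      have v: "v = norm v *\<^sub>R x" and "norm x = 1" using False by (auto simp: x_def)
      have "Re (cdot v (M *v v)) = (norm v)\<^sup>2 * Re (cdot x (M *v x))"
        by (subst (1 2) v) (simp add: mv.scaleR_right cdot.scaleR_left cdot.scaleR_right power2_eq_square)
      then show ?thesis using mult_right_mono[OF w(2)[of x], of "(norm v)\<^sup>2"] \<open>norm x = 1\<close>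
        by (simp add: mult.commute)
    qed (simp add: cdot.zero_left)
  qed
qed

lemma norm_matrix_vector_le_op_norm: "norm (M *v v) \<le> op_norm M * norm v" for M :: "complex^'m^'m"
  unfolding op_norm_def by (rule onorm) (rule mv.bounded_linear_right)

lemma op_norm_nonneg: "0 \<le> op_norm M" for M :: "complex^'m^'m"
  unfolding op_norm_def by (rule onorm_pos_le) (rule mv.bounded_linear_right)

lemma quadratic_form_le_op_norm: "norm (cdot v (M *v v)) \<le> op_norm M * (norm v)\<^sup>2"
proof -
  have "norm (cdot v (M *v v)) \<le> norm v * (op_norm M * norm v)"
    by (rule order_trans[OF norm_cdot_le mult_left_mono[OF norm_matrix_vector_le_op_norm]]) simp
  then show ?thesis by (simp add: power2_eq_square mult_ac)
qed

text \<open>For \<open>D = S - T\<close> one has \<open>S D + D T = 0\<close>; multiplying by \<open>D\<close> and taking traces gives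
  \<open>tr (D S D) + tr (D T D) = 0\<close>, and both summands are nonnegative.\<close>

lemma pos_def_sqrt_unique:
  assumes S: "pos_def S" and T: "pos_def T" and eq: "S ** S = T ** T"
  shows "S = T"
proof (rule matrix_eqI)
  fix v
  define D where "D = S - T"
  have Dv: "D *v x = S *v x - T *v x" for x by (simp add: D_def mv.diff_left)
  have sa: "self_adjoint D"
    by (intro self_adjointI)
      (simp add: Dv cdot.diff_left cdot.diff_right cdot_self_adjoint[OF pos_def_self_adjoint[OF S]]
        cdot_self_adjoint[OF pos_def_self_adjoint[OF T]])
  have SD: "S *v (D *v x) + D *v (T *v x) = 0" for x
    using arg_cong[OF eq, of "\<lambda>M. M *v x"] by (simp add: Dv mv.diff_right flip: matrix_vector_mul_assoc)
  have "\<exists>k. D *v axis k 1 \<noteq> 0" if "D *v v \<noteq> 0" for v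
  proof (rule ccontr)
    assume "\<not> (\<exists>k. D *v axis k 1 \<noteq> 0)"
    then have "D *v (\<Sum>k\<in>UNIV. (v $ k) *s axis k 1) = 0" by (simp add: mv.sum_right matrix_vector_scalar)
    then show False using that by (simp add: basis_expansion)
  qed
  moreover have "D *v axis k 1 = 0" for k
  proof -
    let ?e = "\<lambda>k. axis k (1::complex)"
    let ?d = "\<lambda>k. D *v ?e k"
    have "(\<Sum>k\<in>UNIV. cdot (?e k) (D *v (S *v ?d k))) + (\<Sum>k\<in>UNIV. cdot (?e k) (D *v (D *v (T *v ?e k)))) = 0"
      unfolding sum.distrib[symmetric] cdot.add_right[symmetric] mv.add_right[symmetric] SD
      by (simp add: mv.zero_right cdot.zero_right)
    moreover have tr: "(\<Sum>k\<in>UNIV. cdot (?e k) (M *v (N *v ?e k))) = (\<Sum>k\<in>UNIV. cdot (?e k) (N *v (M *v ?e k)))" for M N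
    proof -
      have e: "cdot (?e k) x = x $ k" for k x
        by (simp add: cdot_def axis_def if_distrib[of cnj] if_distrib[of "\<lambda>z. z * _"] cong: if_cong)
      have t: "(\<Sum>k\<in>UNIV. cdot (?e k) (M *v (N *v ?e k))) = trace (M ** N)" for M N
        by (simp add: e trace_def matrix_vector_mul_assoc)
          (simp add: matrix_vector_mult_def axis_def if_distrib[of "\<lambda>z. _ * z"] cong: if_cong)
      show ?thesis unfolding t by (rule trace_mul_sym)
    qed
    have "(\<Sum>k\<in>UNIV. cdot (?e k) (D *v (D *v (T *v ?e k)))) = (\<Sum>k\<in>UNIV. cdot (?e k) (D *v (T *v ?d k)))"
      using tr[of D "D ** T"] by (simp flip: matrix_vector_mul_assoc)
    ultimately have "(\<Sum>k\<in>UNIV. cdot (?d k) (S *v ?d k)) + (\<Sum>k\<in>UNIV. cdot (?d k) (T *v ?d k)) = 0"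
      by (simp add: cdot_self_adjoint[OF sa])
    then have 0: "(\<Sum>k\<in>UNIV. Re (cdot (?d k) (S *v ?d k))) + (\<Sum>k\<in>UNIV. Re (cdot (?d k) (T *v ?d k))) = 0"
      by (simp add: complex_eq_iff)
    have "(\<Sum>k\<in>UNIV. Re (cdot (?d k) (S *v ?d k))) \<ge> 0" "(\<Sum>k\<in>UNIV. Re (cdot (?d k) (T *v ?d k))) \<ge> 0"
      by (intro sum_nonneg pos_def_nonneg S T)+
    with 0 have "(\<Sum>k\<in>UNIV. Re (cdot (?d k) (S *v ?d k))) = 0" by linarith
    then have "Re (cdot (?d k) (S *v ?d k)) = 0"
      by (subst (asm) sum_nonneg_eq_0_iff) (auto intro: pos_def_nonneg S)
    then show ?thesis by (rule pos_def_eq_0[OF S])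
  qed
  ultimately have "D *v v = 0" by blast
  then show "S *v v = T *v v" by (simp add: Dv)
qed

lemma pos_def_contraction:
  fixes R :: "complex^'m^'m"
  assumes R: "pos_def R"
  obtains s \<alpha> where "s > 0" "0 \<le> \<alpha>" "\<alpha> < 1" "\<And>v. norm (v - s *\<^sub>R (R *v v)) \<le> \<alpha> * norm v"
proof -
  obtain k0 where "k0 > 0" and k0: "\<And>v. k0 * (norm v)\<^sup>2 \<le> Re (cdot v (R *v v))"
    using pos_def_lower_bound[OF R] by blast
  define N where "N = op_norm R + 1"
  define k where "k = min k0 N"
  have N: "N > 0" "norm (R *v v) \<le> N * norm v" for v
    using op_norm_nonneg[of R] norm_matrix_vector_le_op_norm[of R v] 
    by (auto simp: N_def distrib_right intro: order_trans)
  have k: "k > 0" "k \<le> N" "k * (norm v)\<^sup>2 \<le> Re (cdot v (R *v v))" for v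
    using \<open>k0 > 0\<close> N(1) order_trans[OF mult_right_mono k0, of k "v"] by (auto simp: k_def)
  \<comment> \<open>The squared norm of \<open>v - s R v\<close> is at most
    \<open>1 - 2 s k + s^2 N^2\<close> times that of v; s minimises this quadratic, and its minimum
    \<open>1 - k^2 / N^2\<close> is the square of \<alpha> below.\<close>
  define s where "s = k / N\<^sup>2"
  have "s > 0" using k N by (simp add: s_def)
  define \<alpha> where "\<alpha> = sqrt (1 - k\<^sup>2 / N\<^sup>2)"
  have kN: "k\<^sup>2 / N\<^sup>2 \<le> 1" using k N by (simp add: power_mono)
  show ?thesis
  proof
    show "s > 0" by fact
    show "0 \<le> \<alpha>" "\<alpha> < 1" using kN k N by (auto simp: \<alpha>_def)
    fix v
    have "(norm (v - s *\<^sub>R (R *v v)))\<^sup>2 = (norm v)\<^sup>2 - 2 * s * Re (cdot v (R *v v)) + s\<^sup>2 * (norm (R *v v))\<^sup>2"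
      by (simp add: Re_cdot power2_norm_eq_inner inner_diff_left inner_diff_right inner_commute)
        (simp add: power2_eq_square)
    also have "\<dots> \<le> (norm v)\<^sup>2 - 2 * s * (k * (norm v)\<^sup>2) + s\<^sup>2 * (N * norm v)\<^sup>2"
      using \<open>s > 0\<close> k(3)[of v] N(2)[of v] by (intro add_mono diff_mono mult_left_mono power_mono) auto
    also have "\<dots> = (\<alpha> * norm v)\<^sup>2"
      using kN N(1) by (simp add: \<alpha>_def s_def power_mult_distrib) (simp add: field_simps power2_eq_square)
    finally show "norm (v - s *\<^sub>R (R *v v)) \<le> \<alpha> * norm v"
      by (rule power2_le_imp_le) (use \<open>0 \<le> \<alpha>\<close> in auto)
  qed
qed

text \<open>With \<open>A = 1 - s R\<close> a strict contraction, a fixed point \<open>B\<close> of \<open>B \<mapsto> (A + B\<^sup>2) / 2\<close> satisfies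
  \<open>(1 - B)\<^sup>2 = s R\<close>.\<close>

lemma pos_def_sqrt_exists:
  fixes R :: "complex^'m^'m"
  assumes R: "pos_def R"
  obtains S where "pos_def S" "S ** S = R"
proof -
  obtain s \<alpha> where "s > 0" and \<alpha>: "0 \<le> \<alpha>" "\<alpha> < 1" "\<And>v. norm (v - s *\<^sub>R (R *v v)) \<le> \<alpha> * norm v"
    using pos_def_contraction[OF R] by blast
  define A where "A = Blinfun (\<lambda>v. v - s *\<^sub>R (R *v v))"
  have bl: "bounded_linear (\<lambda>v. v - s *\<^sub>R (R *v v))"
    by (intro bounded_linear_sub bounded_linear_ident bounded_linear_scaleR_right[THEN bounded_linear_compose] mv.bounded_linear_right)
  then have A: "A v = v - s *\<^sub>R (R *v v)" for v by (simp add: A_def bounded_linear_Blinfun_apply)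
  have nA: "norm A \<le> \<alpha>" by (rule norm_blinfun_bound) (use \<alpha> A in auto)
  \<comment> \<open>With this radius the ball is invariant, as (\<alpha> + \<rho>^2)/2 is at most
    (\<alpha> + 1)/2 = \<rho>, and \<rho> is also the contraction constant.\<close>
  define \<rho> where "\<rho> = (1 + \<alpha>) / 2"
  have \<rho>: "0 \<le> \<rho>" "\<rho> < 1" using \<alpha> by (auto simp: \<rho>_def)
  \<comment> \<open>Self-adjointness is a closed condition preserved by the iteration, so imposing
    it on the complete set makes the fixed point self-adjoint.\<close>
  define sa where "sa B \<longleftrightarrow> (\<forall>u v. cdot (blinfun_apply B u) v = cdot u (blinfun_apply B v))" for B :: "(complex^'m) \<Rightarrow>\<^sub>L (complex^'m)"
  have saA: "sa A"
    by (simp add: sa_def A cdot.diff_left cdot.diff_right cdot.scaleR_left cdot.scaleR_right cdot_self_adjoint[OF pos_def_self_adjoint[OF R]])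
  define X where "X = {B. norm B \<le> \<rho> \<and> sa B}"
  define f where "f B = (1/2) *\<^sub>R (A + (B o\<^sub>L B))" for B
  have "closed X"
  proof -
    have "closed {B. cdot (blinfun_apply B u) v = cdot u (blinfun_apply B v)}" for u v :: "complex^'m"
      by (intro closed_Collect_eq cdot.continuous_on continuous_intros)
    then have "closed {B. sa B}" unfolding sa_def by (intro closed_Collect_all)
    moreover have "closed {B :: (complex^'m) \<Rightarrow>\<^sub>L (complex^'m). norm B \<le> \<rho>}" by (intro closed_Collect_le continuous_intros)
    ultimately show ?thesis unfolding X_def by (intro closed_Collect_conj)
  qed
  then have "complete X" by (simp add: complete_eq_closed)
  moreover have "X \<noteq> {}"
  proof -
    have "0 \<in> X" using \<rho> by (simp add: X_def sa_def cdot.zero_left cdot.zero_right)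
    then show ?thesis by blast
  qed
  moreover have "f ` X \<subseteq> X"
  proof
    fix C assume "C \<in> f ` X"
    then obtain B where B: "norm B \<le> \<rho>" "sa B" and C: "C = f B" by (auto simp: X_def)
    have "sa C" using B(2) saA
      by (simp add: C f_def sa_def blinfun.add_left blinfun.scaleR_left cdot.add_left cdot.add_right cdot.scaleR_left cdot.scaleR_right)
    moreover have "norm C \<le> \<rho>"
    proof -
      have "norm (B o\<^sub>L B) \<le> \<rho> * \<rho>"
        by (rule order_trans[OF norm_blinfun_compose]) (use B \<rho> in \<open>auto intro: mult_mono\<close>)
      then have "norm (A + (B o\<^sub>L B)) \<le> \<alpha> + \<rho> * \<rho>" using nA by (intro order_trans[OF norm_triangle_ineq] add_mono)
      moreover have "\<alpha> + \<rho> * \<rho> \<le> 2 * \<rho>"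
      proof -
        have "\<rho> * \<rho> \<le> 1" using \<rho> by (simp add: mult_le_one)
        then show ?thesis by (simp add: \<rho>_def)
      qed
      ultimately show ?thesis by (simp add: C f_def)
    qed
    ultimately show "C \<in> X" by (simp add: X_def)
  qed
  moreover have "dist (f B) (f C) \<le> \<rho> * dist B C" if "B \<in> X" "C \<in> X" for B C
  proof -
    have "f B - f C = (1/2) *\<^sub>R ((B o\<^sub>L (B - C)) + ((B - C) o\<^sub>L C))"
      by (rule blinfun_eqI) (simp add: f_def blinfun.add_left blinfun.scaleR_left blinfun.diff_left blinfun.diff_right algebra_simps)
    then have "norm (f B - f C) = (1/2) * norm ((B o\<^sub>L (B - C)) + ((B - C) o\<^sub>L C))" by simp
    also have "\<dots> \<le> (1/2) * (norm B * norm (B - C) + norm (B - C) * norm C)"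
      by (intro mult_left_mono order_trans[OF norm_triangle_ineq] add_mono norm_blinfun_compose) simp
    also have "\<dots> \<le> (1/2) * (\<rho> * norm (B - C) + norm (B - C) * \<rho>)"
      using that by (intro mult_left_mono add_mono mult_right_mono) (auto simp: X_def)
    finally show ?thesis by (simp add: dist_norm)
  qed
  ultimately obtain B where B: "B \<in> X" "f B = B"
    using Banach_fix[of X \<rho> f] \<rho> by blast
  then have "sa B" "norm B \<le> \<rho>" by (auto simp: X_def)
  have B2: "B v + B v = A v + B (B v)" for v
  proof -
    have eq: "B v = (1/2) *\<^sub>R (A v + B (B v))"
      by (subst B(2)[symmetric]) (simp add: f_def blinfun.add_left blinfun.scaleR_left)
    then have "B v + B v = (1/2) *\<^sub>R (A v + B (B v)) + (1/2) *\<^sub>R (A v + B (B v))" using eq by (rule arg_cong2[where f="(+)"])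
    also have "\<dots> = (1/2 + 1/2) *\<^sub>R (A v + B (B v))" by (simp only: scaleR_add_left)
    finally show ?thesis by simp
  qed
  \<comment> \<open>The square root read off from \<open>(1 - B)^2 = s R\<close>.\<close>
  define T where "T v = (1 / sqrt s) *\<^sub>R (v - B v)" for v
  have saT: "cdot (T u) v = cdot u (T v)" for u v
    using \<open>sa B\<close> by (simp add: T_def sa_def cdot.scaleR_left cdot.scaleR_right cdot.diff_left cdot.diff_right)
  have "T (u + v) = T u + T v" for u v
    by (simp add: T_def blinfun.add_right algebra_simps)
  \<comment> \<open>Bounded linear functions are only real linear here; complex homogeneity follows
    from the symmetry of T with respect to \<open>cdot\<close>.\<close>
  moreover have "T (a *s v) = a *s T v" for a v
    by (rule cdot_eqI) (simp add: saT[symmetric] cdot_vector_scalar_right)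
  ultimately have "Vector_Spaces.linear (*s) (*s) T"
    unfolding Vector_Spaces.linear_iff using vec.vector_space_axioms by blast
  then have mT: "matrix T *v v = T v" for v by (rule matrix_works)
  show ?thesis
  proof
    show "matrix T ** matrix T = R"
    proof (rule matrix_eqI)
      fix v
      have "T (T v) = (1 / s) *\<^sub>R (v - B v - (B v - B (B v)))"
        using \<open>s > 0\<close> by (simp add: T_def blinfun.scaleR_right blinfun.diff_right scaleR_diff_right[symmetric] flip: real_sqrt_mult)
      also have "v - B v - (B v - B (B v)) = s *\<^sub>R (R *v v)"
        using B2[of v] unfolding A by (simp add: algebra_simps)
      finally show "(matrix T ** matrix T) *v v = R *v v"
        using \<open>s > 0\<close> by (simp add: mT flip: matrix_vector_mul_assoc)
    qed
    show "pos_def (matrix T)" unfolding pos_def_def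
    proof (intro conjI allI impI)
      show "self_adjoint (matrix T)" by (rule self_adjointI) (simp add: mT saT)
      fix v :: "complex^'m" assume "v \<noteq> 0"
      have "Re (cdot v (B v)) \<le> norm v * norm (B v)" using norm_cdot_le[of v "B v"] complex_Re_le_cmod order_trans by blast
      also have "\<dots> \<le> norm v * (\<rho> * norm v)"
        using \<open>norm B \<le> \<rho>\<close> by (intro mult_left_mono order_trans[OF norm_blinfun mult_right_mono]) auto
      also have "\<dots> < (norm v)\<^sup>2" using \<rho> \<open>v \<noteq> 0\<close> by (simp add: power2_eq_square)
      finally show "0 < Re (cdot v (matrix T *v v))"
        using \<open>s > 0\<close> by (simp add: mT T_def cdot.scaleR_right cdot.diff_right cdot_self)
    qed
  qed
qed

lemma mat_sqrt:
  assumes "pos_def R"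
  shows "pos_def (mat_sqrt R)" "mat_sqrt R ** mat_sqrt R = R"
proof -
  have "\<exists>!S. pos_def S \<and> S ** S = R"
    using pos_def_sqrt_exists[OF assms] pos_def_sqrt_unique by metis
  from theI'[OF this] show "pos_def (mat_sqrt R)" "mat_sqrt R ** mat_sqrt R = R"
    unfolding mat_sqrt_def by auto
qed

text \<open>With w the image of u under the root of R, the form of P at u is the form of the
  conjugated matrix at w, and the squared norm of w is the form of R at u. This is how the growth
  hypothesis acts on energies.\<close>

lemma quadratic_form_le_mat_inv_sqrt:
  assumes R: "pos_def R"
  shows "Re (cdot u (P *v u)) \<le> op_norm (mat_inv_sqrt R ** P ** mat_inv_sqrt R) * Re (cdot u (R *v u))"
proof -
  let ?S = "mat_sqrt R" and ?T = "mat_inv_sqrt R"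
  note S = mat_sqrt[OF R]
  have inv: "invertible ?S" by (rule pos_def_invertible[OF S(1)])
  define w where "w = ?S *v u"
  have u: "u = ?T *v w" unfolding w_def mat_inv_sqrt_def by (simp add: matrix_inv_cancel[OF inv])
  have T: "self_adjoint ?T" unfolding mat_inv_sqrt_def by (intro self_adjoint_matrix_inv inv pos_def_self_adjoint S)
  have "cdot u (P *v u) = cdot w ((?T ** P ** ?T) *v w)"
    unfolding u by (simp add: cdot_self_adjoint[OF T] flip: matrix_vector_mul_assoc)
  then have "Re (cdot u (P *v u)) \<le> op_norm (?T ** P ** ?T) * (norm w)\<^sup>2"
    using quadratic_form_le_op_norm[of w "?T ** P ** ?T"] complex_Re_le_cmod order_trans by metis
  also have "(norm w)\<^sup>2 = Re (cdot w w)" by (simp add: cdot_self)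
  also have "cdot w w = cdot u (R *v u)"
    unfolding w_def by (simp add: cdot_self_adjoint[OF pos_def_self_adjoint[OF S(1)]] matrix_vector_mul_assoc S(2))
  finally show ?thesis .
qed

section \<open>Integrals on a half-line\<close>

lemma bounded_linear_axis: "bounded_linear (axis i :: 'a::euclidean_space \<Rightarrow> 'a^'n)"
  unfolding linear_conv_bounded_linear[symmetric]
  by (intro linearI) (auto simp: vec_eq_iff axis_def)

lemma vec_axis_sum: "v = (\<Sum>i\<in>UNIV. axis i (v $ i))" for v :: "('a::euclidean_space)^'n"
  by (simp add: vec_eq_iff axis_def if_distrib[of "\<lambda>z. z $ _"] cong: if_cong)

lemma borel_measurable_vec:
  fixes f :: "'b \<Rightarrow> ('a::euclidean_space)^'n"
  assumes "\<And>i. (\<lambda>x. f x $ i) \<in> borel_measurable M"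
  shows "f \<in> borel_measurable M"
proof -
  have ax: "(axis i :: 'a \<Rightarrow> 'a^'n) \<in> borel_measurable borel" for i
    by (intro borel_measurable_continuous_onI linear_continuous_on bounded_linear_axis)
  have "(\<lambda>x. \<Sum>i\<in>UNIV. axis i (f x $ i)) \<in> borel_measurable M"
    by (intro borel_measurable_sum measurable_compose[OF assms ax])
  then show ?thesis by (simp flip: vec_axis_sum)
qed

lemma borel_measurable_vec_nth:
  fixes f :: "'b \<Rightarrow> ('a::euclidean_space)^'n"
  assumes "f \<in> borel_measurable M"
  shows "(\<lambda>x. f x $ i) \<in> borel_measurable M"
proof -
  have "(\<lambda>v. v $ i) \<in> borel_measurable (borel :: ('a^'n) measure)"
    by (intro borel_measurable_continuous_onI linear_continuous_on bounded_linear_vec_nth)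
  from measurable_compose[OF assms this] show ?thesis .
qed

lemma absolutely_integrable_vec:
  fixes f :: "real \<Rightarrow> ('a::euclidean_space)^'n"
  assumes "\<And>i. (\<lambda>x. f x $ i) absolutely_integrable_on S"
  shows "f absolutely_integrable_on S"
proof -
  have "(\<lambda>x. \<Sum>i\<in>UNIV. axis i (f x $ i)) absolutely_integrable_on S"
    by (intro absolutely_integrable_sum absolutely_integrable_linear[OF assms bounded_linear_axis, unfolded o_def]) auto
  then show ?thesis by (simp flip: vec_axis_sum)
qed

lemma L1_mat_absolutely_integrable: "L1_mat a b M \<Longrightarrow> M absolutely_integrable_on {a..b}"
  unfolding L1_mat_def by (intro absolutely_integrable_vec) auto

lemma ac_on_add:
  assumes "ac_on a b f" "ac_on a b g" shows "ac_on a b (\<lambda>x. f x + g x)"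
proof (rule ac_on_by_variation[OF assms])
  show "family_var (\<lambda>x. f x + g x) xs \<le> 1 * (family_var f xs + family_var g xs)" for xs
  proof (induction xs)
    case (Cons p xs)
    have "norm (f (snd p) + g (snd p) - (f (fst p) + g (fst p))) \<le> norm (f (snd p) - f (fst p)) + norm (g (snd p) - g (fst p))"
      by (metis add_diff_add norm_triangle_ineq)
    then show ?case using Cons by simp
  qed simp
qed

lemma ac_on_linear:
  assumes "bounded_linear h" "ac_on a b f" shows "ac_on a b (\<lambda>x. h (f x))"
proof -
  interpret bounded_linear h by fact
  obtain K where K: "K \<ge> 0" "\<And>x. norm (h x) \<le> norm x * K" using nonneg_bounded by blast
  have "family_var (\<lambda>x. h (f x)) xs \<le> K * (family_var f xs + family_var f xs)" for xs
  proof (induction xs)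
    case (Cons p xs)
    have "norm (h (f (snd p)) - h (f (fst p))) \<le> norm (f (snd p) - f (fst p)) * K"
      using K(2)[of "f (snd p) - f (fst p)"] by (simp add: diff)
    moreover have "0 \<le> norm (f (snd p) - f (fst p)) * K" using K(1) by simp
    ultimately show ?case using Cons by (simp add: algebra_simps)
  qed simp
  then show ?thesis by (rule ac_on_by_variation[OF assms(2,2)])
qed

lemma ac_on_const: "ac_on a b (\<lambda>x. k)"
proof -
  have "family_var (\<lambda>x. k) xs = 0" for xs by (induction xs) auto
  then show ?thesis unfolding ac_on_iff_family by (metis zero_less_one)
qed

lemma ac_on_sum: "finite I \<Longrightarrow> (\<And>i. i \<in> I \<Longrightarrow> ac_on a b (f i)) \<Longrightarrow> ac_on a b (\<lambda>x. \<Sum>i\<in>I. f i x)"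
  by (induction I rule: finite_induct) (auto intro: ac_on_const ac_on_add)

lemma ac_on_vec:
  fixes f :: "real \<Rightarrow> ('a::euclidean_space)^'n"
  assumes "\<And>i. ac_on a b (\<lambda>x. f x $ i)" shows "ac_on a b f"
proof -
  have "ac_on a b (\<lambda>x. \<Sum>i\<in>UNIV. axis i (f x $ i))"
    by (intro ac_on_sum ac_on_linear[OF bounded_linear_axis assms]) auto
  then show ?thesis by (simp flip: vec_axis_sum)
qed

lemma AC_vec_iff: "AC_vec a b u \<longleftrightarrow> ac_on a b u"
proof
  assume "AC_vec a b u"
  then show "ac_on a b u" unfolding AC_vec_def abs_continuous_on_eq by (intro ac_on_vec) auto
qed (auto simp: AC_vec_def abs_continuous_on_eq intro: ac_on_linear[OF bounded_linear_vec_nth])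

lemma AC_mat_ac_on: "AC_mat a b M \<Longrightarrow> ac_on a b M"
  unfolding AC_mat_def abs_continuous_on_eq by (intro ac_on_vec) auto

lemma AE_halfline_ge: "AE x in lebesgue_on {c..}. c \<le> (x::real)"
  by (auto simp: AE_lebesgue_on_halfline_iff intro!: exI[of _ "{}"])

lemma halfline_sets [simp]: "{c..} \<in> sets lebesgue" for c :: real
  by (intro sets_completionI_sets) simp

text \<open>A null set contains no interval, so x is the limit of good points from its right.
  Approaching from the right works at the left end c as well.\<close>

lemma AE_imp_right_limit:
  fixes f :: "real \<Rightarrow> 'a::t2_space"
  assumes "continuous_on {c..} f" "c \<le> x" "x < d"
    and "AE y in lebesgue_on {c..}. x < y \<and> y < d \<longrightarrow> f y = k"
  shows "f x = k"
proof -
  obtain N where N: "negligible N" "\<And>y. y \<ge> c \<Longrightarrow> y \<notin> N \<Longrightarrow> x < y \<and> y < d \<longrightarrow> f y = k"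
    using assms(4) unfolding AE_lebesgue_on_halfline_iff by blast
  have "\<exists>y. x < y \<and> y < min d (x + 1 / real (Suc n)) \<and> y \<notin> N" for n
  proof (rule ccontr)
    assume "\<nexists>y. x < y \<and> y < min d (x + 1 / real (Suc n)) \<and> y \<notin> N"
    then have "{x<..<min d (x + 1 / real (Suc n))} \<subseteq> N" by auto
    then have "negligible {x<..<min d (x + 1 / real (Suc n))}" using N(1) negligible_subset by blast
    moreover have "\<not> negligible {x<..<min d (x + 1 / real (Suc n))}"
    proof -
      have "1 / real (Suc n) > 0" by simp
      then have "x < min d (x + 1 / real (Suc n))" using assms(3) by (simp del: of_nat_Suc)
      then show ?thesis by (intro open_not_negligible open_greaterThanLessThan) (simp del: of_nat_Suc min_less_iff_conj)
    qed
    ultimately show False by blast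
  qed
  then obtain y where y: "\<And>n. x < y n" "\<And>n. y n < min d (x + 1 / real (Suc n))" "\<And>n. y n \<notin> N" by metis
  have "y \<longlonglongrightarrow> x"
  proof (rule tendsto_sandwich[of "\<lambda>n. x" _ _ "\<lambda>n. x + 1 / real (Suc n)"])
    show "(\<lambda>n. x + 1 / real (Suc n)) \<longlonglongrightarrow> x"
      using tendsto_add[OF tendsto_const[of x] LIMSEQ_Suc[OF lim_1_over_n]] by simp
  qed (use y in \<open>auto intro!: always_eventually less_imp_le\<close>)
  moreover have "c \<le> y n" for n using y(1)[of n] assms(2) by linarith
  ultimately have "(\<lambda>n. f (y n)) \<longlonglongrightarrow> f x"
    using assms(2) by (intro continuous_on_tendsto_compose[OF assms(1)]) auto
  moreover have "f (y n) = k" for n using N(2)[of "y n"] y[of n] assms(2) by auto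
  ultimately have "(\<lambda>n. k) \<longlonglongrightarrow> f x" by simp
  then show ?thesis by (simp add: tendsto_const_iff)
qed

lemma AE_eq_continuous:
  fixes f g :: "real \<Rightarrow> 'a::real_normed_vector"
  assumes "continuous_on {c..} f" "continuous_on {c..} g" "AE x in lebesgue_on {c..}. f x = g x" "c \<le> x"
  shows "f x = g x"
proof -
  have "f x - g x = 0"
    by (rule AE_imp_right_limit[of c "\<lambda>x. f x - g x" x "x+1"])
      (use assms in \<open>auto intro!: continuous_intros elim: eventually_mono\<close>)
  then show ?thesis by simp
qed

lemma integral_le_AE:
  fixes f g :: "real \<Rightarrow> real"
  assumes "f integrable_on S" "g integrable_on S" "S \<subseteq> {c..}" "AE x in lebesgue_on {c..}. x \<in> S \<longrightarrow> f x \<le> g x"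
  shows "integral S f \<le> integral S g"
proof -
  obtain N where N: "negligible N" "\<And>y. y \<ge> c \<Longrightarrow> y \<notin> N \<Longrightarrow> y \<in> S \<longrightarrow> f y \<le> g y"
    using assms(4) unfolding AE_lebesgue_on_halfline_iff by blast
  let ?f = "\<lambda>x. if x \<in> N then g x else f x"
  have "?f integrable_on S" "integral S f = integral S ?f"
    by (rule integrable_spike[OF assms(1) N(1)] integral_spike[OF N(1)]; simp)+
  moreover have "integral S ?f \<le> integral S g"
    by (rule integral_le[OF \<open>?f integrable_on S\<close> assms(2)]) (use N assms(3) in auto)
  ultimately show ?thesis by simp
qed

lemma integral_nonneg_AE':
  fixes f :: "real \<Rightarrow> real"
  assumes "f integrable_on S" "S \<subseteq> {c..}" "AE x in lebesgue_on {c..}. x \<in> S \<longrightarrow> 0 \<le> f x"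
  shows "0 \<le> integral S f"
  using integral_le_AE[of "\<lambda>x. 0" S f c] assms by (simp add: integrable_0)

lemma integral_mono_upper_AE:
  fixes f :: "real \<Rightarrow> real"
  assumes "f integrable_on {c..b}" "c \<le> a" "a \<le> b" "AE x in lebesgue_on {c..}. 0 \<le> f x"
  shows "integral {c..a} f \<le> integral {c..b} f"
proof -
  have "integral {c..a} f + integral {a..b} f = integral {c..b} f"
    using assms by (intro Henstock_Kurzweil_Integration.integral_combine) auto
  moreover have "0 \<le> integral {a..b} f"
    by (rule integral_nonneg_AE'[of _ _ c]) (use assms in \<open>auto intro: integrable_on_subinterval\<close>)
  ultimately show ?thesis by simp
qed

lemma halfline_integral:
  fixes G :: "real \<Rightarrow> 'a::euclidean_space"
  assumes G: "G absolutely_integrable_on {c..b}" and 0: "\<And>x. x > b \<Longrightarrow> G x = 0"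
  shows "integrable (lebesgue_on {c..}) G" "(LINT x|lebesgue_on {c..}. G x) = integral {c..b} G"
proof -
  have eq: "(\<lambda>x. indicator {c..b} x *\<^sub>R G x) = (\<lambda>x. indicator {c..} x *\<^sub>R G x)"
    using 0 by (auto simp: fun_eq_iff indicator_def) (metis not_less)
  have i: "integrable lebesgue (\<lambda>x. indicator {c..} x *\<^sub>R G x)"
    using G unfolding set_integrable_def eq .
  then show "integrable (lebesgue_on {c..}) G" by (simp add: integrable_restrict_space)
  have "(LINT x|lebesgue_on {c..}. G x) = (LINT x:{c..b}|lebesgue. G x)"
    by (simp add: integral_restrict_space set_lebesgue_integral_def eq)
  also have "\<dots> = integral {c..b} G" by (rule set_lebesgue_integral_eq_integral(2)[OF G])
  finally show "(LINT x|lebesgue_on {c..}. G x) = integral {c..b} G" .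
qed

text \<open>Monotone convergence along the intervals [c, c + k], after f has been replaced by 0 on
  the null set where it may be negative.\<close>

lemma halfline_integrable_of_bounded:
  fixes f :: "real \<Rightarrow> real"
  assumes f: "\<And>d. d \<ge> c \<Longrightarrow> f integrable_on {c..d}" and bd: "\<And>d. d \<ge> c \<Longrightarrow> integral {c..d} f \<le> K"
    and nn: "AE x in lebesgue_on {c..}. 0 \<le> f x"
  shows "integrable (lebesgue_on {c..}) f"
proof -
  obtain N where N: "negligible N" "\<And>x. x \<ge> c \<Longrightarrow> x \<notin> N \<Longrightarrow> 0 \<le> f x"
    using nn unfolding AE_lebesgue_on_halfline_iff by blast
  define g where "g x = (if x \<in> N then 0 else f x)" for x
  have g: "g integrable_on {c..d}" "integral {c..d} g \<le> K" if "d \<ge> c" for d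
  proof -
    show "g integrable_on {c..d}" by (rule integrable_spike[OF f[OF that] N(1)]) (simp add: g_def)
    have "integral {c..d} f = integral {c..d} g" by (rule integral_spike[OF N(1)]) (simp add: g_def)
    then show "integral {c..d} g \<le> K" using bd[OF that] by simp
  qed
  have g0: "0 \<le> g x" if "x \<ge> c" for x using N(2) that by (auto simp: g_def)
  let ?h = "\<lambda>k x. if x \<in> {c..c + real k} then g x else 0"
  have hi: "integral {c..} (?h k) = integral {c..c + real k} g" for k
  proof -
    have "integral {c..} (?h k) = integral ({c..c + real k} \<inter> {c..}) g"
      by (rule Henstock_Kurzweil_Integration.integral_restrict_Int)
    moreover have "{c..c + real k} \<inter> {c..} = {c..c + real k}" by auto
    ultimately show ?thesis by simp
  qed
  have "g integrable_on {c..} \<and> (\<lambda>k. integral {c..} (?h k)) \<longlonglongrightarrow> integral {c..} g"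
  proof (rule monotone_convergence_increasing)
    fix k
    have "?h k integrable_on {c..}"
    proof -
      have "{c..c + real k} \<inter> {c..} = {c..c + real k}" by auto
      then show ?thesis using g(1)[of "c + real k"] by (subst integrable_restrict_Int) simp
    qed
    then show "?h k integrable_on {c..}" .
    show "?h k x \<le> ?h (Suc k) x" if "x \<in> {c..}" for x using g0 that by auto
  next
    fix x assume "x \<in> {c..}"
    obtain k0 where "x - c < real k0" using reals_Archimedean2 by blast
    then show "(\<lambda>k. ?h k x) \<longlonglongrightarrow> g x"
      using \<open>x \<in> {c..}\<close> by (intro tendsto_eventually eventually_sequentiallyI[of k0]) auto
  next
    have "0 \<le> integral {c..c + real k} g" for k
      by (rule Henstock_Kurzweil_Integration.integral_nonneg) (use g g0 in auto)
    then show "bounded (range (\<lambda>k. integral {c..} (?h k)))"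
      unfolding hi bounded_iff using g(2) by (intro exI[of _ K]) (auto simp: abs_of_nonneg)
  qed
  then have "g absolutely_integrable_on {c..}"
    by (intro nonnegative_absolutely_integrable_1) (use g0 in auto)
  then have "f absolutely_integrable_on {c..}"
    by (rule absolutely_integrable_spike[OF _ N(1)]) (simp add: g_def)
  then show ?thesis by (simp add: set_integrable_def integrable_restrict_space)
qed

lemma borel_measurable_lebesgue_on_AE:
  fixes f g :: "real \<Rightarrow> 'a::euclidean_space"
  assumes f: "f \<in> borel_measurable (lebesgue_on {c..})" and "AE x in lebesgue_on {c..}. f x = g x"
  shows "g \<in> borel_measurable (lebesgue_on {c..})"
proof -
  have "(\<lambda>x. if x \<in> {c..} then f x else 0) \<in> borel_measurable lebesgue"
    by (rule borel_measurable_if[OF halfline_sets, THEN iffD2, OF f])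
  moreover have "AE x in lebesgue. (if x \<in> {c..} then f x else 0) = (if x \<in> {c..} then g x else 0)"
  proof -
    have "AE x in lebesgue. x \<in> {c..} \<longrightarrow> f x = g x"
      using assms(2) AE_restrict_space_iff[of "{c..}" lebesgue "\<lambda>x. f x = g x"] by simp
    then show ?thesis by eventually_elim auto
  qed
  ultimately have "(\<lambda>x. if x \<in> {c..} then g x else 0) \<in> borel_measurable lebesgue"
    by (rule borel_measurable_AE)
  then show ?thesis by (rule borel_measurable_if[OF halfline_sets, THEN iffD1])
qed

text \<open>By Cramer's rule the entries are quotients of determinants, hence measurable; the choice
  in \<open>matrix_inv\<close> gives no direct access to measurability.\<close>

lemma borel_measurable_matrix_inv_mult:
  fixes A :: "real \<Rightarrow> complex^'m^'m" and s :: "real \<Rightarrow> complex^'m"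
  assumes A: "A \<in> borel_measurable (lebesgue_on {c..})" and s: "s \<in> borel_measurable (lebesgue_on {c..})"
    and inv: "AE x in lebesgue_on {c..}. invertible (A x)"
  shows "(\<lambda>x. matrix_inv (A x) *v s x) \<in> borel_measurable (lebesgue_on {c..})"
proof (rule borel_measurable_lebesgue_on_AE)
  have m: "(\<lambda>x. A x $ i $ j) \<in> borel_measurable (lebesgue_on {c..})" "(\<lambda>x. s x $ i) \<in> borel_measurable (lebesgue_on {c..})" for i j
    by (intro borel_measurable_vec_nth A s)+
  have det: "(\<lambda>x. det (B x)) \<in> borel_measurable (lebesgue_on {c..})"
    if "\<And>i j. (\<lambda>x. B x $ i $ j) \<in> borel_measurable (lebesgue_on {c..})" for B :: "real \<Rightarrow> complex^'m^'m"
    unfolding det_def by (intro borel_measurable_sum borel_measurable_times borel_measurable_prod that borel_measurable_const)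
  show "(\<lambda>x. \<chi> k. det (\<chi> i j. if j = k then s x $ i else A x $ i $ j) / det (A x)) \<in> borel_measurable (lebesgue_on {c..})"
  proof (rule borel_measurable_vec, simp only: vec_lambda_beta, intro borel_measurable_divide det)
    show "(\<lambda>x. (\<chi> i j. if j = k then s x $ i else A x $ i $ j) $ i $ j) \<in> borel_measurable (lebesgue_on {c..})" for k i j
      by (cases "j = k") (simp_all add: m)
  qed (rule m)
  show "AE x in lebesgue_on {c..}. (\<chi> k. det (\<chi> i j. if j = k then s x $ i else A x $ i $ j) / det (A x)) = matrix_inv (A x) *v s x"
    using inv
  proof eventually_elim
    case (elim x)
    then have "det (A x) \<noteq> 0" by (simp add: invertible_det_nz)
    from cramer[OF this, of "matrix_inv (A x) *v s x" "s x"] matrix_inv_cancel(2)[OF elim]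
    show ?case by simp
  qed
qed

section \<open>The differential expression as a first order system\<close>

locale sturm_liouville =
  fixes c :: real and P Q R :: "real \<Rightarrow> complex^'m^'m"
  assumes R_meas: "R \<in> borel_measurable (lebesgue_on {c..})"
    and P_pos: "AE x in lebesgue_on {c..}. pos_def (P x)"
    and R_pos: "AE x in lebesgue_on {c..}. pos_def (R x)"
    and Q_sa: "AE x in lebesgue_on {c..}. self_adjoint (Q x)"
    and Pinv_L1: "\<And>d. d \<ge> c \<Longrightarrow> L1_mat c d (\<lambda>x. matrix_inv (P x))"
    and Q_L1: "\<And>d. d \<ge> c \<Longrightarrow> L1_mat c d Q"
    and R_L1: "\<And>d. d \<ge> c \<Longrightarrow> L1_mat c d R"
    and P_AC: "\<And>\<rho>. \<rho> > 0 \<Longrightarrow> AC_mat c (c + \<rho>) P"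
begin

lemma Pinv_int: "d \<ge> c \<Longrightarrow> (\<lambda>x. matrix_inv (P x)) absolutely_integrable_on {c..d}"
  and Q_int: "d \<ge> c \<Longrightarrow> Q absolutely_integrable_on {c..d}"
  and R_int: "d \<ge> c \<Longrightarrow> R absolutely_integrable_on {c..d}"
  by (intro L1_mat_absolutely_integrable Pinv_L1 Q_L1 R_L1; assumption)+

lemma P_prim: "prim c P (hderiv c P)"
proof (rule ac_prim_hderiv)
  fix d assume "d \<ge> c"
  have "ac_on c (c + (d - c + 1)) P" by (rule AC_mat_ac_on[OF P_AC]) (use \<open>d \<ge> c\<close> in auto)
  then show "ac_on c d P" by (rule ac_on_subset) auto
qed

text \<open>\<open>SL u p f\<close> is \<open>L u = f\<close> with quasi-derivative \<open>p = P u'\<close>, written as a first order system.\<close>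

definition SL :: "(real \<Rightarrow> complex^'m) \<Rightarrow> (real \<Rightarrow> complex^'m) \<Rightarrow> (real \<Rightarrow> complex^'m) \<Rightarrow> bool" where
  "SL u p f \<longleftrightarrow> prim c u (\<lambda>x. matrix_inv (P x) *v p x) \<and> prim c p (\<lambda>x. Q x *v u x - R x *v f x)"

lemma SL_continuous: "SL u p f \<Longrightarrow> continuous_on {c..} u" "SL u p f \<Longrightarrow> continuous_on {c..} p"
  unfolding SL_def by (auto intro: prim_continuous)

lemma SL_add:
  assumes "SL u p f" "SL v q g" shows "SL (\<lambda>x. u x + v x) (\<lambda>x. p x + q x) (\<lambda>x. f x + g x)"
  using prim_add[OF conjunct1 conjunct1, OF assms[unfolded SL_def]] 
    prim_add[OF conjunct2 conjunct2, OF assms[unfolded SL_def]]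
  unfolding SL_def by (simp add: mv.add_right algebra_simps)

lemma bounded_linear_vector_scalar: "bounded_linear (\<lambda>v::complex^'n. a *s v)"
  unfolding linear_conv_bounded_linear[symmetric]
  by (intro linearI) (auto simp: vec_eq_iff algebra_simps)

lemma SL_scale:
  assumes "SL u p f" shows "SL (\<lambda>x. a *s u x) (\<lambda>x. a *s p x) (\<lambda>x. a *s f x)"
proof -
  have u: "prim c u (\<lambda>x. matrix_inv (P x) *v p x)" and p: "prim c p (\<lambda>x. Q x *v u x - R x *v f x)"
    using assms by (auto simp: SL_def)
  have eq: "a *s (M *v v - N *v w) = M *v (a *s v) - N *v (a *s w)" "a *s (M *v v) = M *v (a *s v)"
    for M N :: "complex^'m^'m" and v w
    by (simp_all add: matrix_vector_scalar vec_eq_iff algebra_simps)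
  show ?thesis
    using prim_linear[OF bounded_linear_vector_scalar[of a] u] prim_linear[OF bounded_linear_vector_scalar[of a] p]
    unfolding SL_def eq by blast
qed

lemma SL_diff:
  assumes "SL u p f" "SL v q g" shows "SL (\<lambda>x. u x - v x) (\<lambda>x. p x - q x) (\<lambda>x. f x - g x)"
proof -
  have "(-1) *s v = - v" for v :: "complex^'m" by (simp add: vec_eq_iff)
  with SL_add[OF assms(1) SL_scale[OF assms(2), of "-1"]] show ?thesis by simp
qed

lemma SL_scaleR: "SL u p f \<Longrightarrow> SL (\<lambda>x. r *\<^sub>R u x) (\<lambda>x. r *\<^sub>R p x) (\<lambda>x. r *\<^sub>R f x)"
proof -
  have "complex_of_real r *s v = r *\<^sub>R v" for v :: "complex^'m" by (simp add: vec_eq_iff) (simp add: scaleR_conv_of_real)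
  then show "SL u p f \<Longrightarrow> SL (\<lambda>x. r *\<^sub>R u x) (\<lambda>x. r *\<^sub>R p x) (\<lambda>x. r *\<^sub>R f x)"
    using SL_scale[of u p f "of_real r"] by simp
qed

lemma quasi_deriv_SL:
  assumes "prim c u (\<lambda>x. matrix_inv (P x) *v p x)" "prim c p g"
  shows "is_quasi_deriv c P u p"
  unfolding is_quasi_deriv_def
proof (intro conjI allI impI)
  show "AC_vec c d p" for d unfolding AC_vec_iff by (rule prim_ac_on[OF assms(2) order_refl])
  show "AE x in lebesgue_on {c..}. p x = P x *v hderiv c u x"
    using prim_hderiv[OF assms(1)] P_pos
    by eventually_elim (simp add: matrix_inv_cancel pos_def_invertible)
qed

lemma is_quasi_deriv_prim:
  assumes "is_quasi_deriv c P u v" shows "prim c v (hderiv c v)"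
  using assms unfolding is_quasi_deriv_def AC_vec_iff by (intro ac_prim_hderiv) auto

lemma is_quasi_deriv_unique:
  assumes "is_quasi_deriv c P u v" "is_quasi_deriv c P u w" "x \<ge> c"
  shows "v x = w x"
proof (rule AE_eq_continuous[OF _ _ _ assms(3)])
  show "continuous_on {c..} v" "continuous_on {c..} w"
    using assms(1,2) by (auto intro: prim_continuous is_quasi_deriv_prim)
  have "AE x in lebesgue_on {c..}. v x = P x *v hderiv c u x" "AE x in lebesgue_on {c..}. w x = P x *v hderiv c u x"
    using assms unfolding is_quasi_deriv_def by auto
  then show "AE x in lebesgue_on {c..}. v x = w x" by eventually_elim simp
qed

text \<open>\<open>quasi_deriv\<close> is some function picked by choice; uniqueness on the
  half-line identifies it there with p, so \<open>L_expr\<close> can be computed from the first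
  order system.\<close>

lemma SL_imp_admissible:
  assumes "SL u p f"
  shows "u \<in> L_admissible c P" "AE x in lebesgue_on {c..}. L_expr c P Q R u x = f x"
proof -
  have u: "prim c u (\<lambda>x. matrix_inv (P x) *v p x)" and p: "prim c p (\<lambda>x. Q x *v u x - R x *v f x)"
    using assms by (auto simp: SL_def)
  have qd: "is_quasi_deriv c P u p" by (rule quasi_deriv_SL[OF u p])
  then show "u \<in> L_admissible c P"
    using prim_ac_on[OF u order_refl] unfolding L_admissible_def AC_vec_iff by blast
  have "is_quasi_deriv c P u (quasi_deriv c P u)"
    unfolding quasi_deriv_def using qd by (rule someI[of "is_quasi_deriv c P u"])
  then have "p x = quasi_deriv c P u x" if "x \<ge> c" for x using is_quasi_deriv_unique[OF qd _ that] by simp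
  with p have "prim c (quasi_deriv c P u) (\<lambda>x. Q x *v u x - R x *v f x)" by (rule prim_cong_left)
  from prim_hderiv[OF this] R_pos
  show "AE x in lebesgue_on {c..}. L_expr c P Q R u x = f x"
    by eventually_elim (simp add: L_expr_def matrix_inv_cancel pos_def_invertible)
qed

lemma admissible_imp_SL:
  assumes "u \<in> L_admissible c P" "AE x in lebesgue_on {c..}. L_expr c P Q R u x = f x"
  shows "SL u (quasi_deriv c P u) f"
  unfolding SL_def
proof
  let ?p = "quasi_deriv c P u"
  have qd: "is_quasi_deriv c P u ?p"
    using assms(1) someI_ex[of "is_quasi_deriv c P u"] unfolding L_admissible_def quasi_deriv_def by auto
  have "prim c u (hderiv c u)"
    using assms(1) unfolding L_admissible_def AC_vec_iff by (intro ac_prim_hderiv) auto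
  moreover have "AE x in lebesgue_on {c..}. ?p x = P x *v hderiv c u x"
    using qd unfolding is_quasi_deriv_def by simp
  with P_pos have "AE x in lebesgue_on {c..}. hderiv c u x = matrix_inv (P x) *v ?p x"
    by eventually_elim (simp add: matrix_inv_cancel pos_def_invertible)
  ultimately show "prim c u (\<lambda>x. matrix_inv (P x) *v ?p x)" by (rule prim_cong_AE)
  have "AE x in lebesgue_on {c..}. hderiv c ?p x = Q x *v u x - R x *v f x"
    using assms(2) R_pos
  proof eventually_elim
    case (elim x)
    then have "R x *v f x = - hderiv c ?p x + Q x *v u x"
      unfolding L_expr_def by (metis matrix_inv_cancel(2) pos_def_invertible)
    then show ?case by simp
  qed
  then show "prim c ?p (\<lambda>x. Q x *v u x - R x *v f x)"
    by (rule prim_cong_AE[OF is_quasi_deriv_prim[OF qd]])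
qed

section \<open>The weighted quadratic form and Lagrange's identity\<close>

lemma form_int:
  assumes "continuous_on {c..} u" "continuous_on {c..} v" "d \<ge> c"
  shows "(\<lambda>x. cdot (u x) (R x *v v x)) absolutely_integrable_on {c..d}"
proof -
  have c: "continuous_on {c..d} u" "continuous_on {c..d} v"
    by (rule continuous_on_subset[OF assms(1)] continuous_on_subset[OF assms(2)]; auto)+
  show ?thesis
    by (intro absolutely_integrable_bilinear_continuous[OF bounded_bilinear.flip[OF bounded_bilinear_cdot]]
      absolutely_integrable_bilinear_continuous[OF bounded_bilinear_matrix_vector_mult] R_int assms c)
qed

lemma Re_form_int:
  assumes "continuous_on {c..} u" "continuous_on {c..} v" "d \<ge> c"
  shows "(\<lambda>x. Re (cdot (u x) (R x *v v x))) absolutely_integrable_on {c..d}"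
  using absolutely_integrable_linear[OF form_int[OF assms] bounded_linear_Re] by (simp add: o_def)

lemma Re_form_integrable:
  assumes "continuous_on {c..} u" "continuous_on {c..} v" "d \<ge> c"
  shows "(\<lambda>x. Re (cdot (u x) (R x *v v x))) integrable_on {c..d}"
  by (rule set_lebesgue_integral_eq_integral(1)[OF Re_form_int[OF assms]])

text \<open>The squared norm of the weighted space over [c, d]. For a continuous u, square
  integrability amounts to a bound on it that is uniform in d.\<close>

abbreviation mass :: "real \<Rightarrow> (real \<Rightarrow> complex^'m) \<Rightarrow> real" where
  "mass d u \<equiv> integral {c..d} (\<lambda>x. Re (cdot (u x) (R x *v u x)))"

lemma form_nonneg: "AE x in lebesgue_on {c..}. 0 \<le> Re (cdot (u x) (R x *v u x))"
  using R_pos by eventually_elim (rule pos_def_nonneg)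

lemma mass_nonneg: "continuous_on {c..} u \<Longrightarrow> d \<ge> c \<Longrightarrow> 0 \<le> mass d u"
  by (rule integral_nonneg_AE'[of _ _ c])
    (auto intro: Re_form_integrable eventually_mono[OF form_nonneg[of u]])

lemma mass_mono: "continuous_on {c..} u \<Longrightarrow> c \<le> d \<Longrightarrow> d \<le> d' \<Longrightarrow> mass d u \<le> mass d' u"
  by (rule integral_mono_upper_AE) (use form_nonneg in \<open>auto intro: Re_form_integrable\<close>)

lemma L2_bound:
  assumes u: "continuous_on {c..} u" and "u \<in> L2_space c R"
  obtains K where "\<And>d. d \<ge> c \<Longrightarrow> mass d u \<le> K"
proof
  let ?w = "\<lambda>x. Re (cdot (u x) (R x *v u x))"
  have "integrable (lebesgue_on {c..}) (\<lambda>x. cdot (u x) (R x *v u x))"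
    using assms(2) by (simp add: L2_space_def)
  then have w: "integrable (lebesgue_on {c..}) ?w" by (rule integrable_Re)
  have "(\<lambda>x. \<bar>?w x\<bar>) absolutely_integrable_on {c..}"
    using integrable_abs[OF w] by (simp add: set_integrable_def integrable_restrict_space)
  then have wi: "(\<lambda>x. \<bar>?w x\<bar>) integrable_on {c..}" by (rule set_lebesgue_integral_eq_integral(1))
  fix d assume d: "d \<ge> c"
  have ai: "(\<lambda>x. \<bar>?w x\<bar>) integrable_on {c..d}"
    using absolutely_integrable_norm[OF Re_form_int[OF u u d]]
    by (simp add: o_def set_lebesgue_integral_eq_integral(1))
  have "mass d u \<le> integral {c..d} (\<lambda>x. \<bar>?w x\<bar>)"
    by (intro integral_le Re_form_integrable u d ai) auto
  also have "\<dots> \<le> integral {c..} (\<lambda>x. \<bar>?w x\<bar>)"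
    by (intro integral_subset_le ai wi) auto
  finally show "mass d u \<le> integral {c..} (\<lambda>x. \<bar>?w x\<bar>)" .
qed

lemma L2_spaceI:
  assumes u: "continuous_on {c..} u" and K: "\<And>d. d \<ge> c \<Longrightarrow> mass d u \<le> K"
  shows "u \<in> L2_space c R"
  unfolding L2_space_def
proof (intro CollectI conjI)
  show "u \<in> borel_measurable (lebesgue_on {c..})"
    by (rule continuous_imp_measurable_on_sets_lebesgue[OF u halfline_sets])
  let ?w = "\<lambda>x. Re (cdot (u x) (R x *v u x))"
  have "integrable (lebesgue_on {c..}) ?w"
    by (rule halfline_integrable_of_bounded[OF Re_form_integrable[OF u u] K form_nonneg])
  then have "integrable (lebesgue_on {c..}) (\<lambda>x. complex_of_real (?w x))" by (rule integrable_of_real)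
  moreover have ae: "AE x in lebesgue_on {c..}. complex_of_real (?w x) = cdot (u x) (R x *v u x)"
    using R_pos by eventually_elim (simp flip: cdot_self_adjoint_real[OF pos_def_self_adjoint])
  moreover have "(\<lambda>x. cdot (u x) (R x *v u x)) \<in> borel_measurable (lebesgue_on {c..})"
    by (rule borel_measurable_lebesgue_on_AE[OF _ ae]) (use calculation(1) in auto)
  ultimately show "integrable (lebesgue_on {c..}) (\<lambda>x. cdot (u x) (R x *v u x))"
    by (subst integrable_cong_AE[of _ _ "\<lambda>x. complex_of_real (?w x)"]) (auto elim: eventually_mono)
qed

lemma L2_space_cong_AE:
  assumes "u \<in> L2_space c R" "AE x in lebesgue_on {c..}. u x = v x"
  shows "v \<in> L2_space c R"
  unfolding L2_space_def
proof (intro CollectI conjI)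
  have u: "u \<in> borel_measurable (lebesgue_on {c..})" "integrable (lebesgue_on {c..}) (\<lambda>x. cdot (u x) (R x *v u x))"
    using assms(1) by (auto simp: L2_space_def)
  show "v \<in> borel_measurable (lebesgue_on {c..})"
    by (rule borel_measurable_lebesgue_on_AE[OF u(1) assms(2)])
  have ae: "AE x in lebesgue_on {c..}. cdot (u x) (R x *v u x) = cdot (v x) (R x *v v x)"
    using assms(2) by eventually_elim simp
  have "(\<lambda>x. cdot (v x) (R x *v v x)) \<in> borel_measurable (lebesgue_on {c..})"
    by (rule borel_measurable_lebesgue_on_AE[OF _ ae]) (use u in auto)
  then show "integrable (lebesgue_on {c..}) (\<lambda>x. cdot (v x) (R x *v v x))"
    by (subst integrable_cong_AE[of _ _ "\<lambda>x. cdot (u x) (R x *v u x)"]) (use u ae in \<open>auto elim: eventually_mono\<close>)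
qed

lemma mass_scale: "mass d (\<lambda>x. a *s u x) = (norm a)\<^sup>2 * mass d u"
proof -
  have "cdot (a *s v) (M *v (a *s v)) = of_real ((norm a)\<^sup>2) * cdot v (M *v v)" for M :: "complex^'m^'m" and v
    by (simp only: matrix_vector_scalar cdot_vector_scalar_left cdot_vector_scalar_right complex_norm_square mult_ac)
  then show ?thesis by simp
qed

lemma mass_add_le:
  assumes u: "continuous_on {c..} u" and v: "continuous_on {c..} v" and d: "d \<ge> c"
  shows "mass d (\<lambda>x. u x + v x) \<le> 2 * mass d u + 2 * mass d v"
proof -
  have uv: "continuous_on {c..} (\<lambda>x. u x + v x)" by (intro continuous_intros u v)
  have "mass d (\<lambda>x. u x + v x) \<le> integral {c..d} (\<lambda>x. 2 * Re (cdot (u x) (R x *v u x)) + 2 * Re (cdot (v x) (R x *v v x)))"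
  proof (rule integral_le_AE[of _ _ _ c])
    show "AE x in lebesgue_on {c..}. x \<in> {c..d} \<longrightarrow> Re (cdot (u x + v x) (R x *v (u x + v x)))
      \<le> 2 * Re (cdot (u x) (R x *v u x)) + 2 * Re (cdot (v x) (R x *v v x))"
      using R_pos by eventually_elim (use quadratic_form_add_le in blast)
  qed (auto intro!: Re_form_integrable u v uv d integrable_add integrable_on_cmult_left)
  also have "\<dots> = 2 * mass d u + 2 * mass d v"
    by (subst integral_add) (auto intro!: Re_form_integrable u v d integrable_on_cmult_left)
  finally show ?thesis .
qed

text \<open>Serves as a Cauchy-Schwarz inequality whose weight t is adapted to each use, either to
  absorb a term or to balance a small factor against a bounded one.\<close>

lemma mass_young:
  assumes u: "continuous_on {c..} u" and v: "continuous_on {c..} v" and d: "c \<le> a" "a \<le> d" and "t > 0"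
  shows "2 * norm (integral {a..d} (\<lambda>x. cdot (v x) (R x *v u x)))
     \<le> t * integral {a..d} (\<lambda>x. Re (cdot (v x) (R x *v v x))) + integral {a..d} (\<lambda>x. Re (cdot (u x) (R x *v u x))) / t"
proof -
  have cd: "c \<le> d" using d by simp
  have sub: "f integrable_on {a..d}" if "f integrable_on {c..d}" for f :: "real \<Rightarrow> 'b::banach"
    using that by (rule integrable_on_subinterval) (use d in auto)
  have i: "(\<lambda>x. norm (cdot (v x) (R x *v u x))) integrable_on {a..d}"
    "(\<lambda>x. Re (cdot (v x) (R x *v v x))) integrable_on {a..d}" "(\<lambda>x. Re (cdot (u x) (R x *v u x))) integrable_on {a..d}"
    "(\<lambda>x. cdot (v x) (R x *v u x)) integrable_on {a..d}"
    using absolutely_integrable_norm[OF form_int[OF v u cd]] set_lebesgue_integral_eq_integral(1)[OF form_int[OF v u cd]]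
    by (auto intro!: sub Re_form_integrable u v cd simp: o_def set_lebesgue_integral_eq_integral(1))
  have "2 * norm (integral {a..d} (\<lambda>x. cdot (v x) (R x *v u x))) \<le> 2 * integral {a..d} (\<lambda>x. norm (cdot (v x) (R x *v u x)))"
    by (intro mult_left_mono integral_norm_bound_integral i) auto
  also have "\<dots> = integral {a..d} (\<lambda>x. 2 * norm (cdot (v x) (R x *v u x)))" by simp
  also have "\<dots> \<le> integral {a..d} (\<lambda>x. t * Re (cdot (v x) (R x *v v x)) + Re (cdot (u x) (R x *v u x)) / t)"
  proof (rule integral_le_AE[of _ _ _ c])
    show "AE x in lebesgue_on {c..}. x \<in> {a..d} \<longrightarrow> 2 * norm (cdot (v x) (R x *v u x))
      \<le> t * Re (cdot (v x) (R x *v v x)) + Re (cdot (u x) (R x *v u x)) / t"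
      using R_pos by eventually_elim (use pos_def_young[OF _ \<open>t > 0\<close>] in blast)
  qed (use i d in \<open>auto intro!: integrable_add integrable_on_mult_right integrable_on_divide\<close>)
  also have "\<dots> = t * integral {a..d} (\<lambda>x. Re (cdot (v x) (R x *v v x))) + integral {a..d} (\<lambda>x. Re (cdot (u x) (R x *v u x))) / t"
    by (subst integral_add) (use i in \<open>auto intro!: integrable_on_mult_right integrable_on_divide\<close>)
  finally show ?thesis .
qed

text \<open>Product rule for the boundary form: the terms with the inverse of P and with Q cancel by
  self-adjointness.\<close>

lemma Lagrange_identity:
  assumes u: "SL u p f" and v: "SL v q g" and d: "d \<ge> c"
  shows "((\<lambda>x. cdot (R x *v f x) (v x) - cdot (u x) (R x *v g x)) has_integral
    ((cdot (u d) (q d) - cdot (p d) (v d)) - (cdot (u c) (q c) - cdot (p c) (v c)))) {c..d}"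
proof -
  have u1: "prim c u (\<lambda>x. matrix_inv (P x) *v p x)" and u2: "prim c p (\<lambda>x. Q x *v u x - R x *v f x)"
    using u by (auto simp: SL_def)
  have v1: "prim c v (\<lambda>x. matrix_inv (P x) *v q x)" and v2: "prim c q (\<lambda>x. Q x *v v x - R x *v g x)"
    using v by (auto simp: SL_def)
  have "prim c (\<lambda>x. cdot (u x) (q x) - cdot (p x) (v x))
     (\<lambda>x. (cdot (u x) (Q x *v v x - R x *v g x) + cdot (matrix_inv (P x) *v p x) (q x))
        - (cdot (p x) (matrix_inv (P x) *v q x) + cdot (Q x *v u x - R x *v f x) (v x)))"
    by (intro prim_diff prim_bilinear[OF bounded_bilinear_cdot] u1 u2 v1 v2)
  moreover have "AE x in lebesgue_on {c..}. (cdot (u x) (Q x *v v x - R x *v g x) + cdot (matrix_inv (P x) *v p x) (q x))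
        - (cdot (p x) (matrix_inv (P x) *v q x) + cdot (Q x *v u x - R x *v f x) (v x)) = cdot (R x *v f x) (v x) - cdot (u x) (R x *v g x)"
    using P_pos Q_sa
  proof eventually_elim
    case (elim x)
    have "cdot (matrix_inv (P x) *v p x) (q x) = cdot (p x) (matrix_inv (P x) *v q x)"
      by (intro cdot_self_adjoint pos_def_self_adjoint pos_def_matrix_inv elim)
    moreover have "cdot (Q x *v u x) (v x) = cdot (u x) (Q x *v v x)" by (intro cdot_self_adjoint elim)
    ultimately show ?case by (simp add: cdot.diff_left cdot.diff_right)
  qed
  ultimately have "prim c (\<lambda>x. cdot (u x) (q x) - cdot (p x) (v x)) (\<lambda>x. cdot (R x *v f x) (v x) - cdot (u x) (R x *v g x))"
    by (rule prim_cong_AE)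
  from prim_has_integral[OF this order_refl d] show ?thesis .
qed

end

section \<open>Cutoff functions\<close>

definition ramp :: "real \<Rightarrow> real \<Rightarrow> real \<Rightarrow> real" where
  "ramp a b x = max 0 (min 1 ((b - x) / (b - a)))"

definition ramp' :: "real \<Rightarrow> real \<Rightarrow> real \<Rightarrow> real" where
  "ramp' a b x = (if a < x \<and> x < b then - 1 / (b - a) else 0)"

text \<open>The cubic \<open>3 r^2 - 2 r^3\<close> of the ramp has vanishing slope at r = 0 and r =
  1, so its derivative is again absolutely continuous; the quasi-derivative of a cut-off solution
  contains that derivative.\<close>

definition cut :: "real \<Rightarrow> real \<Rightarrow> real \<Rightarrow> real" where
  "cut a b x = 3 * (ramp a b x * ramp a b x) - 2 * (ramp a b x * (ramp a b x * ramp a b x))"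

text \<open>The chain rule gives \<open>6 r (1 - r) r'\<close>. As \<open>r (1 - r)\<close> vanishes
  off (a, b), r' may be replaced by its constant value inside, which makes the formula
  continuous.\<close>

definition cut1 :: "real \<Rightarrow> real \<Rightarrow> real \<Rightarrow> real" where
  "cut1 a b x = - 6 / (b - a) * (ramp a b x * (1 - ramp a b x))"

definition cut2 :: "real \<Rightarrow> real \<Rightarrow> real \<Rightarrow> real" where
  "cut2 a b x = - 6 / (b - a) * (ramp' a b x * (1 - 2 * ramp a b x))"

lemma ramp_simps:
  assumes "a < b"
  shows "x \<le> a \<Longrightarrow> ramp a b x = 1" "b \<le> x \<Longrightarrow> ramp a b x = 0" "0 \<le> ramp a b x" "ramp a b x \<le> 1"
    "\<lbrakk>a \<le> x; x \<le> b\<rbrakk> \<Longrightarrow> ramp a b x = (b - x) / (b - a)"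
  using assms by (auto simp: ramp_def field_simps max_def min_def)

lemma cut_left: "a < b \<Longrightarrow> x \<le> a \<Longrightarrow> cut a b x = 1 \<and> cut1 a b x = 0 \<and> cut2 a b x = 0"
  by (simp add: cut_def cut1_def cut2_def ramp_simps ramp'_def)

lemma cut_right: "a < b \<Longrightarrow> b \<le> x \<Longrightarrow> cut a b x = 0 \<and> cut1 a b x = 0 \<and> cut2 a b x = 0"
  by (simp add: cut_def cut1_def cut2_def ramp_simps ramp'_def)

lemma cut_nonneg_le_1:
  assumes "a < b" shows "0 \<le> cut a b x" "cut a b x \<le> 1"
proof -
  let ?r = "ramp a b x"
  have r: "0 \<le> ?r" "?r \<le> 1" using ramp_simps[OF assms] by auto
  have "cut a b x = ?r * ?r * (3 - 2 * ?r)" by (simp add: cut_def algebra_simps)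
  also have "\<dots> \<ge> 0" using r by (intro mult_nonneg_nonneg) auto
  finally show "0 \<le> cut a b x" .
  have "1 - cut a b x = (1 - ?r) * (1 - ?r) * (1 + 2 * ?r)" by (simp add: cut_def algebra_simps)
  also have "\<dots> \<ge> 0" using r by (intro mult_nonneg_nonneg) auto
  finally show "cut a b x \<le> 1" by simp
qed

text \<open>The constant is 6 times 1/4, the maximum of \<open>r (1 - r)\<close>.\<close>

lemma cut1_bound:
  assumes "a < b" shows "\<bar>cut1 a b x\<bar> \<le> 3 / 2 / (b - a)"
proof -
  let ?r = "ramp a b x"
  have r: "0 \<le> ?r" "?r \<le> 1" using ramp_simps[OF assms] by auto
  have "0 \<le> (1 - 2 * ?r) * (1 - 2 * ?r)" by simp
  then have "4 * (?r * (1 - ?r)) \<le> 1" by (simp add: algebra_simps)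
  then have "6 / (b - a) * (?r * (1 - ?r)) \<le> 6 / (b - a) * (1/4)"
    using assms by (intro mult_left_mono) auto
  also have "\<dots> = 3 / 2 / (b - a)" by (simp add: field_simps)
  finally show ?thesis using r assms by (simp add: cut1_def abs_mult)
qed

lemma cut2_bound:
  assumes "a < b" shows "\<bar>cut2 a b x\<bar> \<le> 6 / (b - a) * (1 / (b - a))"
proof -
  have "\<bar>ramp' a b x\<bar> \<le> 1 / (b - a)" using assms by (auto simp: ramp'_def)
  moreover have "\<bar>1 - 2 * ramp a b x\<bar> \<le> 1" using ramp_simps(3,4)[OF assms, of x] by auto
  ultimately have "\<bar>ramp' a b x * (1 - 2 * ramp a b x)\<bar> \<le> 1 / (b - a) * 1"
    unfolding abs_mult using assms by (intro mult_mono) auto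
  then have "6 / (b - a) * \<bar>ramp' a b x * (1 - 2 * ramp a b x)\<bar> \<le> 6 / (b - a) * (1 / (b - a))"
    using assms by (intro mult_left_mono) auto
  then show ?thesis using assms by (simp add: cut2_def abs_mult)
qed

lemma ac_on_ident: "ac_on a b (\<lambda>x::real. x)"
proof -
  have "family_var (\<lambda>x. x) xs = family_length xs" if "family a b xs" for xs
    using that by (induction xs) (auto simp: family_def)
  then show ?thesis unfolding ac_on_iff_family by metis
qed

lemma prim_ramp:
  assumes "a < b" shows "prim c (ramp a b) (ramp' a b)"
proof (rule ac_prim_derivative)
  show "ac_on c d (ramp a b)" for d
  proof (rule ac_on_by_variation[OF ac_on_ident ac_on_ident])
    show "family_var (ramp a b) xs \<le> 1 / (b - a) * (family_var (\<lambda>x. x) xs + family_var (\<lambda>x. x) xs)" for xs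
    proof (induction xs)
      case (Cons p xs)
      have "\<bar>ramp a b (snd p) - ramp a b (fst p)\<bar> \<le> \<bar>(b - snd p) / (b - a) - (b - fst p) / (b - a)\<bar>"
        unfolding ramp_def by (auto simp: max_def min_def)
      also have "\<dots> = 1 / (b - a) * \<bar>snd p - fst p\<bar>"
        using assms by (simp add: diff_divide_distrib[symmetric])
      finally have "\<bar>ramp a b (snd p) - ramp a b (fst p)\<bar> \<le> 1 / (b - a) * \<bar>snd p - fst p\<bar>" .
      moreover have "0 \<le> 1 / (b - a) * \<bar>snd p - fst p\<bar>" using assms by simp
      ultimately show ?case using Cons by (simp add: distrib_left)
    qed simp
  qed
  show "AE x in lebesgue_on {c..}. (ramp a b has_vector_derivative ramp' a b x) (at x within {c..})"
    unfolding AE_lebesgue_on_halfline_iff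
  proof (intro exI[of _ "{a, b}"] conjI allI impI)
    show "negligible {a, b}" by simp
    fix x assume "x \<notin> {a, b}"
    then consider "x < a" | "a < x \<and> x < b" | "b < x" by force
    then have "(ramp a b has_vector_derivative ramp' a b x) (at x)"
    proof cases
      case 1
      show ?thesis
        by (rule has_vector_derivative_transform_within_open[of "\<lambda>x. 1" _ _ "{..<a}"])
          (use 1 assms in \<open>auto simp: ramp'_def ramp_simps\<close>)
    next
      case 2
      have "((\<lambda>x. (b - x) * k) has_real_derivative - k) (at x)" for k
        by (auto intro!: derivative_eq_intros)
      from this[of "1 / (b - a)"] have "((\<lambda>x. (b - x) / (b - a)) has_vector_derivative - 1 / (b - a)) (at x)"
        by (simp add: has_real_derivative_iff_has_vector_derivative)
      then show ?thesis
        by (rule has_vector_derivative_transform_within_open[of _ _ _ "{a<..<b}", THEN back_subst[of "\<lambda>z. (_ has_vector_derivative z) _"]])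
          (use 2 assms in \<open>auto simp: ramp'_def ramp_simps\<close>)
    next
      case 3
      show ?thesis
        by (rule has_vector_derivative_transform_within_open[of "\<lambda>x. 0" _ _ "{b<..}"])
          (use 3 assms in \<open>auto simp: ramp'_def ramp_simps\<close>)
    qed
    then show "(ramp a b has_vector_derivative ramp' a b x) (at x within {c..})"
      by (rule has_vector_derivative_at_within)
  qed
qed

lemma prim_cong:
  assumes "prim c f g" "\<And>x. x \<ge> c \<Longrightarrow> f x = f' x" "\<And>x. x \<ge> c \<Longrightarrow> g x = g' x"
  shows "prim c f' g'"
proof (rule prim_cong_AE)
  show "prim c f' g" using assms(1,2) by (rule prim_cong_left)
  show "AE x in lebesgue_on {c..}. g x = g' x" by (rule eventually_mono[OF AE_halfline_ge]) (rule assms(3))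
qed

lemma prim_cut:
  assumes "a < b" shows "prim c (cut a b) (cut1 a b)" "prim c (cut1 a b) (cut2 a b)"
proof -
  let ?r = "ramp a b" and ?r' = "ramp' a b"
  note r = prim_ramp[OF assms, of c]
  note r2 = prim_bilinear[OF bounded_bilinear_mult r r]
  note r3 = prim_bilinear[OF bounded_bilinear_mult r r2]
  note d = prim_diff[OF prim_linear[OF bounded_linear_mult_right[of 3] r2] prim_linear[OF bounded_linear_mult_right[of 2] r3]]
  have out: "?r x = 1 \<or> ?r x = 0" if "\<not> (a < x \<and> x < b)" for x
    using that ramp_simps(1,2)[OF assms, of x] by auto
  show "prim c (cut a b) (cut1 a b)"
  proof (rule prim_cong[OF d])
    show "3 * (?r x * ?r' x + ?r' x * ?r x) - 2 * (?r x * (?r x * ?r' x + ?r' x * ?r x) + ?r' x * (?r x * ?r x)) = cut1 a b x" for x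
    proof -
      have "?r' x * (?r x * (1 - ?r x)) = - 1 / (b - a) * (?r x * (1 - ?r x))"
        using out[of x] by (cases "a < x \<and> x < b") (auto simp: ramp'_def)
      then have "cut1 a b x = 6 * (?r' x * (?r x * (1 - ?r x)))" by (simp add: cut1_def)
      then show ?thesis by (simp add: algebra_simps)
    qed
  qed (simp add: cut_def)
  show "prim c (cut1 a b) (cut2 a b)"
    by (rule prim_cong[OF prim_linear[OF bounded_linear_mult_right[of "- 6 / (b - a)"] prim_diff[OF r r2]]])
      (auto simp: cut1_def cut2_def algebra_simps)
qed

lemma mult_int_continuous:
  fixes k g :: "real \<Rightarrow> real"
  assumes "continuous_on {c..} k" "g absolutely_integrable_on {c..d}"
  shows "(\<lambda>x. k x * g x) absolutely_integrable_on {c..d}"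
  using absolutely_integrable_bilinear_continuous[OF bounded_bilinear_mult assms(2) continuous_on_subset[OF assms(1)]]
  by (simp add: mult.commute)

lemma continuous_on_Re_form:
  "continuous_on S u \<Longrightarrow> continuous_on S v \<Longrightarrow> continuous_on S M \<Longrightarrow> continuous_on S (\<lambda>x. Re (cdot (u x) (M x *v v x)))"
  by (intro continuous_intros cdot.continuous_on mv.continuous_on)

lemma borel_measurable_bilinear:
  fixes h :: "'a::euclidean_space \<Rightarrow> 'b::euclidean_space \<Rightarrow> 'c::euclidean_space"
  assumes h: "bounded_bilinear h" and "f \<in> borel_measurable M" "g \<in> borel_measurable M"
  shows "(\<lambda>x. h (f x) (g x)) \<in> borel_measurable M"
proof -
  have "continuous_on UNIV (\<lambda>x. h (fst x) (snd x))"
    by (intro bounded_bilinear.continuous_on[OF h] continuous_intros)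
  from borel_measurable_continuous_Pair[OF assms(2,3) this] show ?thesis by simp
qed

lemma bounded_linear_conj_transpose: "bounded_linear (conj_transpose :: complex^'m^'m \<Rightarrow> _)"
  unfolding linear_conv_bounded_linear[symmetric]
  by (intro linearI) (auto simp: vec_eq_iff conj_transpose_def)

context sturm_liouville
begin

abbreviation "DP \<equiv> hderiv c P"

lemma P_continuous: "continuous_on {c..} P" by (rule prim_continuous[OF P_prim])

text \<open>Self-adjointness passes to every point by continuity. Positive definiteness does not,
  which is why suitable end points b are selected later.\<close>

lemma P_self_adjoint: "x \<ge> c \<Longrightarrow> self_adjoint (P x)"
  unfolding self_adjoint_def
  by (rule AE_eq_continuous[of c "\<lambda>x. conj_transpose (P x)" P])
    (use P_pos in \<open>auto simp: pos_def_def self_adjoint_def elim!: eventually_mono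
       intro!: P_continuous bounded_linear.continuous_on[OF bounded_linear_conj_transpose]\<close>)

lemma DP_self_adjoint: "AE x in lebesgue_on {c..}. self_adjoint (DP x)"
proof -
  have "conj_transpose (P x) = P x" if "x \<ge> c" for x
    using P_self_adjoint[OF that] by (simp add: self_adjoint_def)
  from prim_cong_left[OF prim_linear[OF bounded_linear_conj_transpose P_prim] this]
  have "prim c P (\<lambda>x. conj_transpose (DP x))" .
  from prim_hderiv[OF this] show ?thesis by eventually_elim (simp only: self_adjoint_def)
qed

text \<open>The mass is constantly 0 on [c, d], so its derivative, the form of R at u, vanishes
  almost everywhere there; positivity of R and continuity of u give u = 0.\<close>

lemma mass_zero:
  assumes u: "continuous_on {c..} u" and "c < d" and 0: "mass d u \<le> 0" and x: "c \<le> x" "x < d"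
  shows "u x = 0"
proof -
  have m0: "mass y u = 0" if "c \<le> y" "y \<le> d" for y
    using mass_mono[OF u that] mass_nonneg[OF u that(1)] 0 by linarith
  have p: "prim c (\<lambda>x. mass x u) (\<lambda>x. Re (cdot (u x) (R x *v u x)))"
    by (intro prim_integral Re_form_int u)
  have "AE y in lebesgue_on {c..}. x < y \<and> y < d \<longrightarrow> u y = 0"
    using prim_hderiv[OF p] R_pos
  proof eventually_elim
    case (elim y)
    show ?case
    proof
      assume y: "x < y \<and> y < d"
      have "((\<lambda>x. mass x u) has_vector_derivative 0) (at y)"
      proof (rule has_vector_derivative_transform_within_open)
        show "((\<lambda>x. 0::real) has_vector_derivative 0) (at y)" by (rule has_vector_derivative_const)
        show "0 = mass z u" if "z \<in> {c<..<d}" for z using m0[of z] that by simp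
      qed (use y x in auto)
      then have "hderiv c (\<lambda>x. mass x u) y = 0"
        by (rule hderiv_eqI[OF has_vector_derivative_at_within]) (use y x in linarith)
      with elim(1) have "Re (cdot (u y) (R y *v u y)) = 0" by simp
      then show "u y = 0" by (rule pos_def_eq_0[OF elim(2)])
    qed
  qed
  then show ?thesis by (rule AE_imp_right_limit[OF u x])
qed

end

section \<open>Cut-off solutions in the minimal domain and the localization inequality\<close>

locale semibounded = sturm_liouville +
  fixes \<gamma> :: real
  assumes PRP: "L1_loc {c<..} (\<lambda>x. op_norm (hderiv c P x ** matrix_inv (R x) ** hderiv c P x))"
    and Rinv: "L1_loc {c<..} (\<lambda>x. op_norm (matrix_inv (R x)))"
    and lower_bound: "\<And>u. u \<in> D_min c P Q R \<Longrightarrow> Re (L2_ip c R u (L_expr c P Q R u)) \<ge> \<gamma> * Re (L2_ip c R u u)"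
begin

context
  fixes v q f a b
  assumes v: "SL v q f" and f: "continuous_on {c..} f" and v0: "v c = 0" and ab: "c < a" "a < b"
begin

text \<open>With \<open>\<eta> = cut a b\<close>: \<open>cV = \<eta> v\<close>, \<open>cQ = P (\<eta> v)'\<close>, \<open>cS = R L (\<eta> v)\<close> and \<open>cg = L (\<eta> v)\<close>. The assumptions on
  \<open>P'\<close> and \<open>R\<^sup>-\<^sup>1\<close> are what puts \<open>cg\<close> into the weighted space.\<close>

definition "cV x = cut a b x *\<^sub>R v x"
definition "cQ x = cut a b x *\<^sub>R q x + cut1 a b x *\<^sub>R (P x *v v x)"
definition "cS x = cut a b x *\<^sub>R (R x *v f x) - (2 * cut1 a b x) *\<^sub>R q x - cut2 a b x *\<^sub>R (P x *v v x) - cut1 a b x *\<^sub>R (DP x *v v x)"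
definition "cg x = matrix_inv (R x) *v cS x"

lemma v_prim: "prim c v (\<lambda>x. matrix_inv (P x) *v q x)" and q_prim: "prim c q (\<lambda>x. Q x *v v x - R x *v f x)"
  using v by (auto simp: SL_def)

lemma cut_continuous: "continuous_on {c..} (cut a b)" "continuous_on {c..} (cut1 a b)"
  using prim_cut[OF ab(2)] by (auto intro: prim_continuous)

lemma cV_prim: "prim c cV (\<lambda>x. matrix_inv (P x) *v cQ x)"
proof -
  have "prim c cV (\<lambda>x. cut a b x *\<^sub>R (matrix_inv (P x) *v q x) + cut1 a b x *\<^sub>R v x)"
    unfolding cV_def[abs_def] by (rule prim_bilinear[OF bounded_bilinear_scaleR prim_cut(1)[OF ab(2)] v_prim])
  moreover have "AE x in lebesgue_on {c..}. cut a b x *\<^sub>R (matrix_inv (P x) *v q x) + cut1 a b x *\<^sub>R v x = matrix_inv (P x) *v cQ x"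
    using P_pos by eventually_elim (simp add: cQ_def mv.add_right mv.scaleR_right matrix_inv_cancel pos_def_invertible)
  ultimately show ?thesis by (rule prim_cong_AE)
qed

lemma cQ_prim: "prim c cQ (\<lambda>x. Q x *v cV x - cS x)"
proof -
  have Pv: "prim c (\<lambda>x. P x *v v x) (\<lambda>x. P x *v (matrix_inv (P x) *v q x) + DP x *v v x)"
    by (rule prim_bilinear[OF bounded_bilinear_matrix_vector_mult P_prim v_prim])
  have "prim c cQ (\<lambda>x. (cut a b x *\<^sub>R (Q x *v v x - R x *v f x) + cut1 a b x *\<^sub>R q x) +
     (cut1 a b x *\<^sub>R (P x *v (matrix_inv (P x) *v q x) + DP x *v v x) + cut2 a b x *\<^sub>R (P x *v v x)))"
    unfolding cQ_def[abs_def] by (intro prim_add prim_bilinear[OF bounded_bilinear_scaleR] prim_cut ab q_prim Pv)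
  moreover have "AE x in lebesgue_on {c..}. (cut a b x *\<^sub>R (Q x *v v x - R x *v f x) + cut1 a b x *\<^sub>R q x) +
     (cut1 a b x *\<^sub>R (P x *v (matrix_inv (P x) *v q x) + DP x *v v x) + cut2 a b x *\<^sub>R (P x *v v x)) = Q x *v cV x - cS x"
    using P_pos
  proof eventually_elim
    case (elim x)
    have "r *\<^sub>R (y * 2) = (2 * r) *\<^sub>R y" for r and y :: "complex^'a"
      unfolding vec_eq_iff by (simp add: scaleR_conv_of_real)
    then show ?case
      using elim by (simp add: cS_def cV_def mv.scaleR_right matrix_inv_cancel pos_def_invertible algebra_simps)
  qed
  ultimately show ?thesis by (rule prim_cong_AE)
qed

lemma R_cg: "AE x in lebesgue_on {c..}. R x *v cg x = cS x"
  using R_pos by eventually_elim (simp add: cg_def matrix_inv_cancel pos_def_invertible)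

lemma cV_SL: "SL cV cQ cg"
  unfolding SL_def
proof
  show "prim c cQ (\<lambda>x. Q x *v cV x - R x *v cg x)"
    using R_cg by (intro prim_cong_AE[OF cQ_prim]) (auto elim: eventually_mono)
qed (rule cV_prim)

lemma cV_continuous: "continuous_on {c..} cV" by (rule prim_continuous[OF cV_prim])

text \<open>The terms of \<open>cS\<close> are not treated singly: \<open>cS\<close> is
  \<open>Q cV\<close> minus the derivative of \<open>cQ\<close>, and both are integrable on
  [c, b].\<close>

lemma cS_int: "cS absolutely_integrable_on {c..b}"
proof -
  have cb: "c \<le> b" using ab by simp
  have "(\<lambda>x. Q x *v cV x) absolutely_integrable_on {c..b}"
    by (intro absolutely_integrable_bilinear_continuous[OF bounded_bilinear_matrix_vector_mult] Q_int cb
       continuous_on_subset[OF cV_continuous]) auto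
  from set_integral_diff(1)[OF this prim_int[OF cQ_prim cb]] show ?thesis by simp
qed

lemma c_right: "b < x \<Longrightarrow> cV x = 0" "b < x \<Longrightarrow> cS x = 0"
  using cut_right[OF ab(2), of x] by (auto simp: cV_def cS_def)

lemma cg_measurable: "cg \<in> borel_measurable (lebesgue_on {c..})"
proof -
  have "cS \<in> borel_measurable (lebesgue_on {c..})"
    using halfline_integral(1)[OF cS_int c_right(2)] by auto
  then show ?thesis unfolding cg_def[abs_def]
    using R_pos by (intro borel_measurable_matrix_inv_mult R_meas) (auto elim: eventually_mono intro: pos_def_invertible)
qed

text \<open>The form of R at \<open>cg\<close> is the form of the inverse of R at \<open>cS\<close>,
  a sum of four terms, whence the factor 4. The first reproduces the form of f; q and P v are
  bounded on [c, b], so the inverse of R controls them; the term P' v is controlled by the product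
  of P', the inverse of R and P'. The last three are supported in [a, b], a compact subset of the
  open half-line, where local integrability is assumed.\<close>

lemma cg_form_bound:
  obtains C where "AE x in lebesgue_on {c..}. Re (cdot (cg x) (R x *v cg x)) \<le>
     4 * (if x \<le> b then \<bar>Re (cdot (f x) (R x *v f x))\<bar> else 0) +
     (if a \<le> x \<and> x \<le> b then C * (op_norm (matrix_inv (R x)) + op_norm (DP x ** matrix_inv (R x) ** DP x)) else 0)"
proof -
  have "compact {c..b}" by simp
  have cc: "continuous_on {c..b} q" "continuous_on {c..b} (\<lambda>x. P x *v v x)" "continuous_on {c..b} v"
    using v by (auto intro!: mv.continuous_on continuous_on_subset[OF SL_continuous(1)[OF v]]
        continuous_on_subset[OF SL_continuous(2)[OF v]] continuous_on_subset[OF P_continuous])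
  have "\<exists>B\<ge>0. \<forall>x\<in>{c..b}. norm (k x) \<le> B" if "continuous_on {c..b} k" for k :: "real \<Rightarrow> complex^'a"
  proof -
    have "bounded (k ` {c..b})" by (intro compact_imp_bounded compact_continuous_image that) auto
    then obtain B where "\<forall>x\<in>{c..b}. norm (k x) \<le> B" unfolding bounded_iff by blast
    then show ?thesis by (intro exI[of _ "max 0 B"]) auto
  qed
  from this[OF cc(1)] this[OF cc(2)] this[OF cc(3)]
  obtain B1 B2 B3 where B: "B1 \<ge> 0" "B2 \<ge> 0" "B3 \<ge> 0" "\<And>x. x \<in> {c..b} \<Longrightarrow> norm (q x) \<le> B1"
     "\<And>x. x \<in> {c..b} \<Longrightarrow> norm (P x *v v x) \<le> B2" "\<And>x. x \<in> {c..b} \<Longrightarrow> norm (v x) \<le> B3"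
    by metis
  define m1 m2 where "m1 = 3 / 2 / (b - a)" and "m2 = 6 / (b - a) * (1 / (b - a))"
  have m: "m1 \<ge> 0" "m2 \<ge> 0" using ab by (auto simp: m1_def m2_def)
  define C where "C = 4 * ((2 * m1)\<^sup>2 * B1\<^sup>2 + m2\<^sup>2 * B2\<^sup>2 + m1\<^sup>2 * B3\<^sup>2)"
  have C0: "C \<ge> 0" by (auto simp: C_def)
  show ?thesis
  proof
    show "AE x in lebesgue_on {c..}. Re (cdot (cg x) (R x *v cg x)) \<le>
     4 * (if x \<le> b then \<bar>Re (cdot (f x) (R x *v f x))\<bar> else 0) +
     (if a \<le> x \<and> x \<le> b then C * (op_norm (matrix_inv (R x)) + op_norm (DP x ** matrix_inv (R x) ** DP x)) else 0)"
      using R_pos R_cg DP_self_adjoint AE_halfline_ge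
    proof eventually_elim
      case (elim x)
      let ?M = "matrix_inv (R x)"
      let ?N = "DP x ** matrix_inv (R x) ** DP x"
      define qf where "qf s = Re (cdot s (?M *v s))" for s
      have M: "pos_def ?M" by (rule pos_def_matrix_inv[OF elim(1)])
      have sc: "qf (r *\<^sub>R s) = r\<^sup>2 * qf s" for r s
        by (simp add: qf_def mv.scaleR_right cdot.scaleR_left cdot.scaleR_right power2_eq_square)
      have add: "qf (s + t) \<le> 2 * qf s + 2 * qf t" for s t
        unfolding qf_def by (rule quadratic_form_add_le[OF M])
      have qfM: "qf s \<le> op_norm ?M * (norm s)\<^sup>2" for s
        unfolding qf_def using quadratic_form_le_op_norm complex_Re_le_cmod order_trans by blast
      have 0: "Re (cdot (cg x) (R x *v cg x)) = qf (cS x)"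
        using elim(2) unfolding qf_def cg_def[symmetric] by (metis cdot_commute complex_cnj complex.sel(1) cnj.sel(1))
      show ?case
      proof (cases "x \<le> b")
        case False
        then show ?thesis unfolding 0 using c_right(2)[of x] by (simp add: qf_def cdot.zero_left)
      next
        case True
        let ?s1 = "R x *v f x" and ?s4 = "DP x *v v x"
        have xc: "x \<in> {c..b}" using True elim(4) by auto
        have s1: "qf ?s1 = Re (cdot (f x) (R x *v f x))"
          unfolding qf_def by (simp add: matrix_inv_cancel pos_def_invertible[OF elim(1)]) 
            (metis cdot_commute cnj.sel(1))
        have c2: "(cut a b x)\<^sup>2 \<le> 1" using cut_nonneg_le_1[OF ab(2)] by (simp add: power_le_one)
        have s1': "qf (cut a b x *\<^sub>R ?s1) \<le> \<bar>Re (cdot (f x) (R x *v f x))\<bar>"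
        proof -
          have "(cut a b x)\<^sup>2 * Re (cdot (f x) (R x *v f x)) \<le> (cut a b x)\<^sup>2 * \<bar>Re (cdot (f x) (R x *v f x))\<bar>"
            by (intro mult_left_mono) auto
          also have "\<dots> \<le> 1 * \<bar>Re (cdot (f x) (R x *v f x))\<bar>" by (intro mult_right_mono c2) auto
          finally show ?thesis unfolding sc s1 by simp
        qed
        show ?thesis
        proof (cases "a \<le> x")
          case False
          then have "cS x = cut a b x *\<^sub>R ?s1" using cut_left[OF ab(2), of x] by (simp add: cS_def)
          then show ?thesis unfolding 0 using s1' True False by simp
        next
          case a: True
          have s4: "qf ?s4 \<le> op_norm ?N * (norm (v x))\<^sup>2"
          proof -
            have "cdot ?s4 (?M *v ?s4) = cdot (v x) (?N *v v x)"
              by (simp add: cdot_self_adjoint[OF elim(3)] flip: matrix_vector_mul_assoc)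
            then show ?thesis unfolding qf_def
              by (simp only:) (rule order_trans[OF complex_Re_le_cmod quadratic_form_le_op_norm])
          qed
          have "qf (cS x) = qf ((cut a b x *\<^sub>R ?s1 + (- (2 * cut1 a b x)) *\<^sub>R q x) + ((- cut2 a b x) *\<^sub>R (P x *v v x) + (- cut1 a b x) *\<^sub>R ?s4))"
            by (simp add: cS_def algebra_simps)
          also have "\<dots> \<le> 2 * (2 * qf (cut a b x *\<^sub>R ?s1) + 2 * qf ((- (2 * cut1 a b x)) *\<^sub>R q x))
              + 2 * (2 * qf ((- cut2 a b x) *\<^sub>R (P x *v v x)) + 2 * qf ((- cut1 a b x) *\<^sub>R ?s4))"
            by (rule order_trans[OF add add_mono[OF mult_left_mono[OF add] mult_left_mono[OF add]]]) simp_all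
          also have "\<dots> = 4 * qf (cut a b x *\<^sub>R ?s1) + 4 * ((2 * cut1 a b x)\<^sup>2 * qf (q x) + (cut2 a b x)\<^sup>2 * qf (P x *v v x) + (cut1 a b x)\<^sup>2 * qf ?s4)"
            by (simp only: sc) (simp add: algebra_simps)
          also have "\<dots> \<le> 4 * \<bar>Re (cdot (f x) (R x *v f x))\<bar> + 4 * ((2 * m1)\<^sup>2 * (op_norm ?M * B1\<^sup>2) + m2\<^sup>2 * (op_norm ?M * B2\<^sup>2) + m1\<^sup>2 * (op_norm ?N * B3\<^sup>2))"
          proof -
            have c1: "(2 * cut1 a b x)\<^sup>2 \<le> (2 * m1)\<^sup>2" "(cut1 a b x)\<^sup>2 \<le> m1\<^sup>2"
              using cut1_bound[OF ab(2), of x] m unfolding m1_def[symmetric]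
              by (auto simp: abs_le_square_iff[symmetric])
            have c2: "(cut2 a b x)\<^sup>2 \<le> m2\<^sup>2"
              using cut2_bound[OF ab(2), of x] m unfolding m2_def[symmetric]
              by (auto simp: abs_le_square_iff[symmetric])
            have q1: "qf (q x) \<le> op_norm ?M * B1\<^sup>2"
              by (rule order_trans[OF qfM]) (use B xc op_norm_nonneg in \<open>auto intro!: mult_left_mono power_mono\<close>)
            have q2: "qf (P x *v v x) \<le> op_norm ?M * B2\<^sup>2"
              by (rule order_trans[OF qfM]) (use B xc op_norm_nonneg in \<open>auto intro!: mult_left_mono power_mono\<close>)
            have q4: "qf ?s4 \<le> op_norm ?N * B3\<^sup>2"
              by (rule order_trans[OF s4]) (use B xc op_norm_nonneg in \<open>auto intro!: mult_left_mono power_mono\<close>)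
            have qf0: "0 \<le> qf s" for s unfolding qf_def by (rule pos_def_nonneg[OF M])
            show ?thesis
              by (intro add_mono mult_left_mono mult_mono s1' c1 c2 q1 q2 q4 qf0) auto
          qed
          also have "\<dots> \<le> 4 * \<bar>Re (cdot (f x) (R x *v f x))\<bar> + C * (op_norm ?M + op_norm ?N)"
          proof -
            have "0 \<le> op_norm ?M" "0 \<le> op_norm ?N" by (rule op_norm_nonneg)+
            moreover have "C * (op_norm ?M + op_norm ?N) = 4 * ((2 * m1)\<^sup>2 * (op_norm ?M * B1\<^sup>2) + m2\<^sup>2 * (op_norm ?M * B2\<^sup>2) + m1\<^sup>2 * (op_norm ?N * B3\<^sup>2))
               + 4 * ((2 * m1)\<^sup>2 * (op_norm ?N * B1\<^sup>2) + m2\<^sup>2 * (op_norm ?N * B2\<^sup>2) + m1\<^sup>2 * (op_norm ?M * B3\<^sup>2))"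
              by (simp add: C_def algebra_simps)
            ultimately show ?thesis by simp
          qed
          finally show ?thesis unfolding 0 using a True by simp
        qed
      qed
    qed
  qed
qed

lemma cg_L2: "cg \<in> L2_space c R"
  unfolding L2_space_def
proof (intro CollectI conjI cg_measurable)
  obtain C where C: "AE x in lebesgue_on {c..}. Re (cdot (cg x) (R x *v cg x)) \<le>
     4 * (if x \<le> b then \<bar>Re (cdot (f x) (R x *v f x))\<bar> else 0) +
     (if a \<le> x \<and> x \<le> b then C * (op_norm (matrix_inv (R x)) + op_norm (DP x ** matrix_inv (R x) ** DP x)) else 0)"
    (is "AE x in _. _ \<le> 4 * ?H1 x + ?H2 x")
    using cg_form_bound by blast
  have cb: "c \<le> b" using ab by simp
  have "?H1 absolutely_integrable_on {c..b}"
    by (rule absolutely_integrable_spike[OF absolutely_integrable_norm[OF Re_form_int[OF f f cb]], of "{}"]) auto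
  from halfline_integral(1)[OF this] have H1: "integrable (lebesgue_on {c..}) ?H1" by auto
  have sub: "compact {a..b}" "{a..b} \<subseteq> {c<..}" using ab by auto
  have "(\<lambda>x. C * (op_norm (matrix_inv (R x)) + op_norm (DP x ** matrix_inv (R x) ** DP x))) absolutely_integrable_on {a..b}"
    using PRP Rinv sub unfolding L1_loc_def by (intro set_integrable_mult_right set_integral_add) blast+
  then have "integrable lebesgue (\<lambda>x. indicator {a..b} x *\<^sub>R (C * (op_norm (matrix_inv (R x)) + op_norm (DP x ** matrix_inv (R x) ** DP x))))"
    unfolding set_integrable_def .
  also have "(\<lambda>x. indicator {a..b} x *\<^sub>R (C * (op_norm (matrix_inv (R x)) + op_norm (DP x ** matrix_inv (R x) ** DP x)))) = (\<lambda>x. indicator {c..} x *\<^sub>R ?H2 x)"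
    using ab by (auto simp: indicator_def fun_eq_iff)
  finally have H2: "integrable (lebesgue_on {c..}) ?H2" by (simp add: integrable_restrict_space)
  show "integrable (lebesgue_on {c..}) (\<lambda>x. cdot (cg x) (R x *v cg x))"
  proof (rule Bochner_Integration.integrable_bound)
    show "integrable (lebesgue_on {c..}) (\<lambda>x. 4 * ?H1 x + ?H2 x)"
      by (intro Bochner_Integration.integrable_add Bochner_Integration.integrable_mult_right H1 H2)
    show "(\<lambda>x. cdot (cg x) (R x *v cg x)) \<in> borel_measurable (lebesgue_on {c..})"
      by (intro borel_measurable_bilinear[OF bounded_bilinear_cdot] borel_measurable_bilinear[OF bounded_bilinear_matrix_vector_mult] cg_measurable R_meas)
    show "AE x in lebesgue_on {c..}. norm (cdot (cg x) (R x *v cg x)) \<le> norm (4 * ?H1 x + ?H2 x)"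
      using C R_pos
    proof eventually_elim
      case (elim x)
      have "norm (cdot (cg x) (R x *v cg x)) = Re (cdot (cg x) (R x *v cg x))"
        by (subst cdot_self_adjoint_real[OF pos_def_self_adjoint[OF elim(2)]]) (simp add: pos_def_nonneg[OF elim(2)])
      then show ?case using elim(1) unfolding real_norm_def by linarith
    qed
  qed
qed

lemma cV_D_min: "cV \<in> D_min c P Q R"
  unfolding D_min_def D_max_def
proof (intro CollectI conjI)
  show "cV \<in> L_admissible c P" by (rule SL_imp_admissible(1)[OF cV_SL])
  show "cV c = 0" by (simp add: cV_def v0)
  show "cV \<in> L2_space c R" unfolding L2_space_def
  proof (intro CollectI conjI)
    show "cV \<in> borel_measurable (lebesgue_on {c..})"
      by (rule continuous_imp_measurable_on_sets_lebesgue[OF cV_continuous halfline_sets])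
    show "integrable (lebesgue_on {c..}) (\<lambda>x. cdot (cV x) (R x *v cV x))"
      by (rule halfline_integral(1)[OF form_int[OF cV_continuous cV_continuous, of b]])
        (use ab c_right in \<open>auto simp: cdot.zero_left\<close>)
  qed
  show "L_expr c P Q R cV \<in> L2_space c R"
    using SL_imp_admissible(2)[OF cV_SL] by (intro L2_space_cong_AE[OF cg_L2]) (auto elim: eventually_mono)
  have "{x \<in> {c..}. cV x \<noteq> 0} \<subseteq> {c..b}" by (auto intro!: leI dest: c_right(1))
  then have "bounded {x \<in> {c..}. cV x \<noteq> 0}" using bounded_subset bounded_closed_interval by blast
  then show "compact (closure {x \<in> {c..}. cV x \<noteq> 0})" by (simp add: compact_closure)
qed

text \<open>Localization formula: adding (\<eta>')^2 (v, P v) to the cross terms 2 \<eta> \<eta>'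
  (v, q), \<eta> \<eta>'' (v, P v) and \<eta> \<eta>' (v, P' v) gives, in real parts, the exact
  derivative of \<eta> \<eta>' (v, P v). After integration only the (\<eta>')^2 energy is left of
  them.\<close>

lemma cut_energy_prim:
  obtains h' where "prim c (\<lambda>x. (cut a b x * cut1 a b x) * Re (cdot (v x) (P x *v v x))) h'"
    "AE x in lebesgue_on {c..}. Re (cdot (cV x) (cS x)) =
      (cut a b x)\<^sup>2 * Re (cdot (v x) (R x *v f x)) + (cut1 a b x)\<^sup>2 * Re (cdot (v x) (P x *v v x)) - h' x"
proof
  have Pv: "prim c (\<lambda>x. P x *v v x) (\<lambda>x. P x *v (matrix_inv (P x) *v q x) + DP x *v v x)"
    by (rule prim_bilinear[OF bounded_bilinear_matrix_vector_mult P_prim v_prim])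
  let ?\<phi>' = "\<lambda>x. Re (cdot (v x) (P x *v (matrix_inv (P x) *v q x) + DP x *v v x) + cdot (matrix_inv (P x) *v q x) (P x *v v x))"
  have \<phi>: "prim c (\<lambda>x. Re (cdot (v x) (P x *v v x))) ?\<phi>'"
    by (rule prim_linear[OF bounded_linear_Re prim_bilinear[OF bounded_bilinear_cdot v_prim Pv]])
  let ?h' = "\<lambda>x. (cut a b x * cut1 a b x) * ?\<phi>' x + (cut a b x * cut2 a b x + cut1 a b x * cut1 a b x) * Re (cdot (v x) (P x *v v x))"
  show "prim c (\<lambda>x. (cut a b x * cut1 a b x) * Re (cdot (v x) (P x *v v x))) ?h'"
    by (intro prim_bilinear[OF bounded_bilinear_mult] prim_cut ab \<phi>)
  show "AE x in lebesgue_on {c..}. Re (cdot (cV x) (cS x)) =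
      (cut a b x)\<^sup>2 * Re (cdot (v x) (R x *v f x)) + (cut1 a b x)\<^sup>2 * Re (cdot (v x) (P x *v v x)) - ?h' x"
    using P_pos
  proof eventually_elim
    case (elim x)
    have 1: "P x *v (matrix_inv (P x) *v q x) = q x" by (simp add: matrix_inv_cancel pos_def_invertible[OF elim])
    have "cdot (matrix_inv (P x) *v q x) (P x *v v x) = cdot (q x) (v x)"
      using cdot_self_adjoint[OF pos_def_self_adjoint[OF elim], of "matrix_inv (P x) *v q x" "v x"] 1 by simp
    then have 2: "Re (cdot (matrix_inv (P x) *v q x) (P x *v v x)) = Re (cdot (v x) (q x))"
      using cdot_commute[of "v x" "q x"] by simp
    show ?case
      using 2 by (simp add: 1 cV_def cS_def cdot.scaleR_left cdot.scaleR_right cdot.diff_right cdot.add_right algebra_simps power2_eq_square)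
  qed
qed

text \<open>The exact derivative h' integrates to 0, because \<open>cut1\<close> vanishes at c and
  at b; what remains is the lower bound at \<open>cV\<close>.\<close>

lemma cut_form_bound:
  "\<gamma> * integral {c..b} (\<lambda>x. (cut a b x)\<^sup>2 * Re (cdot (v x) (R x *v v x)))
   \<le> integral {c..b} (\<lambda>x. (cut a b x)\<^sup>2 * Re (cdot (v x) (R x *v f x)))
     + integral {c..b} (\<lambda>x. (cut1 a b x)\<^sup>2 * Re (cdot (v x) (P x *v v x)))"
proof -
  have cb: "c \<le> b" using ab by simp
  have vc: "continuous_on {c..} v" by (rule SL_continuous(1)[OF v])
  obtain h' where h: "prim c (\<lambda>x. (cut a b x * cut1 a b x) * Re (cdot (v x) (P x *v v x))) h'"
    and ae: "AE x in lebesgue_on {c..}. Re (cdot (cV x) (cS x)) =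
      (cut a b x)\<^sup>2 * Re (cdot (v x) (R x *v f x)) + (cut1 a b x)\<^sup>2 * Re (cdot (v x) (P x *v v x)) - h' x"
    using cut_energy_prim by blast
  have hi: "(h' has_integral 0) {c..b}"
    using prim_has_integral[OF h order_refl cb] cut_left[OF ab(2), of c] cut_right[OF ab(2), of b] ab by simp
  let ?G = "\<lambda>x. cdot (cV x) (cS x)"
  have "(\<lambda>x. cdot (cV x) (cS x)) absolutely_integrable_on {c..b}"
    by (rule absolutely_integrable_bilinear_continuous[OF bounded_bilinear.flip[OF bounded_bilinear_cdot] cS_int])
      (rule continuous_on_subset[OF cV_continuous], auto)
  note G = this
  have G0: "?G x = 0" if "x > b" for x using c_right[OF that] by (simp add: cdot.zero_left)
  have Gae: "AE x in lebesgue_on {c..}. ?G x = cdot (cV x) (R x *v L_expr c P Q R cV x)"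
    using SL_imp_admissible(2)[OF cV_SL] R_cg by eventually_elim simp
  have "L2_ip c R cV (L_expr c P Q R cV) = (LINT x|lebesgue_on {c..}. ?G x)"
    unfolding L2_ip_def
  proof (rule integral_cong_AE)
    show "?G \<in> borel_measurable (lebesgue_on {c..})" using halfline_integral(1)[OF G G0] by auto
    then show "(\<lambda>x. cdot (cV x) (R x *v L_expr c P Q R cV x)) \<in> borel_measurable (lebesgue_on {c..})"
      by (rule borel_measurable_lebesgue_on_AE[OF _ Gae])
    show "AE x in lebesgue_on {c..}. cdot (cV x) (R x *v L_expr c P Q R cV x) = ?G x"
      using Gae by eventually_elim simp
  qed
  also have "\<dots> = integral {c..b} ?G" by (rule halfline_integral(2)[OF G G0])
  finally have "Re (L2_ip c R cV (L_expr c P Q R cV)) = integral {c..b} (\<lambda>x. Re (?G x))"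
    using integral_linear[OF set_lebesgue_integral_eq_integral(1)[OF G] bounded_linear_Re] by (simp add: o_def)
  also have "\<dots> = integral {c..b} (\<lambda>x. ((cut a b x)\<^sup>2 * Re (cdot (v x) (R x *v f x)) + (cut1 a b x)\<^sup>2 * Re (cdot (v x) (P x *v v x))) - h' x)"
  proof -
    obtain N where "negligible N" "\<And>x. x \<ge> c \<Longrightarrow> x \<notin> N \<Longrightarrow> Re (?G x) =
      (cut a b x)\<^sup>2 * Re (cdot (v x) (R x *v f x)) + (cut1 a b x)\<^sup>2 * Re (cdot (v x) (P x *v v x)) - h' x"
      using ae unfolding AE_lebesgue_on_halfline_iff by blast
    then show ?thesis by (intro integral_spike[of N]) auto
  qed
  also have "\<dots> = integral {c..b} (\<lambda>x. (cut a b x)\<^sup>2 * Re (cdot (v x) (R x *v f x)))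
     + integral {c..b} (\<lambda>x. (cut1 a b x)\<^sup>2 * Re (cdot (v x) (P x *v v x)))"
  proof -
    have i1: "(\<lambda>x. (cut a b x)\<^sup>2 * Re (cdot (v x) (R x *v f x))) integrable_on {c..b}"
      by (intro set_lebesgue_integral_eq_integral(1) mult_int_continuous continuous_intros cut_continuous Re_form_int vc f cb)
    have "continuous_on {c..} (\<lambda>x. (cut1 a b x)\<^sup>2 * Re (cdot (v x) (P x *v v x)))"
      by (intro continuous_on_mult continuous_intros continuous_on_Re_form cut_continuous vc P_continuous)
    then have i2: "(\<lambda>x. (cut1 a b x)\<^sup>2 * Re (cdot (v x) (P x *v v x))) integrable_on {c..b}"
      by (intro integrable_continuous_real) (auto intro: continuous_on_subset)
    show ?thesis using integral_diff[OF integrable_add[OF i1 i2], of h'] integral_add[OF i1 i2] hi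
      by (auto simp: has_integral_iff)
  qed
  finally have R1: "Re (L2_ip c R cV (L_expr c P Q R cV)) = \<dots>" .
  have F: "(\<lambda>x. cdot (cV x) (R x *v cV x)) absolutely_integrable_on {c..b}"
    by (rule form_int[OF cV_continuous cV_continuous cb])
  have "L2_ip c R cV cV = integral {c..b} (\<lambda>x. cdot (cV x) (R x *v cV x))"
    unfolding L2_ip_def by (rule halfline_integral(2)[OF F]) (use c_right(1) in \<open>simp add: cdot.zero_left\<close>)
  then have "Re (L2_ip c R cV cV) = integral {c..b} (\<lambda>x. Re (cdot (cV x) (R x *v cV x)))"
    using integral_linear[OF set_lebesgue_integral_eq_integral(1)[OF F] bounded_linear_Re] by (simp add: o_def)
  also have "\<dots> = integral {c..b} (\<lambda>x. (cut a b x)\<^sup>2 * Re (cdot (v x) (R x *v v x)))"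
    by (simp add: cV_def mv.scaleR_right cdot.scaleR_left cdot.scaleR_right power2_eq_square mult.assoc)
  finally show ?thesis using lower_bound[OF cV_D_min] R1 by simp
qed

end

end

section \<open>Consequences of semiboundedness\<close>

text \<open>Each doubling of \<rho> multiplies m by at least 1 + 1/B, so a positive value would
  exceed K eventually.\<close>

lemma geometric_growth_bounded:
  fixes m :: "real \<Rightarrow> real"
  assumes "B > 0" "\<rho>0 > 0" and grow: "\<And>\<rho>. \<rho> \<ge> \<rho>0 \<Longrightarrow> m (\<rho>/2) \<le> B * (m \<rho> - m (\<rho>/2))"
    and bd: "\<And>\<rho>. \<rho> \<ge> \<rho>0 \<Longrightarrow> m \<rho> \<le> K" and "\<rho> \<ge> \<rho>0"
  shows "m \<rho> \<le> 0"
proof (rule ccontr)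
  assume "\<not> m \<rho> \<le> 0"
  define q where "q = 1 + 1 / B"
  have q: "q > 1" using \<open>B > 0\<close> by (simp add: q_def)
  have ge: "\<rho> * 2 ^ n \<ge> \<rho>0" for n
  proof -
    have "\<rho> * 1 \<le> \<rho> * 2 ^ n" using assms by (intro mult_left_mono) auto
    then show ?thesis using \<open>\<rho> \<ge> \<rho>0\<close> unfolding mult_1_right by linarith
  qed
  have "q ^ n * m \<rho> \<le> m (\<rho> * 2 ^ n)" for n
  proof (induction n)
    case (Suc n)
    have "m (\<rho> * 2 ^ n) \<le> B * (m (\<rho> * 2 ^ Suc n) - m (\<rho> * 2 ^ n))"
      using grow[OF ge[of "Suc n"]] by simp
    then have "q * m (\<rho> * 2 ^ n) \<le> m (\<rho> * 2 ^ Suc n)"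
      using \<open>B > 0\<close> by (simp add: q_def field_simps)
    moreover have "q * (q ^ n * m \<rho>) \<le> q * m (\<rho> * 2 ^ n)" using Suc q by (intro mult_left_mono) auto
    ultimately show ?case by (simp add: mult.assoc)
  qed simp
  then have "q ^ n * m \<rho> \<le> K" for n using bd[OF ge] order_trans by blast
  moreover obtain n where "K / m \<rho> < q ^ n" using real_arch_pow[OF q] by blast
  then have "K < q ^ n * m \<rho>" using \<open>\<not> m \<rho> \<le> 0\<close> by (simp add: field_simps)
  ultimately show False by (meson not_le)
qed

context semibounded
begin

text \<open>A cutoff between \<open>\<rho>/2\<close> and \<open>\<rho>\<close> has energy at most a constant times the mass of \<open>w\<close> on \<open>[\<rho>/2, \<rho>]\<close>, so
  the mass on \<open>[c, \<rho>]\<close> would grow geometrically along \<open>\<rho>, 2 \<rho>, 4 \<rho>, \<dots>\<close> if it were not zero.\<close>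

lemma Povzner_Wienholtz:
  assumes w: "SL w p (\<lambda>x. complex_of_real \<mu> *s w x)" and w0: "w c = 0" and "\<mu> < \<gamma>"
    and K: "\<And>d. d \<ge> c \<Longrightarrow> mass d w \<le> K"
    and growth: "\<And>\<rho>. \<rho> \<ge> \<rho>0 \<Longrightarrow> AE x in lebesgue_on {c..}. \<rho>/2 \<le> x \<and> x \<le> \<rho> \<longrightarrow>
      op_norm (mat_inv_sqrt (R x) ** P x ** mat_inv_sqrt (R x)) \<le> C * \<rho>\<^sup>2"
    and x: "x \<ge> c"
  shows "w x = 0"
proof -
  have wc: "continuous_on {c..} w" by (rule SL_continuous(1)[OF w])
  have fc: "continuous_on {c..} (\<lambda>x. complex_of_real \<mu> *s w x)"
    by (rule bounded_linear.continuous_on[OF bounded_linear_vector_scalar wc])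
  \<comment> \<open>The 9 comes from squaring \<open>\<bar>cut1\<bar> \<le> 3 / \<rho>\<close>, the
    slope bound for an interval of length \<rho>/2; \<open>\<bar>C\<bar> + 1\<close> makes B
    positive.\<close>
  define B where "B = 9 * (\<bar>C\<bar> + 1) / (\<gamma> - \<mu>)"
  have B: "B > 0" using \<open>\<mu> < \<gamma>\<close> by (simp add: B_def add_nonneg_pos)
  \<comment> \<open>From here on \<rho>/2 lies to the right of c, whatever the sign of c, and \<rho>
    is positive.\<close>
  define \<rho>1 where "\<rho>1 = max \<rho>0 (2 * \<bar>c\<bar> + 1)"
  have grow: "mass (\<rho>/2) w \<le> B * (mass \<rho> w - mass (\<rho>/2) w)" if \<rho>: "\<rho> \<ge> \<rho>1" for \<rho>
  proof -
    let ?a = "\<rho> / 2" and ?W = "\<lambda>x. Re (cdot (w x) (R x *v w x))" and ?\<phi> = "\<lambda>x. Re (cdot (w x) (P x *v w x))"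
    have ab: "c < ?a" "?a < \<rho>" "c \<le> \<rho>" "\<rho> > 0" using \<rho> by (auto simp: \<rho>1_def)
    let ?cut = "cut ?a \<rho>" and ?cut1 = "cut1 ?a \<rho>"
    note bound = cut_form_bound[OF w fc w0 ab(1,2)]
    have cut_cont: "continuous_on {c..} ?cut" "continuous_on {c..} ?cut1"
      using prim_cut[OF ab(2)] by (auto intro: prim_continuous)
    have i1: "(\<lambda>x. (?cut x)\<^sup>2 * ?W x) integrable_on {c..\<rho>}"
      by (intro set_lebesgue_integral_eq_integral(1) mult_int_continuous continuous_intros cut_cont Re_form_int wc ab)
    have Wi: "?W integrable_on {c..\<rho>}" "?W integrable_on {c..?a}"
      using ab by (auto intro!: Re_form_integrable wc)
    have "continuous_on {c..} (\<lambda>x. (?cut1 x)\<^sup>2 * ?\<phi> x)"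
      by (intro continuous_on_mult continuous_intros continuous_on_Re_form cut_cont wc P_continuous)
    then have i2: "(\<lambda>x. (?cut1 x)\<^sup>2 * ?\<phi> x) integrable_on {c..\<rho>}"
      by (intro integrable_continuous_real) (auto intro: continuous_on_subset)
    have "integral {c..\<rho>} (\<lambda>x. (?cut x)\<^sup>2 * Re (cdot (w x) (R x *v (complex_of_real \<mu> *s w x))))
       = \<mu> * integral {c..\<rho>} (\<lambda>x. (?cut x)\<^sup>2 * ?W x)"
      by (simp add: matrix_vector_scalar cdot_vector_scalar_right mult.left_commute)
    with bound have 1: "(\<gamma> - \<mu>) * integral {c..\<rho>} (\<lambda>x. (?cut x)\<^sup>2 * ?W x) \<le> integral {c..\<rho>} (\<lambda>x. (?cut1 x)\<^sup>2 * ?\<phi> x)"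
      by (simp add: algebra_simps)
    have "mass ?a w = integral {c..?a} (\<lambda>x. (?cut x)\<^sup>2 * ?W x)"
      using cut_left[OF ab(2)] by (intro integral_cong) auto
    also have "\<dots> \<le> integral {c..\<rho>} (\<lambda>x. (?cut x)\<^sup>2 * ?W x)"
      by (rule integral_mono_upper_AE[OF i1]) (use ab in \<open>auto intro: eventually_mono[OF form_nonneg[of w]]\<close>)
    finally have 2: "(\<gamma> - \<mu>) * mass ?a w \<le> (\<gamma> - \<mu>) * integral {c..\<rho>} (\<lambda>x. (?cut x)\<^sup>2 * ?W x)"
      using \<open>\<mu> < \<gamma>\<close> by (intro mult_left_mono) auto
    have split: "integral {c..?a} g + integral {?a..\<rho>} g = integral {c..\<rho>} g" if "g integrable_on {c..\<rho>}" for g :: "real \<Rightarrow> real"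
      by (rule Henstock_Kurzweil_Integration.integral_combine) (use ab that in auto)
    have sub: "g integrable_on {?a..\<rho>}" if "g integrable_on {c..\<rho>}" for g :: "real \<Rightarrow> real"
      by (rule integrable_on_subinterval[OF that]) (use ab in auto)
    have "integral {c..?a} (\<lambda>x. (?cut1 x)\<^sup>2 * ?\<phi> x) = integral {c..?a} (\<lambda>x. 0)"
      using cut_left[OF ab(2)] by (intro integral_cong) auto
    then have "integral {c..\<rho>} (\<lambda>x. (?cut1 x)\<^sup>2 * ?\<phi> x) = integral {?a..\<rho>} (\<lambda>x. (?cut1 x)\<^sup>2 * ?\<phi> x)"
      using split[OF i2] by simp
    also have "\<dots> \<le> integral {?a..\<rho>} (\<lambda>x. 9 * (\<bar>C\<bar> + 1) * ?W x)"
    proof (rule integral_le_AE[of _ _ _ c])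
      have g: "AE x in lebesgue_on {c..}. \<rho>/2 \<le> x \<and> x \<le> \<rho> \<longrightarrow>
          op_norm (mat_inv_sqrt (R x) ** P x ** mat_inv_sqrt (R x)) \<le> C * \<rho>\<^sup>2"
        by (rule growth) (use \<rho> in \<open>simp add: \<rho>1_def\<close>)
      show "AE x in lebesgue_on {c..}. x \<in> {?a..\<rho>} \<longrightarrow> (?cut1 x)\<^sup>2 * ?\<phi> x \<le> 9 * (\<bar>C\<bar> + 1) * ?W x"
        using g R_pos
      proof eventually_elim
        case (elim x)
        show ?case
        proof
          assume x: "x \<in> {?a..\<rho>}"
          have W0: "0 \<le> ?W x" by (rule pos_def_nonneg[OF elim(2)])
          have "?\<phi> x \<le> op_norm (mat_inv_sqrt (R x) ** P x ** mat_inv_sqrt (R x)) * ?W x"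
            by (rule quadratic_form_le_mat_inv_sqrt[OF elim(2)])
          also have "\<dots> \<le> ((\<bar>C\<bar> + 1) * \<rho>\<^sup>2) * ?W x"
          proof (intro mult_right_mono W0)
            have "C * \<rho>\<^sup>2 \<le> (\<bar>C\<bar> + 1) * \<rho>\<^sup>2" by (intro mult_right_mono) auto
            then show "op_norm (mat_inv_sqrt (R x) ** P x ** mat_inv_sqrt (R x)) \<le> (\<bar>C\<bar> + 1) * \<rho>\<^sup>2"
              using elim(1) x by auto
          qed
          finally have \<phi>: "?\<phi> x \<le> ((\<bar>C\<bar> + 1) * \<rho>\<^sup>2) * ?W x" .
          have "\<bar>?cut1 x\<bar> \<le> 3 / \<rho>" using cut1_bound[OF ab(2), of x] by simp
          then have c1: "(?cut1 x)\<^sup>2 \<le> (3 / \<rho>)\<^sup>2" using ab(4) by (simp add: abs_le_square_iff[symmetric])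
          have "(?cut1 x)\<^sup>2 * ?\<phi> x \<le> (?cut1 x)\<^sup>2 * (((\<bar>C\<bar> + 1) * \<rho>\<^sup>2) * ?W x)"
            by (intro mult_left_mono \<phi>) auto
          also have "\<dots> \<le> (3 / \<rho>)\<^sup>2 * (((\<bar>C\<bar> + 1) * \<rho>\<^sup>2) * ?W x)"
            by (intro mult_right_mono c1 mult_nonneg_nonneg W0) auto
          also have "\<dots> = 9 * (\<bar>C\<bar> + 1) * ?W x" using ab(4) by (simp add: power_divide)
          finally show "(?cut1 x)\<^sup>2 * ?\<phi> x \<le> 9 * (\<bar>C\<bar> + 1) * ?W x" .
        qed
      qed
    qed (use ab in \<open>auto intro!: sub i2 Wi integrable_on_mult_right\<close>)
    also have "\<dots> = 9 * (\<bar>C\<bar> + 1) * integral {?a..\<rho>} ?W"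
      by (rule Henstock_Kurzweil_Integration.integral_mult_right)
    also have "integral {?a..\<rho>} ?W = mass \<rho> w - mass ?a w" using split[OF Wi(1)] by linarith
    finally have "(\<gamma> - \<mu>) * mass ?a w \<le> 9 * (\<bar>C\<bar> + 1) * (mass \<rho> w - mass ?a w)" using 1 2 by simp
    then show ?thesis using \<open>\<mu> < \<gamma>\<close> unfolding B_def by (simp add: pos_le_divide_eq mult.commute)
  qed
  define d where "d = max \<rho>1 (x + 1)"
  have "mass d w \<le> 0"
  proof (rule geometric_growth_bounded[where m="\<lambda>\<rho>. mass \<rho> w", OF B _ grow K])
    show "\<rho>1 > 0" by (simp add: \<rho>1_def)
    show "\<rho>1 \<le> d" by (simp add: d_def)
    show "c \<le> \<rho>" if "\<rho>1 \<le> \<rho>" for \<rho> using that by (auto simp: \<rho>1_def)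
  qed
  then show ?thesis by (intro mass_zero[OF wc _ _ x, of d]) (use x in \<open>auto simp: d_def\<close>)
qed

text \<open>Functions vanishing at \<open>b\<close> need not be in the minimal domain. As \<open>P b\<close> is invertible, \<open>v x = O(b - x)\<close>, and
  the energy of a cutoff on \<open>[b - \<delta>, b]\<close> tends to zero with \<open>\<delta>\<close>.\<close>

lemma Dirichlet_lower_bound:
  assumes v: "SL v q f" and f: "continuous_on {c..} f" and v0: "v c = 0" and vb: "v b = 0" and "c < b"
    and Pb: "pos_def (P b)"
  shows "\<gamma> * mass b v \<le> integral {c..b} (\<lambda>x. Re (cdot (v x) (R x *v f x)))"
proof -
  have vc: "continuous_on {c..} v" and qc: "continuous_on {c..} q" by (rule SL_continuous[OF v])+
  have v1: "prim c v (\<lambda>x. matrix_inv (P x) *v q x)" using v by (simp add: SL_def)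
  obtain k where "k > 0" and k: "\<And>\<xi>. k * (norm \<xi>)\<^sup>2 \<le> Re (cdot \<xi> (P b *v \<xi>))"
    using pos_def_lower_bound[OF Pb] by blast
  obtain L where "L > 0" and L: "\<And>M \<xi>. norm (M *v \<xi>) \<le> norm (M :: complex^'a^'a) * norm \<xi> * L"
    using mv.pos_bounded by blast
  have "b \<in> {c..}" using \<open>c < b\<close> by simp
  then obtain \<delta>1 where "\<delta>1 > 0" and \<delta>1: "\<And>x. x \<ge> c \<Longrightarrow> dist x b < \<delta>1 \<Longrightarrow> dist (P x) (P b) < k / 2 / L"
    using P_continuous \<open>k > 0\<close> \<open>L > 0\<close> unfolding continuous_on_iff
    by (metis atLeast_iff divide_pos_pos half_gt_zero)
  \<comment> \<open>By continuity of P the lower bound k at b survives as k/2 nearby, where it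
    bounds the inverse of P.\<close>
  have low: "k / 2 * norm \<xi> \<le> norm (P x *v \<xi>)" if "x \<ge> c" "dist x b < \<delta>1" for x \<xi>
  proof (cases "\<xi> = 0")
    case False
    have "norm ((P x - P b) *v \<xi>) \<le> (k / 2 / L) * norm \<xi> * L"
      using \<delta>1[OF that] \<open>L > 0\<close> by (intro order_trans[OF L] mult_right_mono) (auto simp: dist_norm)
    then have D: "norm ((P x - P b) *v \<xi>) \<le> k / 2 * norm \<xi>" using \<open>L > 0\<close> by simp
    have "k * (norm \<xi>)\<^sup>2 \<le> Re (cdot \<xi> (P x *v \<xi>)) - Re (cdot \<xi> ((P x - P b) *v \<xi>))"
      using k[of \<xi>] by (simp add: mv.diff_left cdot.diff_right)
    also have "\<dots> \<le> norm \<xi> * norm (P x *v \<xi>) + norm \<xi> * (k / 2 * norm \<xi>)"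
    proof -
      have "Re (cdot \<xi> (P x *v \<xi>)) \<le> norm \<xi> * norm (P x *v \<xi>)"
        by (rule order_trans[OF complex_Re_le_cmod norm_cdot_le])
      moreover have "- Re (cdot \<xi> ((P x - P b) *v \<xi>)) \<le> norm \<xi> * norm ((P x - P b) *v \<xi>)"
        using abs_Re_le_cmod norm_cdot_le order_trans by (metis abs_le_iff)
      moreover have "norm \<xi> * norm ((P x - P b) *v \<xi>) \<le> norm \<xi> * (k / 2 * norm \<xi>)"
        using D by (intro mult_left_mono) auto
      ultimately show ?thesis by linarith
    qed
    finally have "norm \<xi> * (k / 2 * norm \<xi>) \<le> norm \<xi> * norm (P x *v \<xi>)" by (simp add: power2_eq_square algebra_simps)
    then show ?thesis using False by simp
  qed simp
  have cb: "c \<le> b" using \<open>c < b\<close> by simp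
  obtain B where "B \<ge> 0" and B: "\<And>x. x \<in> {c..b} \<Longrightarrow> norm (q x) \<le> B" "\<And>x. x \<in> {c..b} \<Longrightarrow> norm (P x) \<le> B"
  proof -
    have "bounded (q ` {c..b})" "bounded (P ` {c..b})"
      by (intro compact_imp_bounded compact_continuous_image continuous_on_subset[OF qc] continuous_on_subset[OF P_continuous]; force)+
    then obtain B1 B2 where "\<forall>x\<in>{c..b}. norm (q x) \<le> B1" "\<forall>x\<in>{c..b}. norm (P x) \<le> B2"
      unfolding bounded_iff ball_simps by blast
    then show ?thesis by (intro that[of "max 0 (max B1 B2)"]) (auto simp: le_max_iff_disj)
  qed
  \<comment> \<open>Bound for the derivative of v near b: the inverse of P has norm at most 2/k
    there and q is bounded by B.\<close>
  define K where "K = 2 / k * B"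
  have vK: "norm (v x) \<le> K * (b - x)" if x: "x \<in> {c..b}" "b - x < \<delta>1" for x
  proof -
    have "norm (v x) = norm (integral {x..b} (\<lambda>x. matrix_inv (P x) *v q x))"
      using primD(2)[OF v1, of x b] x vb by simp
    also have "\<dots> \<le> integral {x..b} (\<lambda>x. norm (matrix_inv (P x) *v q x))"
      using absolutely_integrable_norm[OF primD(1)[OF v1, of x b]] primD(1)[OF v1, of x b] x
      by (intro integral_norm_bound_integral) (auto simp: o_def intro: set_lebesgue_integral_eq_integral(1))
    also have "\<dots> \<le> integral {x..b} (\<lambda>x. K)"
    proof (rule integral_le_AE[of _ _ _ c])
      show "(\<lambda>x. norm (matrix_inv (P x) *v q x)) integrable_on {x..b}"
        using absolutely_integrable_norm[OF primD(1)[OF v1, of x b]] x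
        by (auto simp: o_def intro: set_lebesgue_integral_eq_integral(1))
      show "AE y in lebesgue_on {c..}. y \<in> {x..b} \<longrightarrow> norm (matrix_inv (P y) *v q y) \<le> K"
        using P_pos
      proof eventually_elim
        case (elim y)
        show ?case
        proof
          assume y: "y \<in> {x..b}"
          have "k / 2 * norm (matrix_inv (P y) *v q y) \<le> norm (P y *v (matrix_inv (P y) *v q y))"
            by (rule low) (use x y in \<open>auto simp: dist_real_def\<close>)
          also have "\<dots> \<le> B" using B(1)[of y] x y by (simp add: matrix_inv_cancel pos_def_invertible[OF elim])
          finally show "norm (matrix_inv (P y) *v q y) \<le> K" using \<open>k > 0\<close> by (simp add: K_def field_simps)
        qed
      qed
    qed (use x in auto)
    also have "\<dots> = K * (b - x)" using x by simp
    finally show ?thesis .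
  qed
  have K0: "K \<ge> 0" using \<open>k > 0\<close> \<open>B \<ge> 0\<close> by (simp add: K_def)
  \<comment> \<open>The denominator n + 2 makes the inequalities with \<delta>1 and b - c strict
    already for n = 0.\<close>
  define \<delta> where "\<delta> n = min \<delta>1 (b - c) / real (n + 2)" for n
  have \<delta>: "\<delta> n > 0" "\<delta> n < \<delta>1" "\<delta> n < b - c" for n
  proof -
    have m: "min \<delta>1 (b - c) > 0" using \<open>\<delta>1 > 0\<close> \<open>c < b\<close> by simp
    then show "\<delta> n > 0" by (simp add: \<delta>_def)
    have "\<delta> n < min \<delta>1 (b - c)" using m by (simp add: \<delta>_def divide_less_eq del: min_less_iff_conj)
    then show "\<delta> n < \<delta>1" "\<delta> n < b - c" by auto
  qed
  have \<delta>0: "\<delta> \<longlonglongrightarrow> 0"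
  proof -
    have "(\<lambda>n. min \<delta>1 (b - c) / real (n + 2)) \<longlonglongrightarrow> 0"
      using LIMSEQ_ignore_initial_segment[OF lim_const_over_n, of "min \<delta>1 (b - c)" 2] by simp
    then show ?thesis by (simp add: \<delta>_def[abs_def])
  qed
  let ?a = "\<lambda>n. b - \<delta> n"
  have ab: "c < ?a n" "?a n < b" for n using \<delta>[of n] by auto
  let ?cut = "\<lambda>n. cut (?a n) b" and ?cut1 = "\<lambda>n. cut1 (?a n) b"
  have cut_cont: "continuous_on {c..} (?cut n)" "continuous_on {c..} (?cut1 n)" for n
    by (rule prim_continuous[OF prim_cut(1)[OF ab(2)]], rule prim_continuous[OF prim_cut(2)[OF ab(2)]])
  \<comment> \<open>Squared slope \<open>(3/2/\<delta>)^2\<close> times the form of P, at most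
    \<open>L B K^2 \<delta>^2\<close> as v is at most K \<delta>: the powers of \<delta> cancel, and
    the length of the interval supplies the factor \<delta> that tends to 0.\<close>
  define M where "M = 9 / 4 * (L * B * K\<^sup>2)"
  have energy: "integral {c..b} (\<lambda>x. (?cut1 n x)\<^sup>2 * Re (cdot (v x) (P x *v v x))) \<le> M * \<delta> n" for n
  proof -
    let ?g = "\<lambda>x. (?cut1 n x)\<^sup>2 * Re (cdot (v x) (P x *v v x))"
    have gc: "continuous_on {c..} ?g"
      by (intro continuous_on_mult continuous_intros continuous_on_Re_form cut_cont vc P_continuous)
    have gi: "?g integrable_on {x..b}" if "x \<ge> c" for x
      using that by (intro integrable_continuous_real continuous_on_subset[OF gc]) auto
    have "integral {c..?a n} ?g = integral {c..?a n} (\<lambda>x. 0)"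
      using cut_left[OF ab(2)[of n]] by (intro integral_cong) auto
    then have "integral {c..b} ?g = integral {?a n..b} ?g"
      using Henstock_Kurzweil_Integration.integral_combine[of c "?a n" b ?g] ab[of n] gi[of c] by simp
    also have "\<dots> \<le> integral {?a n..b} (\<lambda>x. M)"
    proof (rule integral_le)
      fix x assume x: "x \<in> {?a n..b}"
      then have xc: "x \<in> {c..b}" and xd: "b - x \<le> \<delta> n" using ab(1)[of n] by auto
      have "norm (v x) \<le> K * (b - x)" by (rule vK[OF xc]) (use xd \<delta>[of n] in auto)
      also have "\<dots> \<le> K * \<delta> n" using xd K0 by (intro mult_left_mono) auto
      finally have nv: "norm (v x) \<le> K * \<delta> n" .
      have "Re (cdot (v x) (P x *v v x)) \<le> norm (v x) * norm (P x *v v x)"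
        by (rule order_trans[OF complex_Re_le_cmod norm_cdot_le])
      also have "\<dots> \<le> norm (v x) * (norm (P x) * norm (v x) * L)" by (intro mult_left_mono L) auto
      also have "\<dots> \<le> (K * \<delta> n) * (B * (K * \<delta> n) * L)"
        using nv B(2)[OF xc] \<open>L > 0\<close> \<open>B \<ge> 0\<close> K0 \<delta>(1)[of n] by (intro mult_mono) auto
      finally have 1: "Re (cdot (v x) (P x *v v x)) \<le> L * B * K\<^sup>2 * (\<delta> n)\<^sup>2" by (simp add: power2_eq_square mult_ac)
      have "\<bar>?cut1 n x\<bar> \<le> 3 / 2 / \<delta> n" using cut1_bound[OF ab(2)[of n], of x] by simp
      then have 2: "(?cut1 n x)\<^sup>2 \<le> (3 / 2 / \<delta> n)\<^sup>2" using \<delta>(1)[of n] by (simp add: abs_le_square_iff[symmetric])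
      have "?g x \<le> (?cut1 n x)\<^sup>2 * (L * B * K\<^sup>2 * (\<delta> n)\<^sup>2)" by (intro mult_left_mono 1) auto
      also have "\<dots> \<le> (3 / 2 / \<delta> n)\<^sup>2 * (L * B * K\<^sup>2 * (\<delta> n)\<^sup>2)"
        using \<open>L > 0\<close> \<open>B \<ge> 0\<close> by (intro mult_right_mono 2) auto
      also have "\<dots> = M" using \<delta>(1)[of n] by (simp add: M_def power_divide)
      finally show "?g x \<le> M" .
    qed (use gi ab[of n] in auto)
    also have "\<dots> = M * \<delta> n" using ab(2)[of n] by simp
    finally show ?thesis .
  qed
  \<comment> \<open>For x < b the cutoff at x is eventually 1, and at x = b the integrand vanishes
    with v; the uncut integrand dominates.\<close>
  have conv: "(\<lambda>n. integral {c..b} (\<lambda>x. (?cut n x)\<^sup>2 * Re (cdot (v x) (R x *v u x)))) \<longlonglongrightarrow> integral {c..b} (\<lambda>x. Re (cdot (v x) (R x *v u x)))"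
    if u: "continuous_on {c..} u" for u
  proof (rule dominated_convergence(2)[where h="\<lambda>x. norm (Re (cdot (v x) (R x *v u x)))"])
    show "(\<lambda>x. (?cut n x)\<^sup>2 * Re (cdot (v x) (R x *v u x))) integrable_on {c..b}" for n
      by (intro set_lebesgue_integral_eq_integral(1) mult_int_continuous continuous_intros cut_cont Re_form_int vc u cb)
    show "(\<lambda>x. norm (Re (cdot (v x) (R x *v u x)))) integrable_on {c..b}"
      using absolutely_integrable_norm[OF Re_form_int[OF vc u cb]] by (simp add: o_def set_lebesgue_integral_eq_integral(1))
    show "norm ((?cut n x)\<^sup>2 * Re (cdot (v x) (R x *v u x))) \<le> norm (Re (cdot (v x) (R x *v u x)))" for n x
      using cut_nonneg_le_1[OF ab(2)[of n], of x]
      by (simp add: abs_mult mult_left_le_one_le power_le_one)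
    show "(\<lambda>n. (?cut n x)\<^sup>2 * Re (cdot (v x) (R x *v u x))) \<longlonglongrightarrow> Re (cdot (v x) (R x *v u x))" if x: "x \<in> {c..b}" for x
    proof (cases "x = b")
      case True
      then show ?thesis using vb by (simp add: cdot.zero_left)
    next
      case False
      then have "b - x > 0" using x by simp
      then have "eventually (\<lambda>n. \<delta> n < b - x) sequentially" using \<delta>0 by (intro order_tendstoD) auto
      then have "eventually (\<lambda>n. (?cut n x)\<^sup>2 * Re (cdot (v x) (R x *v u x)) = Re (cdot (v x) (R x *v u x))) sequentially"
        by eventually_elim (use cut_left[OF ab(2)] in auto)
      then show ?thesis by (rule tendsto_eventually)
    qed
  qed
  have "\<gamma> * integral {c..b} (\<lambda>x. (?cut n x)\<^sup>2 * Re (cdot (v x) (R x *v v x)))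
    \<le> integral {c..b} (\<lambda>x. (?cut n x)\<^sup>2 * Re (cdot (v x) (R x *v f x))) + M * \<delta> n" for n
    by (rule order_trans[OF cut_form_bound[OF v f v0 ab] add_left_mono[OF energy]])
  then have "\<gamma> * mass b v \<le> integral {c..b} (\<lambda>x. Re (cdot (v x) (R x *v f x))) + M * 0"
    by (intro LIMSEQ_le[OF tendsto_mult[OF tendsto_const conv[OF vc]] tendsto_add[OF conv[OF f] tendsto_mult[OF tendsto_const \<delta>0]]]) auto
  then show ?thesis by simp
qed

end

section \<open>The flow and square integrable solutions\<close>

lemma prim_Pair:
  assumes "prim c f f'" "prim c g g'"
  shows "prim c (\<lambda>x. (f x, g x)) (\<lambda>x. (f' x, g' x))"
proof -
  have l1: "bounded_linear (\<lambda>x. (x, 0))" and l2: "bounded_linear (\<lambda>x. (0, x))"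
    by (intro bounded_linear_Pair bounded_linear_ident bounded_linear_zero)+
  show ?thesis using prim_add[OF prim_linear[OF l1 assms(1)] prim_linear[OF l2 assms(2)]] by simp
qed

text \<open>Complex multiples of a matrix, needed to absorb z R into the coefficients of the first
  order system.\<close>

definition cmat_scale :: "complex \<Rightarrow> complex^'n^'m \<Rightarrow> complex^'n^'m" where
  "cmat_scale z M = (\<chi> i j. z * M $ i $ j)"

lemma bounded_linear_cmat_scale: "bounded_linear (cmat_scale z)"
  unfolding linear_conv_bounded_linear[symmetric]
  by (intro linearI) (auto simp: cmat_scale_def vec_eq_iff algebra_simps)

lemma cmat_scale_mult: "cmat_scale z M *v v = M *v (z *s v)"
  by (simp add: cmat_scale_def matrix_vector_mult_def vec_eq_iff mult_ac)

text \<open>Product with a block matrix whose diagonal blocks are zero, as a bounded bilinear map to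
  which the linear equation theorems apply.\<close>

definition block_mult :: "(complex^'m^'m) \<times> (complex^'m^'m) \<Rightarrow> (complex^'m) \<times> (complex^'m) \<Rightarrow> (complex^'m) \<times> (complex^'m)" where
  "block_mult M y = (fst M *v snd y, snd M *v fst y)"

lemma bounded_bilinear_block_mult: "bounded_bilinear block_mult"
  unfolding bilinear_conv_bounded_bilinear[symmetric] bilinear_def
  by (intro conjI allI linearI)
    (auto simp: block_mult_def mv.add_left mv.add_right mv.scaleR_left mv.scaleR_right)

context sturm_liouville
begin

abbreviation "sysmat z \<equiv> \<lambda>x. (matrix_inv (P x), Q x - cmat_scale z (R x))"

lemma sysmat_int: "d \<ge> c \<Longrightarrow> sysmat z absolutely_integrable_on {c..d}"
proof -
  assume d: "d \<ge> c"
  have "prim c (\<lambda>x. integral {c..x} (\<lambda>x. Q x - cmat_scale z (R x))) (\<lambda>x. Q x - cmat_scale z (R x))"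
    using absolutely_integrable_linear[OF R_int bounded_linear_cmat_scale, unfolded o_def]
    by (intro prim_integral set_integral_diff Q_int)
  from prim_int[OF prim_Pair[OF prim_integral[OF Pinv_int] this] d] show ?thesis .
qed

lemma SL_iff_block:
  "SL u p (\<lambda>x. z *s u x) \<longleftrightarrow> prim c (\<lambda>x. (u x, p x)) (\<lambda>x. block_mult (sysmat z x) (u x, p x))"
proof
  assume "SL u p (\<lambda>x. z *s u x)"
  then show "prim c (\<lambda>x. (u x, p x)) (\<lambda>x. block_mult (sysmat z x) (u x, p x))"
    unfolding SL_def block_mult_def by (auto dest: prim_Pair simp: mv.diff_left cmat_scale_mult)
next
  assume p: "prim c (\<lambda>x. (u x, p x)) (\<lambda>x. block_mult (sysmat z x) (u x, p x))"
  show "SL u p (\<lambda>x. z *s u x)"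
    using prim_linear[OF bounded_linear_fst p] prim_linear[OF bounded_linear_snd p]
    unfolding SL_def by (simp add: block_mult_def mv.diff_left cmat_scale_mult)
qed

lemma SL_unique:
  assumes "SL u p (\<lambda>x. z *s u x)" "SL v q (\<lambda>x. z *s v x)" "u c = v c" "p c = q c" "x \<ge> c"
  shows "u x = v x" "p x = q x"
proof -
  have "SL (\<lambda>x. u x - v x) (\<lambda>x. p x - q x) (\<lambda>x. z *s (u x - v x))"
    using SL_diff[OF assms(1,2)] by simp
  then have "prim c (\<lambda>x. (u x - v x, p x - q x)) (\<lambda>x. block_mult (sysmat z x) (u x - v x, p x - q x))"
    unfolding SL_iff_block .
  from linear_ode_unique[OF bounded_bilinear_block_mult sysmat_int this _ assms(5)] assms(3,4)
  have "(u x - v x, p x - q x) = 0" by (simp add: zero_prod_def)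
  then show "u x = v x" "p x = q x" by (simp_all add: zero_prod_def)
qed

text \<open>The solution of the first order system as a function of its initial value e = (u c, p
  c), unique on the half-line. Linearity in e reduces questions about solutions to
  finite-dimensional linear algebra.\<close>

definition flow :: "complex \<Rightarrow> (complex^'m) \<times> (complex^'m) \<Rightarrow> real \<Rightarrow> (complex^'m) \<times> (complex^'m)" where
  "flow z e = (SOME y. prim c y (\<lambda>x. block_mult (sysmat z x) (y x)) \<and> y c = e)"

lemma flow: "prim c (flow z e) (\<lambda>x. block_mult (sysmat z x) (flow z e x))" "flow z e c = e"
proof -
  obtain y where "prim c y (\<lambda>x. block_mult (sysmat z x) (y x))" "y c = e"
    using linear_ode_exists[OF bounded_bilinear_block_mult sysmat_int] by blast
  then have "\<exists>y. prim c y (\<lambda>x. block_mult (sysmat z x) (y x)) \<and> y c = e" by blast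
  from someI_ex[OF this] have "prim c (flow z e) (\<lambda>x. block_mult (sysmat z x) (flow z e x)) \<and> flow z e c = e"
    unfolding flow_def .
  then show "prim c (flow z e) (\<lambda>x. block_mult (sysmat z x) (flow z e x))" "flow z e c = e" by auto
qed

abbreviation "fl z e x \<equiv> fst (flow z e x)"

lemma flow_SL: "SL (fl z e) (\<lambda>x. snd (flow z e x)) (\<lambda>x. z *s fl z e x)"
  unfolding SL_iff_block using flow(1)[of z e] by simp

lemma fl_continuous: "continuous_on {c..} (fl z e)"
  by (rule SL_continuous(1)[OF flow_SL])

lemma flow_unique:
  assumes "SL u p (\<lambda>x. z *s u x)" "x \<ge> c"
  shows "flow z (u c, p c) x = (u x, p x)"
  using SL_unique[OF assms(1) flow_SL[of z "(u c, p c)"] _ _ assms(2)] by (simp add: flow(2) prod_eq_iff)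

lemma flow_add: "x \<ge> c \<Longrightarrow> flow z (e + e') x = flow z e x + flow z e' x"
proof -
  assume "x \<ge> c"
  have "SL (\<lambda>x. fl z e x + fl z e' x) (\<lambda>x. snd (flow z e x) + snd (flow z e' x)) (\<lambda>x. z *s (fl z e x + fl z e' x))"
    using SL_add[OF flow_SL[of z e] flow_SL[of z e']] by (simp add: vector_add_ldistrib)
  from flow_unique[OF this \<open>x \<ge> c\<close>] show ?thesis by (simp add: flow(2) prod_eq_iff plus_prod_def)
qed

lemma flow_scaleR: "x \<ge> c \<Longrightarrow> flow z (r *\<^sub>R e) x = r *\<^sub>R flow z e x"
proof -
  assume "x \<ge> c"
  have "r *\<^sub>R (z *s v) = z *s (r *\<^sub>R v)" for v :: "complex^'m" by (simp add: vec_eq_iff)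
  then have "SL (\<lambda>x. r *\<^sub>R fl z e x) (\<lambda>x. r *\<^sub>R snd (flow z e x)) (\<lambda>x. z *s (r *\<^sub>R fl z e x))"
    using SL_scaleR[OF flow_SL[of z e], of r] by simp
  from flow_unique[OF this \<open>x \<ge> c\<close>] show ?thesis by (simp add: flow(2) prod_eq_iff scaleR_prod_def)
qed

text \<open>Where u vanishes on an interval its derivative does too, so p = P u' is zero almost
  everywhere there, and continuity carries this to c.\<close>

lemma vanishing_quasi_deriv:
  assumes u: "SL u p f" and "c < d" and 0: "\<And>x. c \<le> x \<Longrightarrow> x < d \<Longrightarrow> u x = 0"
  shows "p c = 0"
proof -
  have u1: "prim c u (\<lambda>x. matrix_inv (P x) *v p x)" using u by (simp add: SL_def)
  have "AE y in lebesgue_on {c..}. c < y \<and> y < d \<longrightarrow> p y = 0"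
    using prim_hderiv[OF u1] P_pos
  proof eventually_elim
    case (elim y)
    show ?case
    proof
      assume y: "c < y \<and> y < d"
      have "(u has_vector_derivative 0) (at y)"
      proof (rule has_vector_derivative_transform_within_open)
        show "((\<lambda>x. 0::complex^'m) has_vector_derivative 0) (at y)" by (rule has_vector_derivative_const)
        show "0 = u z" if "z \<in> {c<..<d}" for z using 0[of z] that by simp
      qed (use y in auto)
      then have "hderiv c u y = 0" by (rule hderiv_eqI[OF has_vector_derivative_at_within]) (use y in linarith)
      then have "matrix_inv (P y) *v p y = 0" using elim(1) by simp
      then have "P y *v (matrix_inv (P y) *v p y) = 0" by (simp only: mv.zero_right)
      then show "p y = 0" by (simp add: matrix_inv_cancel pos_def_invertible[OF elim(2)])
    qed
  qed
  then show ?thesis by (rule AE_imp_right_limit[OF SL_continuous(2)[OF u] order_refl \<open>c < d\<close>])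
qed

text \<open>Polarisation of the mass as a quadratic form in the initial values; it yields continuity
  and homogeneity in e.\<close>

lemma flow_bilinear:
  assumes "d \<ge> c"
  shows "bounded_bilinear (\<lambda>e e'. integral {c..d} (\<lambda>x. Re (cdot (fl z e x) (R x *v fl z e' x))))"
  unfolding bilinear_conv_bounded_bilinear[symmetric] bilinear_def
proof (intro conjI allI linearI)
  fix e e1 e2 :: "(complex^'m) \<times> (complex^'m)" and r :: real
  have i: "(\<lambda>x. Re (cdot (fl z e x) (R x *v fl z e' x))) integrable_on {c..d}" for e e'
    by (intro Re_form_integrable fl_continuous assms)
  show "integral {c..d} (\<lambda>x. Re (cdot (fl z e x) (R x *v fl z (e1 + e2) x)))
     = integral {c..d} (\<lambda>x. Re (cdot (fl z e x) (R x *v fl z e1 x))) + integral {c..d} (\<lambda>x. Re (cdot (fl z e x) (R x *v fl z e2 x)))"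
    by (subst integral_add[symmetric, OF i i], rule integral_cong) (simp add: flow_add mv.add_right cdot.add_right)
  show "integral {c..d} (\<lambda>x. Re (cdot (fl z (e1 + e2) x) (R x *v fl z e x)))
     = integral {c..d} (\<lambda>x. Re (cdot (fl z e1 x) (R x *v fl z e x))) + integral {c..d} (\<lambda>x. Re (cdot (fl z e2 x) (R x *v fl z e x)))"
    by (subst integral_add[symmetric, OF i i], rule integral_cong) (simp add: flow_add cdot.add_left)
  show "integral {c..d} (\<lambda>x. Re (cdot (fl z e x) (R x *v fl z (r *\<^sub>R e1) x)))
     = r *\<^sub>R integral {c..d} (\<lambda>x. Re (cdot (fl z e x) (R x *v fl z e1 x)))"
    by (subst integral_cmul[symmetric], rule integral_cong) (simp add: flow_scaleR mv.scaleR_right cdot.scaleR_right)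
  show "integral {c..d} (\<lambda>x. Re (cdot (fl z (r *\<^sub>R e1) x) (R x *v fl z e x)))
     = r *\<^sub>R integral {c..d} (\<lambda>x. Re (cdot (fl z e1 x) (R x *v fl z e x)))"
    by (subst integral_cmul[symmetric], rule integral_cong) (simp add: flow_scaleR cdot.scaleR_left)
qed

lemma mass_flow_continuous: "d \<ge> c \<Longrightarrow> continuous_on UNIV (\<lambda>e. mass d (fl z e))"
  using bounded_bilinear.continuous_on[OF flow_bilinear continuous_on_id continuous_on_id] by blast

lemma mass_flow_pos:
  assumes "c < d" "mass d (fl z e) \<le> 0"
  shows "e = 0"
proof -
  have 0: "fl z e x = 0" if "c \<le> x" "x < d" for x
    by (rule mass_zero[OF fl_continuous assms that])
  have "snd (flow z e c) = 0" by (rule vanishing_quasi_deriv[OF flow_SL assms(1) 0])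
  then show ?thesis using 0[of c] \<open>c < d\<close> by (simp add: flow(2) prod_eq_iff)
qed

text \<open>A nonzero initial value has positive mass on [c, d], and the unit sphere of initial
  values is compact. Mass bounds thereby become bounds on initial values.\<close>

lemma mass_flow_coercive:
  assumes "c < d"
  obtains \<kappa> where "\<kappa> > 0" "\<And>e. \<kappa> * (norm e)\<^sup>2 \<le> mass d (fl z e)"
proof -
  have cont: "continuous_on (sphere 0 1) (\<lambda>e. mass d (fl z e))"
    by (rule continuous_on_subset[OF mass_flow_continuous]) (use assms in auto)
  have "sphere (0::(complex^'m) \<times> (complex^'m)) 1 \<noteq> {}" by simp
  then obtain e0 where e0: "e0 \<in> sphere 0 1" "\<And>e. e \<in> sphere 0 1 \<Longrightarrow> mass d (fl z e0) \<le> mass d (fl z e)"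
    using continuous_attains_inf[OF compact_sphere _ cont] by blast
  show ?thesis
  proof
    have "e0 \<noteq> 0" using e0(1) by auto
    then show "mass d (fl z e0) > 0" using mass_flow_pos[OF assms] not_le by blast
    fix e
    show "mass d (fl z e0) * (norm e)\<^sup>2 \<le> mass d (fl z e)"
    proof (cases "e = 0")
      case True
      then show ?thesis using mass_nonneg[OF fl_continuous, of d] assms by simp
    next
      case False
      define e1 where "e1 = (1 / norm e) *\<^sub>R e"
      have e: "e = norm e *\<^sub>R e1" and "norm e1 = 1" using False by (auto simp: e1_def)
      have cd: "c \<le> d" using assms by simp
      interpret b: bounded_bilinear "\<lambda>e e'. integral {c..d} (\<lambda>x. Re (cdot (fl z e x) (R x *v fl z e' x)))"
        by (rule flow_bilinear[OF cd])
      have "mass d (fl z e) = (norm e)\<^sup>2 * mass d (fl z e1)"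
        by (subst (1 2) e) (simp only: b.scaleR_left b.scaleR_right power2_eq_square real_scaleR_def mult.assoc)
      then show ?thesis using mult_right_mono[OF e0(2)[of e1], of "(norm e)\<^sup>2"] \<open>norm e1 = 1\<close>
        by (simp add: mult.commute)
    qed
  qed
qed

text \<open>Uniqueness for the Dirichlet problem implies solvability, since the map from initial
  slope to end value is linear between spaces of equal finite dimension.\<close>

lemma flow_dirichlet:
  assumes "c < b" and inj: "\<And>k. fl z (0, k) b = 0 \<Longrightarrow> k = 0"
  obtains k where "fl z (h, k) b = w"
proof -
  have cb: "b \<ge> c" using assms by simp
  have lin: "linear (\<lambda>k. fl z (0, k) b)"
  proof (rule linearI)
    fix k1 k2 :: "complex^'m" and r :: real
    show "fl z (0, k1 + k2) b = fl z (0, k1) b + fl z (0, k2) b"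
      using flow_add[OF cb, of z "(0,k1)" "(0,k2)"] by simp
    show "fl z (0, r *\<^sub>R k1) b = r *\<^sub>R fl z (0, k1) b"
      using flow_scaleR[OF cb, of z r "(0,k1)"] by simp
  qed
  have "inj (\<lambda>k. fl z (0, k) b)"
    by (subst linear_injective_0[OF lin]) (use inj in blast)
  then have "surj (\<lambda>k. fl z (0, k) b)" using linear_injective_imp_surjective[OF lin] by simp
  from surjD[OF this, of "w - fl z (h, 0) b"] obtain k where k: "fl z (0, k) b = w - fl z (h, 0) b" by auto
  have "fl z (h, k) b = fl z (h, 0) b + fl z (0, k) b" using flow_add[OF cb, of z "(h,0)" "(0,k)"] by simp
  then show ?thesis using k by (intro that[of k]) simp
qed

lemma integral_form_real:
  assumes "continuous_on {c..} u" "d \<ge> c"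
  shows "integral {c..d} (\<lambda>x. cdot (u x) (R x *v u x)) = complex_of_real (mass d u)"
proof -
  obtain N where N: "negligible N" "\<And>x. x \<ge> c \<Longrightarrow> x \<notin> N \<Longrightarrow> pos_def (R x)"
    using R_pos unfolding AE_lebesgue_on_halfline_iff by blast
  have "integral {c..d} (\<lambda>x. cdot (u x) (R x *v u x)) = integral {c..d} (\<lambda>x. complex_of_real (Re (cdot (u x) (R x *v u x))))"
    by (rule integral_spike[OF N(1)])
      (use N(2) cdot_self_adjoint_real[OF pos_def_self_adjoint] in \<open>metis DiffE atLeastAtMost_iff\<close>)
  also have "\<dots> = complex_of_real (mass d u)"
    using integral_linear[OF Re_form_integrable[OF assms(1,1,2)] bounded_linear_of_real] by (simp add: o_def)
  finally show ?thesis .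
qed

text \<open>Lagrange's identity for u with itself: the integrand is the form of R times
  \<open>cnj z - z\<close>, so only Im z is seen.\<close>

lemma mass_identity:
  assumes u: "SL u p (\<lambda>x. z *s u x)" and d: "d \<ge> c"
  shows "Im z * mass d u = Im (cdot (u c) (p c)) - Im (cdot (u d) (p d))"
proof -
  have uc: "continuous_on {c..} u" by (rule SL_continuous(1)[OF u])
  obtain N where N: "negligible N" "\<And>x. x \<ge> c \<Longrightarrow> x \<notin> N \<Longrightarrow> pos_def (R x)"
    using R_pos unfolding AE_lebesgue_on_halfline_iff by blast
  have I: "integral {c..d} (\<lambda>x. cdot (R x *v (z *s u x)) (u x) - cdot (u x) (R x *v (z *s u x)))
    = (cdot (u d) (p d) - cdot (p d) (u d)) - (cdot (u c) (p c) - cdot (p c) (u c))"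
    by (rule integral_unique[OF Lagrange_identity[OF u u d]])
  have "integral {c..d} (\<lambda>x. cdot (R x *v (z *s u x)) (u x) - cdot (u x) (R x *v (z *s u x)))
    = integral {c..d} (\<lambda>x. (cnj z - z) * cdot (u x) (R x *v u x))"
  proof (rule integral_spike[OF N(1)])
    fix x assume "x \<in> {c..d} - N"
    then have "self_adjoint (R x)" using N(2) by (intro pos_def_self_adjoint) auto
    then show "(cnj z - z) * cdot (u x) (R x *v u x) = cdot (R x *v (z *s u x)) (u x) - cdot (u x) (R x *v (z *s u x))"
      by (simp add: matrix_vector_scalar cdot_vector_scalar_left cdot_vector_scalar_right cdot_self_adjoint algebra_simps)
  qed
  also have "\<dots> = (cnj z - z) * complex_of_real (mass d u)"
    by (simp add: integral_form_real[OF uc d])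
  finally have "Im ((cnj z - z) * complex_of_real (mass d u)) = Im ((cdot (u d) (p d) - cdot (p d) (u d)) - (cdot (u c) (p c) - cdot (p c) (u c)))"
    using I by simp
  moreover have "Im (cdot (p x) (u x)) = - Im (cdot (u x) (p x))" for x
    using cdot_commute[of "p x" "u x"] by simp
  ultimately show ?thesis by simp
qed

lemma compact_subsequence:
  fixes k :: "nat \<Rightarrow> 'a::euclidean_space"
  assumes "\<And>n. norm (k n) \<le> B"
  obtains l r where "strict_mono (r :: nat \<Rightarrow> nat)" "(\<lambda>n. k (r n)) \<longlonglongrightarrow> l"
proof -
  have "\<forall>n. k n \<in> cball 0 B" using assms by simp
  then show ?thesis using compact_cball[of 0 B] unfolding compact_def o_def using that by blast
qed

text \<open>For fixed d almost all intervals [c, b (r n)] contain [c, d], and the mass is continuous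
  in the initial value. As K does not depend on d, the limit solution is square integrable.\<close>

lemma mass_flow_limit_bound:
  assumes k: "(\<lambda>n. k (r n)) \<longlonglongrightarrow> l" and r: "strict_mono (r :: nat \<Rightarrow> nat)"
    and b: "\<And>n. b n \<ge> c + real n" and bd: "\<And>n. mass (b n) (fl z (k n)) \<le> K" and d: "d \<ge> c"
  shows "mass d (fl z l) \<le> K"
proof (rule LIMSEQ_le_const2)
  show "(\<lambda>n. mass d (fl z (k (r n)))) \<longlonglongrightarrow> mass d (fl z l)"
    by (rule continuous_on_tendsto_compose[OF mass_flow_continuous[OF d] k]) auto
  obtain n0 where n0: "d - c \<le> real n0" using real_arch_simple by blast
  show "\<exists>N. \<forall>n\<ge>N. mass d (fl z (k (r n))) \<le> K"
  proof (intro exI[of _ n0] allI impI)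
    fix n assume "n \<ge> n0"
    then have "real n0 \<le> real (r n)" using seq_suble[OF r, of n] by simp
    then have "d \<le> b (r n)" using n0 b[of "r n"] by linarith
    then show "mass d (fl z (k (r n))) \<le> K"
      using mass_mono[OF fl_continuous d] bd[of "r n"] order_trans by blast
  qed
qed

text \<open>Solutions with \<open>u c = h\<close> and \<open>u (b n) = 0\<close> have \<open>\<bar>Im z\<bar> * mass (b n) u \<le> norm h * norm (p c)\<close>; with coercivity
  this bounds \<open>p c\<close>, and a limit point of these initial values gives the solution.\<close>

lemma Weyl_solution:
  assumes "Im z \<noteq> 0"
  obtains u p K where "SL u p (\<lambda>x. z *s u x)" "u c = h" "\<And>d. d \<ge> c \<Longrightarrow> mass d u \<le> K"
proof -
  \<comment> \<open>For non-real z uniqueness needs no lower bound: both boundary terms of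
    \<open>mass_identity\<close> vanish.\<close>
  have inj: "k = 0" if "c < b" "fl z (0, k) b = 0" for k b
  proof -
    have "Im z * mass b (fl z (0, k)) = 0"
      using mass_identity[OF flow_SL, of b z "(0,k)"] that by (simp add: flow(2) cdot.zero_left)
    then have "mass b (fl z (0, k)) \<le> 0" using assms by simp
    from mass_flow_pos[OF that(1) this] show ?thesis by (simp add: prod_eq_iff)
  qed
  \<comment> \<open>The extra 1 keeps [c, c + 1], where coercivity is used, inside every
    [c, b n].\<close>
  define b where "b n = c + 1 + real n" for n
  have "\<exists>k. fl z (h, k) (b n) = 0" for n
  proof -
    have "c < b n" by (simp add: b_def)
    from flow_dirichlet[OF this inj[OF this], of z h 0] show ?thesis by blast
  qed
  then obtain k where k: "\<And>n. fl z (h, k n) (b n) = 0" by metis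
  have cb: "b n \<ge> c" for n by (simp add: b_def)
  have m: "mass (b n) (fl z (h, k n)) \<le> norm h * norm (k n) / \<bar>Im z\<bar>" for n
  proof -
    have "Im z * mass (b n) (fl z (h, k n)) = Im (cdot h (k n))"
      using mass_identity[OF flow_SL cb[of n], of z "(h, k n)"] k[of n] by (simp add: flow(2) cdot.zero_left)
    then have "\<bar>Im z\<bar> * \<bar>mass (b n) (fl z (h, k n))\<bar> = \<bar>Im (cdot h (k n))\<bar>"
      by (simp only: abs_mult[symmetric])
    then have "\<bar>Im z\<bar> * mass (b n) (fl z (h, k n)) = \<bar>Im (cdot h (k n))\<bar>"
      by (simp only: abs_of_nonneg[OF mass_nonneg[OF fl_continuous cb]])
    also have "\<dots> \<le> norm h * norm (k n)"
      by (rule order_trans[OF abs_Im_le_cmod norm_cdot_le])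
    finally show ?thesis using assms by (simp add: field_simps)
  qed
  have c1: "c < c + 1" by simp
  obtain \<kappa> where "\<kappa> > 0" and \<kappa>: "\<And>e. \<kappa> * (norm e)\<^sup>2 \<le> mass (c + 1) (fl z e)"
    using mass_flow_coercive[OF c1] by blast
  define B where "B = norm h / (\<kappa> * \<bar>Im z\<bar>)"
  have kB: "norm (k n) \<le> B" for n
  proof (cases "k n = 0")
    case True
    then show ?thesis using \<open>\<kappa> > 0\<close> by (simp add: B_def)
  next
    \<comment> \<open>Coercivity is quadratic in \<open>k n\<close> while the mass bound is linear,
      so one factor \<open>norm (k n)\<close> can be cancelled.\<close>
    case False
    have "\<kappa> * (norm (k n))\<^sup>2 \<le> \<kappa> * (norm (h, k n))\<^sup>2"
      using \<open>\<kappa> > 0\<close> by (intro mult_left_mono) (auto simp: norm_Pair)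
    also have "\<dots> \<le> mass (c + 1) (fl z (h, k n))" by (rule \<kappa>)
    also have "\<dots> \<le> mass (b n) (fl z (h, k n))" by (intro mass_mono fl_continuous) (auto simp: b_def)
    also have "\<dots> \<le> norm h * norm (k n) / \<bar>Im z\<bar>" by (rule m)
    finally have "norm (k n) * (\<kappa> * norm (k n)) \<le> norm (k n) * (norm h / \<bar>Im z\<bar>)"
      by (simp add: power2_eq_square mult_ac)
    then have "\<kappa> * norm (k n) \<le> norm h / \<bar>Im z\<bar>" by (rule mult_left_le_imp_le) (use False in simp)
    then have "norm (k n) \<le> norm h / \<bar>Im z\<bar> / \<kappa>"
      using \<open>\<kappa> > 0\<close> by (simp only: pos_le_divide_eq mult.commute)
    then show ?thesis by (simp add: B_def mult.commute)
  qed
  obtain l r where r: "strict_mono (r :: nat \<Rightarrow> nat)" "(\<lambda>n. k (r n)) \<longlonglongrightarrow> l"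
    using compact_subsequence[of k B, OF kB] by metis
  define K where "K = norm h * B / \<bar>Im z\<bar>"
  have mK: "mass (b n) (fl z (h, k n)) \<le> K" for n
    by (rule order_trans[OF m]) (auto simp: K_def intro!: divide_right_mono mult_left_mono kB)
  have "(\<lambda>n. (h, k (r n))) \<longlonglongrightarrow> (h, l)" by (intro tendsto_Pair tendsto_const r)
  then have "mass d (fl z (h, l)) \<le> K" if "d \<ge> c" for d
    by (rule mass_flow_limit_bound[OF _ r(1) _ mK that]) (simp add: b_def)
  then show ?thesis by (rule that[OF flow_SL, rotated]) (simp_all add: flow(2))
qed

end

section \<open>The limit point case\<close>

context sturm_liouville
begin

lemma mass_uminus: "mass d (\<lambda>x. - u x) = mass d u"
  by (simp add: mv.minus_right cdot.minus_left cdot.minus_right)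

lemma mass_diff_le:
  assumes "continuous_on {c..} u" "continuous_on {c..} v" "d \<ge> c"
  shows "mass d (\<lambda>x. u x - v x) \<le> 2 * mass d u + 2 * mass d v"
  using mass_add_le[OF assms(1) continuous_on_minus[OF assms(2)] assms(3)] by (simp add: mass_uminus)

end

locale limit_point_growth = semibounded +
  fixes C \<rho>0 :: real
  assumes growth: "\<And>\<rho>. \<rho> \<ge> \<rho>0 \<Longrightarrow> AE x in lebesgue_on {c..}. \<rho>/2 \<le> x \<and> x \<le> \<rho> \<longrightarrow>
      op_norm (mat_inv_sqrt (R x) ** P x ** mat_inv_sqrt (R x)) \<le> C * \<rho>\<^sup>2"
begin

text \<open>Supplies right end points for \<open>Dirichlet_lower_bound\<close>, which asks for
  positive definiteness at the point b itself.\<close>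

lemma ex_P_pos: "\<exists>b. c + 1 + real n < b \<and> pos_def (P b)"
proof -
  obtain N where N: "negligible N" "\<And>x. x \<ge> c \<Longrightarrow> x \<notin> N \<Longrightarrow> pos_def (P x)"
    using P_pos unfolding AE_lebesgue_on_halfline_iff by blast
  have "\<not> negligible {c + 1 + real n<..<c + 2 + real n}" by (intro open_not_negligible) auto
  then obtain b where "b \<in> {c + 1 + real n<..<c + 2 + real n}" "b \<notin> N" using N(1) negligible_subset by blast
  then show ?thesis using N(2)[of b] by (intro exI[of _ b]) auto
qed

text \<open>On \<open>[c, b n]\<close>, \<open>v n = u - w n\<close> is the solution of the Dirichlet problem with \<open>(L - \<mu>) v = (z - \<mu>) u\<close>.\<close>

lemma Dirichlet_L2_solution_zero:
  assumes u: "SL u p (\<lambda>x. z *s u x)" and "Im z \<noteq> 0" and u0: "u c = 0"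
    and K: "\<And>d. d \<ge> c \<Longrightarrow> mass d u \<le> K" and x: "x \<ge> c"
  shows "u x = 0"
proof -
  \<comment> \<open>A point below \<gamma>; the gap 1 lets the factor \<gamma> - \<mu> disappear
    from the estimates.\<close>
  define \<mu> where "\<mu> = \<gamma> - 1"
  let ?m = "complex_of_real \<mu>"
  have uc: "continuous_on {c..} u" by (rule SL_continuous(1)[OF u])
  obtain b where b: "\<And>n. c + 1 + real n < b n" "\<And>n. pos_def (P (b n))" using ex_P_pos by metis
  have cb: "c < b n" "c \<le> b n" "c + 1 \<le> b n" "b n \<ge> c + real n" for n using b(1)[of n] by auto
  \<comment> \<open>Uniqueness of the Dirichlet problem at \<mu>: the lower bound gives \<gamma>
    times the mass at most \<mu> times the mass.\<close>
  have inj: "k = 0" if "c < d" "pos_def (P d)" "fl ?m (0, k) d = 0" for k d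
  proof -
    have "\<gamma> * mass d (fl ?m (0, k)) \<le> integral {c..d} (\<lambda>x. Re (cdot (fl ?m (0, k) x) (R x *v (?m *s fl ?m (0, k) x))))"
      by (rule Dirichlet_lower_bound[OF flow_SL _ _ that(3,1,2)])
        (auto simp: flow(2) intro: bounded_linear.continuous_on[OF bounded_linear_vector_scalar fl_continuous])
    also have "\<dots> = \<mu> * mass d (fl ?m (0, k))"
      by (simp add: matrix_vector_scalar cdot_vector_scalar_right)
    finally have "mass d (fl ?m (0, k)) \<le> 0" by (simp add: \<mu>_def algebra_simps)
    from mass_flow_pos[OF that(1) this] show ?thesis by (simp add: prod_eq_iff)
  qed
  have "\<exists>k. fl ?m (0, k) (b n) = u (b n)" for n
    using flow_dirichlet[OF cb(1)[of n] inj[OF cb(1)[of n] b(2)[of n]], where h=0 and w="u (b n)"] by blast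
  then obtain k where k: "\<And>n. fl ?m (0, k n) (b n) = u (b n)" by metis
  let ?w = "\<lambda>n. fl ?m (0, k n)"
  have wc: "continuous_on {c..} (?w n)" for n by (rule fl_continuous)
  define v where "v n x = u x - ?w n x" for n x
  have vc: "continuous_on {c..} (v n)" for n unfolding v_def[abs_def] by (intro continuous_intros uc wc)
  define f where "f n x = z *s u x - ?m *s ?w n x" for n x
  \<comment> \<open>The source in the equation for v n: L (v n) = \<mu> v n + \<zeta> u, and \<zeta>
    keeps the imaginary part of z.\<close>
  define \<zeta> where "\<zeta> = z - ?m"
  have \<zeta>: "norm \<zeta> > 0" "Im \<zeta> = Im z" using \<open>Im z \<noteq> 0\<close> by (auto simp: \<zeta>_def complex_eq_iff)
  have f: "f n x = ?m *s v n x + \<zeta> *s u x" for n x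
    by (simp add: f_def v_def \<zeta>_def vec_eq_iff algebra_simps)
  have fc: "continuous_on {c..} (f n)" for n
    unfolding f_def[abs_def] by (intro continuous_on_diff bounded_linear.continuous_on[OF bounded_linear_vector_scalar] uc wc)
  have v: "SL (v n) (\<lambda>x. p x - snd (flow ?m (0, k n) x)) (f n)" for n
    unfolding v_def[abs_def] f_def[abs_def] by (rule SL_diff[OF u flow_SL])
  have v0: "v n c = 0" and vb: "v n (b n) = 0" for n
    using k[of n] by (auto simp: v_def u0 flow(2))
  let ?I = "\<lambda>n. integral {c..b n} (\<lambda>x. cdot (v n x) (R x *v u x))"
  have Ii: "(\<lambda>x. cdot (v n x) (R x *v u x)) integrable_on {c..b n}" for n
    by (rule set_lebesgue_integral_eq_integral(1)[OF form_int[OF vc uc cb(2)]])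
  have vi: "(\<lambda>x. cdot (v n x) (R x *v v n x)) integrable_on {c..b n}" for n
    by (rule set_lebesgue_integral_eq_integral(1)[OF form_int[OF vc vc cb(2)]])
  have If: "integral {c..b n} (\<lambda>x. cdot (v n x) (R x *v f n x)) = ?m * complex_of_real (mass (b n) (v n)) + \<zeta> * ?I n" for n
  proof -
    have "integral {c..b n} (\<lambda>x. cdot (v n x) (R x *v f n x))
      = integral {c..b n} (\<lambda>x. ?m * cdot (v n x) (R x *v v n x) + \<zeta> * cdot (v n x) (R x *v u x))"
      by (simp add: f mv.add_right matrix_vector_scalar cdot.add_right cdot_vector_scalar_right)
    also have "\<dots> = ?m * integral {c..b n} (\<lambda>x. cdot (v n x) (R x *v v n x)) + \<zeta> * ?I n"
      using vi Ii by (subst integral_add) (auto intro!: integrable_on_mult_right)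
    finally show ?thesis by (simp only: integral_form_real[OF vc cb(2)])
  qed
  have fi: "(\<lambda>x. cdot (v n x) (R x *v f n x)) integrable_on {c..b n}" for n
    by (rule set_lebesgue_integral_eq_integral(1)[OF form_int[OF vc fc cb(2)]])
  have Re_f: "integral {c..b n} (\<lambda>x. Re (cdot (v n x) (R x *v f n x))) = \<mu> * mass (b n) (v n) + Re (\<zeta> * ?I n)" for n
    using integral_linear[OF fi bounded_linear_Re, of n] by (simp add: o_def If)
  have mv_bound: "mass (b n) (v n) \<le> (norm \<zeta>)\<^sup>2 * K" for n
  proof -
    have "\<gamma> * mass (b n) (v n) \<le> \<mu> * mass (b n) (v n) + Re (\<zeta> * ?I n)"
      using Dirichlet_lower_bound[OF v fc v0 vb cb(1) b(2), of n] unfolding Re_f .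
    then have "mass (b n) (v n) \<le> Re (\<zeta> * ?I n)" by (simp add: \<mu>_def algebra_simps)
    also have "\<dots> \<le> norm (\<zeta> * ?I n)" by (rule complex_Re_le_cmod)
    also have "\<dots> = norm \<zeta> * norm (?I n)" by (rule norm_mult)
    finally have 1: "mass (b n) (v n) \<le> norm \<zeta> * norm (?I n)" .
    \<comment> \<open>The weight 1/|\<zeta>| is chosen so that, after multiplication by |\<zeta>|,
      the mass of v n enters with factor 1 and is absorbed by twice the estimate just shown.\<close>
    have "2 * norm (?I n) \<le> (1 / norm \<zeta>) * mass (b n) (v n) + mass (b n) u / (1 / norm \<zeta>)"
      by (rule mass_young[OF uc vc order_refl cb(2)]) (use \<zeta> in auto)
    then have "norm \<zeta> * (2 * norm (?I n)) \<le> norm \<zeta> * ((1 / norm \<zeta>) * mass (b n) (v n) + mass (b n) u / (1 / norm \<zeta>))"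
      by (rule mult_left_mono) simp
    also have "\<dots> = mass (b n) (v n) + (norm \<zeta>)\<^sup>2 * mass (b n) u"
      using \<zeta>(1) by (simp add: distrib_left power2_eq_square)
    also have "\<dots> \<le> mass (b n) (v n) + (norm \<zeta>)\<^sup>2 * K"
      by (intro add_left_mono mult_left_mono K cb(2)) auto
    finally show ?thesis using 1 by simp
  qed
  define K2 where "K2 = 2 * K + 2 * ((norm \<zeta>)\<^sup>2 * K)"
  have mw_bound: "mass (b n) (?w n) \<le> K2" for n
  proof -
    have "?w n x = u x - v n x" for x by (simp add: v_def)
    then have "mass (b n) (?w n) = mass (b n) (\<lambda>x. u x - v n x)" by (simp only:)
    also have "\<dots> \<le> 2 * mass (b n) u + 2 * mass (b n) (v n)" by (rule mass_diff_le[OF uc vc cb(2)])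
    also have "\<dots> \<le> K2" unfolding K2_def by (intro add_mono mult_left_mono K mv_bound cb(2)) auto
    finally show ?thesis .
  qed
  have c1: "c < c + 1" by simp
  obtain \<kappa> where "\<kappa> > 0" and \<kappa>: "\<And>e. \<kappa> * (norm e)\<^sup>2 \<le> mass (c + 1) (fl ?m e)"
    using mass_flow_coercive[OF c1] by blast
  have kB: "norm (k n) \<le> sqrt (K2 / \<kappa>)" for n
  proof (rule real_le_rsqrt)
    have "\<kappa> * (norm (0::complex^'a, k n))\<^sup>2 \<le> mass (c + 1) (?w n)" by (rule \<kappa>)
    also have "\<dots> \<le> mass (b n) (?w n)" by (rule mass_mono[OF wc _ cb(3)]) simp
    also have "\<dots> \<le> K2" by (rule mw_bound)
    finally show "(norm (k n))\<^sup>2 \<le> K2 / \<kappa>" using \<open>\<kappa> > 0\<close> by (simp add: norm_Pair pos_le_divide_eq mult.commute)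
  qed
  obtain l r where r: "strict_mono (r :: nat \<Rightarrow> nat)" "(\<lambda>n. k (r n)) \<longlonglongrightarrow> l"
    using compact_subsequence[of k "sqrt (K2 / \<kappa>)", OF kB] by metis
  have kl: "(\<lambda>n. (0::complex^'a, k (r n))) \<longlonglongrightarrow> (0, l)" by (intro tendsto_Pair tendsto_const r)
  have ml: "mass d (fl ?m (0, l)) \<le> K2" if "d \<ge> c" for d
    by (rule mass_flow_limit_bound[OF kl r(1) cb(4) mw_bound that])
  \<comment> \<open>The limit of the w n is square integrable, vanishes at c and solves the equation
    at \<mu> < \<gamma>, so the cutoff argument annihilates it.\<close>
  have "fl ?m (0, l) x = 0" if "x \<ge> c" for x
    by (rule Povzner_Wienholtz[OF flow_SL _ _ ml growth that]) (auto simp: flow(2) \<mu>_def)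
  then have "snd (flow ?m (0, l) c) = 0" by (intro vanishing_quasi_deriv[OF flow_SL c1]) auto
  then have l0: "l = 0" by (simp add: flow(2))
  have w_lim: "(\<lambda>n. mass d (?w (r n))) \<longlonglongrightarrow> 0" if d: "d \<ge> c" for d
  proof -
    have "(\<lambda>n. mass d (?w (r n))) \<longlonglongrightarrow> mass d (fl ?m (0, l))"
      by (rule continuous_on_tendsto_compose[OF mass_flow_continuous[OF d] kl]) auto
    moreover have "mass d (fl ?m (0, l)) = 0"
    proof -
      have "mass d (fl ?m (0, l)) = integral {c..d} (\<lambda>x. 0)"
        using \<open>\<And>x. x \<ge> c \<Longrightarrow> fl ?m (0, l) x = 0\<close> by (intro integral_cong) (auto simp: cdot.zero_left)
      then show ?thesis by simp
    qed
    ultimately show ?thesis by simp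
  qed
  let ?W = "\<lambda>n. integral {c..b n} (\<lambda>x. cdot (?w n x) (R x *v u x))"
  have I_eq: "?I n = complex_of_real (mass (b n) u) - ?W n" for n
  proof -
    have i1: "(\<lambda>x. cdot (u x) (R x *v u x)) integrable_on {c..b n}" "(\<lambda>x. cdot (?w n x) (R x *v u x)) integrable_on {c..b n}"
      by (rule set_lebesgue_integral_eq_integral(1)[OF form_int[OF _ uc cb(2)]]; rule uc wc)+
    show ?thesis using integral_diff[OF i1] by (simp add: v_def cdot.diff_left integral_form_real[OF uc cb(2)])
  qed
  \<comment> \<open>The boundary terms of Lagrange's identity vanish because v n is zero at both
    ends.\<close>
  have Im_f: "Im (integral {c..b n} (\<lambda>x. cdot (v n x) (R x *v f n x))) = 0" for n
  proof -
    have H: "((\<lambda>x. cdot (R x *v f n x) (v n x) - cdot (v n x) (R x *v f n x)) has_integral 0) {c..b n}"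
      using Lagrange_identity[OF v[of n] v[of n] cb(2)[of n]] by (simp add: v0 vb cdot.zero_left cdot.zero_right)
    have "((\<lambda>x. Im (cdot (R x *v f n x) (v n x) - cdot (v n x) (R x *v f n x))) has_integral 0) {c..b n}"
      using has_integral_linear[OF H bounded_linear_Im] by (simp add: o_def)
    moreover have "Im (cdot (R x *v f n x) (v n x) - cdot (v n x) (R x *v f n x)) = - 2 * Im (cdot (v n x) (R x *v f n x))" for x
      using cdot_commute[of "R x *v f n x" "v n x"] by simp
    ultimately have "((\<lambda>x. - 2 * Im (cdot (v n x) (R x *v f n x))) has_integral 0) {c..b n}" by (simp only:)
    moreover have "((\<lambda>x. - 2 * Im (cdot (v n x) (R x *v f n x))) has_integral - 2 * Im (integral {c..b n} (\<lambda>x. cdot (v n x) (R x *v f n x)))) {c..b n}"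
      using has_integral_mult_right[OF has_integral_linear[OF integrable_integral[OF fi[of n]] bounded_linear_Im], of "-2"] by (simp add: o_def)
    ultimately have "0 = - 2 * Im (integral {c..b n} (\<lambda>x. cdot (v n x) (R x *v f n x)))"
      by (rule has_integral_unique)
    then show ?thesis by simp
  qed
  \<comment> \<open>Since \<mu> times the mass of v n is real, symmetry leaves Im (\<zeta> (v n, u))
    = 0; inserting v n = u - w n isolates the mass of u.\<close>
  have key: "\<bar>Im z\<bar> * mass (b n) u \<le> norm \<zeta> * norm (?W n)" for n
  proof -
    have "Im (\<zeta> * ?I n) = 0" using Im_f[of n] unfolding If by simp
    then have "Im z * mass (b n) u = Im (\<zeta> * ?W n)" unfolding I_eq using \<zeta>(2) by (simp add: algebra_simps)
    then have "\<bar>Im z\<bar> * \<bar>mass (b n) u\<bar> = \<bar>Im (\<zeta> * ?W n)\<bar>" by (simp only: abs_mult[symmetric])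
    also have "\<dots> \<le> norm (\<zeta> * ?W n)" by (rule abs_Im_le_cmod)
    finally show ?thesis by (simp only: abs_of_nonneg[OF mass_nonneg[OF uc cb(2)]] norm_mult)
  qed
  have K20: "K2 \<ge> 0" using order_trans[OF mass_nonneg[OF wc cb(2)] mw_bound] .
  have K0: "K \<ge> 0" using order_trans[OF mass_nonneg[OF uc order_refl] K[OF order_refl]] .
  \<comment> \<open>The pairing of w n with u is split at \<beta>: on [c, \<beta>] w n is small
    because it converges to 0, and beyond \<beta> u is small because its total mass is finite.
    Neither factor alone is small on all of [c, b n].\<close>
  have small: "\<bar>Im z\<bar> * mass d u \<le> \<epsilon> * (norm \<zeta> * (2 + K + K2))" if d: "d \<ge> c" and "\<epsilon> > 0" for d \<epsilon>
  proof -
    have bdd: "bdd_above ((\<lambda>d. mass d u) ` {c..})" using K by (intro bdd_aboveI2[of _ _ K]) auto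
    define L where "L = (SUP d\<in>{c..}. mass d u)"
    have Lu: "mass y u \<le> L" if "y \<ge> c" for y unfolding L_def by (rule cSUP_upper[OF _ bdd]) (use that in simp)
    have "L - \<epsilon>\<^sup>2 < L" using \<open>\<epsilon> > 0\<close> by simp
    then obtain \<beta>0 where \<beta>0: "\<beta>0 \<ge> c" "L - \<epsilon>\<^sup>2 < mass \<beta>0 u"
      unfolding L_def using less_cSUP_iff[OF _ bdd] by auto
    define \<beta> where "\<beta> = max \<beta>0 d"
    have \<beta>: "\<beta> \<ge> c" "d \<le> \<beta>" "L - \<epsilon>\<^sup>2 < mass \<beta> u"
      using \<beta>0 mass_mono[OF uc \<beta>0(1), of \<beta>] d by (auto simp: \<beta>_def)
    have "eventually (\<lambda>n. mass \<beta> (?w (r n)) < \<epsilon>\<^sup>2) sequentially"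
      using w_lim[OF \<beta>(1)] \<open>\<epsilon> > 0\<close> by (intro order_tendstoD) auto
    then obtain n0 where n0: "\<And>n. n \<ge> n0 \<Longrightarrow> mass \<beta> (?w (r n)) < \<epsilon>\<^sup>2" unfolding eventually_sequentially by blast
    obtain n1 where n1: "\<beta> - c \<le> real n1" using real_arch_simple by blast
    define n where "n = r (max n0 n1)"
    have wn: "mass \<beta> (?w n) < \<epsilon>\<^sup>2" unfolding n_def by (rule n0) simp
    have "real n1 \<le> real n" unfolding n_def using seq_suble[OF r(1), of "max n0 n1"] by simp
    then have \<beta>b: "\<beta> \<le> b n" using n1 cb(4)[of n] by linarith
    let ?g = "\<lambda>x. cdot (?w n x) (R x *v u x)"
    have gi: "?g integrable_on {c..b n}" by (rule set_lebesgue_integral_eq_integral(1)[OF form_int[OF wc uc cb(2)]])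
    have W: "?W n = integral {c..\<beta>} ?g + integral {\<beta>..b n} ?g"
      by (rule Henstock_Kurzweil_Integration.integral_combine[symmetric]) (use \<beta>(1) \<beta>b gi in auto)
    have split: "integral {\<beta>..b n} (\<lambda>x. Re (cdot (y x) (R x *v y x))) = mass (b n) y - mass \<beta> y" if "continuous_on {c..} y" for y
    proof -
      have "mass \<beta> y + integral {\<beta>..b n} (\<lambda>x. Re (cdot (y x) (R x *v y x))) = mass (b n) y"
        by (rule Henstock_Kurzweil_Integration.integral_combine[OF \<beta>(1) \<beta>b Re_form_integrable[OF that that cb(2)]])
      then show ?thesis by linarith
    qed
    \<comment> \<open>The mass of w n is below \<epsilon>^2 here, so weight 1/\<epsilon> makes both
      terms of order \<epsilon>; on the tail the roles are exchanged and the weight is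
      \<epsilon>.\<close>
    have "2 * norm (integral {c..\<beta>} ?g) \<le> (1 / \<epsilon>) * mass \<beta> (?w n) + mass \<beta> u / (1 / \<epsilon>)"
      by (rule mass_young[OF uc wc order_refl \<beta>(1)]) (use \<open>\<epsilon> > 0\<close> in simp)
    also have "\<dots> \<le> (1 / \<epsilon>) * \<epsilon>\<^sup>2 + K / (1 / \<epsilon>)"
      by (rule add_mono[OF mult_left_mono divide_right_mono]) (use wn K[OF \<beta>(1)] \<open>\<epsilon> > 0\<close> in auto)
    also have "\<dots> = \<epsilon> + \<epsilon> * K" using \<open>\<epsilon> > 0\<close> by (simp add: power2_eq_square)
    finally have 1: "2 * norm (integral {c..\<beta>} ?g) \<le> \<epsilon> + \<epsilon> * K" .
    have "2 * norm (integral {\<beta>..b n} ?g) \<le> \<epsilon> * (mass (b n) (?w n) - mass \<beta> (?w n)) + (mass (b n) u - mass \<beta> u) / \<epsilon>"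
      using mass_young[OF uc wc \<beta>(1) \<beta>b \<open>\<epsilon> > 0\<close>] by (simp only: split[OF wc] split[OF uc])
    also have "\<dots> \<le> \<epsilon> * K2 + \<epsilon>\<^sup>2 / \<epsilon>"
    proof (rule add_mono[OF mult_left_mono divide_right_mono])
      show "mass (b n) (?w n) - mass \<beta> (?w n) \<le> K2" using mw_bound[of n] mass_nonneg[OF wc \<beta>(1), of n] by linarith
      show "mass (b n) u - mass \<beta> u \<le> \<epsilon>\<^sup>2" using Lu[OF cb(2)[of n]] \<beta>(3) by linarith
    qed (use \<open>\<epsilon> > 0\<close> in auto)
    also have "\<dots> = \<epsilon> * K2 + \<epsilon>" using \<open>\<epsilon> > 0\<close> by (simp add: power2_eq_square)
    finally have 2: "2 * norm (integral {\<beta>..b n} ?g) \<le> \<epsilon> * K2 + \<epsilon>" .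
    have "norm (?W n) \<le> norm (integral {c..\<beta>} ?g) + norm (integral {\<beta>..b n} ?g)"
      unfolding W by (rule norm_triangle_ineq)
    also have "\<dots> \<le> \<epsilon> * (2 + K + K2)"
    proof -
      have "0 \<le> \<epsilon> * K" "0 \<le> \<epsilon> * K2" using K0 K20 \<open>\<epsilon> > 0\<close> by simp_all
      then show ?thesis using 1 2 \<open>\<epsilon> > 0\<close> unfolding distrib_left by linarith
    qed
    finally have 3: "norm (?W n) \<le> \<epsilon> * (2 + K + K2)" .
    have "mass d u \<le> mass (b n) u" by (rule mass_mono[OF uc d]) (use \<beta>(2) \<beta>b in simp)
    then have "\<bar>Im z\<bar> * mass d u \<le> \<bar>Im z\<bar> * mass (b n) u" by (rule mult_left_mono) simp
    also have "\<dots> \<le> norm \<zeta> * norm (?W n)" by (rule key)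
    also have "\<dots> \<le> norm \<zeta> * (\<epsilon> * (2 + K + K2))" by (intro mult_left_mono 3) simp
    finally show ?thesis by (simp add: mult_ac)
  qed
  have "\<bar>Im z\<bar> * mass (x + 1) u \<le> 0"
  proof (rule field_le_epsilon)
    fix e :: real assume "e > 0"
    define D where "D = norm \<zeta> * (2 + K + K2)"
    have "D > 0" using \<zeta>(1) K0 K20 by (simp add: D_def)
    have "\<bar>Im z\<bar> * mass (x + 1) u \<le> (e / D) * D"
      unfolding D_def by (rule small) (use x \<open>e > 0\<close> \<open>D > 0\<close> in \<open>auto simp: D_def\<close>)
    then show "\<bar>Im z\<bar> * mass (x + 1) u \<le> 0 + e" using \<open>D > 0\<close> by simp
  qed
  then have "mass (x + 1) u \<le> 0" using \<open>Im z \<noteq> 0\<close> by (simp add: mult_le_0_iff)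
  then show ?thesis by (intro mass_zero[OF uc _ _ x, of "x + 1"]) (use x in auto)
qed

section \<open>Dimension of the space of square integrable solutions\<close>

lemma L2_solutions_iff:
  "u \<in> L2_solutions c P Q R z \<longleftrightarrow>
    (\<exists>p. SL u p (\<lambda>x. z *s u x)) \<and> (\<exists>K. \<forall>d\<ge>c. mass d u \<le> K) \<and> (\<forall>x<c. u x = 0)"
proof
  assume "u \<in> L2_solutions c P Q R z"
  then have u: "u \<in> L_admissible c P" "AE x in lebesgue_on {c..}. L_expr c P Q R u x = z *s u x"
    "u \<in> L2_space c R" "\<forall>x<c. u x = 0" by (auto simp: L2_solutions_def)
  have SL: "SL u (quasi_deriv c P u) (\<lambda>x. z *s u x)" by (rule admissible_imp_SL[OF u(1,2)])
  moreover obtain K where "\<And>d. d \<ge> c \<Longrightarrow> mass d u \<le> K" using L2_bound[OF SL_continuous(1)[OF SL] u(3)] by blast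
  ultimately show "(\<exists>p. SL u p (\<lambda>x. z *s u x)) \<and> (\<exists>K. \<forall>d\<ge>c. mass d u \<le> K) \<and> (\<forall>x<c. u x = 0)"
    using u(4) by blast
next
  assume "(\<exists>p. SL u p (\<lambda>x. z *s u x)) \<and> (\<exists>K. \<forall>d\<ge>c. mass d u \<le> K) \<and> (\<forall>x<c. u x = 0)"
  then obtain p K where SL: "SL u p (\<lambda>x. z *s u x)" and K: "\<And>d. d \<ge> c \<Longrightarrow> mass d u \<le> K" and "\<forall>x<c. u x = 0" by blast
  then show "u \<in> L2_solutions c P Q R z"
    unfolding L2_solutions_def
    using SL_imp_admissible[OF SL] L2_spaceI[OF SL_continuous(1)[OF SL] K] by blast
qed

lemma L2_solutions_add:
  assumes "u \<in> L2_solutions c P Q R z" "v \<in> L2_solutions c P Q R z"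
  shows "u + v \<in> L2_solutions c P Q R z"
proof -
  obtain p q K1 K2 where u: "SL u p (\<lambda>x. z *s u x)" "\<And>d. d \<ge> c \<Longrightarrow> mass d u \<le> K1" "\<And>x. x < c \<Longrightarrow> u x = 0"
    and v: "SL v q (\<lambda>x. z *s v x)" "\<And>d. d \<ge> c \<Longrightarrow> mass d v \<le> K2" "\<And>x. x < c \<Longrightarrow> v x = 0"
    using assms unfolding L2_solutions_iff by blast
  have "SL (\<lambda>x. u x + v x) (\<lambda>x. p x + q x) (\<lambda>x. z *s (u x + v x))"
    using SL_add[OF u(1) v(1)] by (simp add: vector_add_ldistrib)
  moreover have "mass d (\<lambda>x. u x + v x) \<le> 2 * K1 + 2 * K2" if "d \<ge> c" for d
    using mass_add_le[OF SL_continuous(1)[OF u(1)] SL_continuous(1)[OF v(1)] that] u(2)[OF that] v(2)[OF that] by linarith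
  ultimately show ?thesis unfolding L2_solutions_iff plus_fun_def using u(3) v(3) by auto
qed

lemma L2_solutions_scale:
  assumes "u \<in> L2_solutions c P Q R z"
  shows "cfun_scale a u \<in> L2_solutions c P Q R z"
proof -
  obtain p K where u: "SL u p (\<lambda>x. z *s u x)" "\<And>d. d \<ge> c \<Longrightarrow> mass d u \<le> K" "\<And>x. x < c \<Longrightarrow> u x = 0"
    using assms unfolding L2_solutions_iff by blast
  have "SL (\<lambda>x. a *s u x) (\<lambda>x. a *s p x) (\<lambda>x. z *s (a *s u x))"
    using SL_scale[OF u(1), of a] by (simp add: mult.commute)
  moreover have "mass d (\<lambda>x. a *s u x) \<le> (norm a)\<^sup>2 * K" if "d \<ge> c" for d
    unfolding mass_scale by (intro mult_left_mono u(2) that) auto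
  ultimately show ?thesis unfolding L2_solutions_iff cfun_scale_def using u(3) by auto
qed

lemma L2_solution_with_value:
  assumes "Im z \<noteq> 0"
  obtains u where "u \<in> L2_solutions c P Q R z" "u c = h"
proof -
  obtain u p K where u: "SL u p (\<lambda>x. z *s u x)" "u c = h" "\<And>d. d \<ge> c \<Longrightarrow> mass d u \<le> K"
    using Weyl_solution[OF assms] by metis
  \<comment> \<open>Members of \<open>L2_solutions\<close> have to vanish left of c, where the
    solution obtained so far is arbitrary.\<close>
  define v where "v x = (if x < c then 0 else u x)" for x
  have vu: "v x = u x" if "x \<ge> c" for x using that by (simp add: v_def)
  have "SL v p (\<lambda>x. z *s v x)"
  proof -
    have u1: "prim c u (\<lambda>x. matrix_inv (P x) *v p x)" and u2: "prim c p (\<lambda>x. Q x *v u x - R x *v (z *s u x))"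
      using u(1) by (auto simp: SL_def)
    have "prim c v (\<lambda>x. matrix_inv (P x) *v p x)" by (rule prim_cong_left[OF u1]) (simp add: vu)
    moreover have "prim c p (\<lambda>x. Q x *v v x - R x *v (z *s v x))" by (rule prim_cong[OF u2]) (simp_all add: vu)
    ultimately show ?thesis by (simp add: SL_def)
  qed
  moreover have "mass d v = mass d u" for d by (intro integral_cong) (simp add: vu)
  ultimately have "v \<in> L2_solutions c P Q R z"
    unfolding L2_solutions_iff using u(3) by (auto simp: v_def)
  then show ?thesis using u(2) by (intro that[of v]) (auto simp: vu)
qed

lemma limit_point: "limit_point_case c P Q R"
  unfolding limit_point_case_def
proof (intro allI impI)
  fix z :: complex assume "z \<notin> \<real>"
  then have z: "Im z \<noteq> 0" by (auto simp: complex_is_Real_iff)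
  interpret V: vector_space "cfun_scale :: complex \<Rightarrow> (real \<Rightarrow> complex^'a) \<Rightarrow> _" by (rule vector_space_cfun)
  let ?S = "L2_solutions c P Q R z"
  have "\<forall>j. \<exists>u. u \<in> ?S \<and> u c = axis j 1"
    by (intro allI, rule L2_solution_with_value[OF z]) blast
  from choice[OF this] obtain \<phi> where \<phi>: "\<And>j. \<phi> j \<in> ?S" "\<And>j. \<phi> j c = axis j (1::complex)" by blast
  have sub: "V.subspace ?S"
    unfolding V.subspace_def
  proof (intro conjI ballI allI)
    show "0 \<in> ?S" using L2_solutions_scale[OF \<phi>(1), of 0] by (simp only: V.scale_zero_left)
  qed (auto intro: L2_solutions_add L2_solutions_scale)
  have inj: "inj \<phi>"
  proof (rule injI)
    fix i j assume "\<phi> i = \<phi> j"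
    then have "axis i (1::complex) = axis j 1" using \<phi>(2) by metis
    then show "i = j" by (simp add: axis_eq_axis)
  qed
  have val: "(\<Sum>j\<in>UNIV. cfun_scale (a j) (\<phi> j)) c = (\<chi> j. a j)" for a
  proof -
    have "(\<Sum>j\<in>J. cfun_scale (a j) (\<phi> j)) c = (\<Sum>j\<in>J. a j *s axis j 1)" if "finite J" for J
      using that by (induction J rule: finite_induct) (auto simp: cfun_scale_def \<phi>(2))
    then have "(\<Sum>j\<in>UNIV. cfun_scale (a j) (\<phi> j)) c = (\<Sum>j\<in>UNIV. a j *s axis j 1)" by simp
    also have "\<dots> = (\<chi> j. a j)" using basis_expansion[of "\<chi> j. a j"] by simp
    finally show ?thesis .
  qed
  \<comment> \<open>Evaluation at c is linear, so a relation among the \<phi> j becomes one among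
    the unit vectors.\<close>
  have ind: "V.independent (range \<phi>)"
    unfolding V.dependent_finite[OF finite_imageI[OF finite]]
  proof
    assume "\<exists>a. (\<exists>v\<in>range \<phi>. a v \<noteq> 0) \<and> (\<Sum>v\<in>range \<phi>. cfun_scale (a v) v) = 0"
    then obtain a j where nz: "a (\<phi> j) \<noteq> 0" and sum: "(\<Sum>v\<in>range \<phi>. cfun_scale (a v) v) = 0" by blast
    have "(\<Sum>v\<in>range \<phi>. cfun_scale (a v) v) = (\<Sum>j\<in>UNIV. cfun_scale (a (\<phi> j)) (\<phi> j))"
      by (rule sum.reindex_cong[OF inj]) auto
    then have "(\<chi> j. a (\<phi> j)) = 0" using val[of "\<lambda>j. a (\<phi> j)"] sum by simp
    with nz show False by (simp add: vec_eq_iff)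
  qed
  have span: "?S \<subseteq> V.span (range \<phi>)"
  proof
    fix u assume u: "u \<in> ?S"
    define w where "w = (\<Sum>j\<in>UNIV. cfun_scale (u c $ j) (\<phi> j))"
    have "w \<in> ?S" unfolding w_def by (rule V.subspace_sum[OF sub L2_solutions_scale[OF \<phi>(1)]])
    then have D: "u - w \<in> ?S" by (rule V.subspace_diff[OF sub u])
    have "(u - w) x = 0" for x
    proof (cases "x < c")
      case True
      then show ?thesis using D unfolding L2_solutions_iff by blast
    next
      case False
      obtain p K where "SL (u - w) p (\<lambda>x. z *s (u - w) x)" "\<And>d. d \<ge> c \<Longrightarrow> mass d (u - w) \<le> K"
        using D unfolding L2_solutions_iff by blast
      moreover have "(u - w) c = 0" by (simp add: w_def val)
      ultimately show ?thesis using False by (intro Dirichlet_L2_solution_zero[of "u - w" p z K x] z) auto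
    qed
    then have "u = w" by (auto simp: fun_eq_iff)
    also have "w \<in> V.span (range \<phi>)"
      unfolding w_def by (intro V.span_sum V.span_scale V.span_base) auto
    finally show "u \<in> V.span (range \<phi>)" .
  qed
  have "card (range \<phi>) = CARD('a)" using inj by (simp add: card_image)
  then show "V.dim ?S = CARD('a)"
    using V.dim_unique[OF _ span ind] \<phi>(1) by blast
qed

end

theorem theorem3p7:
  fixes c :: real and P Q R :: "real \<Rightarrow> complex^'m^'m"
  assumes "P \<in> borel_measurable (lebesgue_on {c..})"
    and "Q \<in> borel_measurable (lebesgue_on {c..})"
    and "R \<in> borel_measurable (lebesgue_on {c..})"
    and "AE x in lebesgue_on {c..}. pos_def (P x)"
    and "AE x in lebesgue_on {c..}. pos_def (R x)"
    and "AE x in lebesgue_on {c..}. self_adjoint (Q x)"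
    and "\<And>d. d \<ge> c \<Longrightarrow> L1_mat c d (\<lambda>x. matrix_inv (P x))"
    and "\<And>d. d \<ge> c \<Longrightarrow> L1_mat c d Q"
    and "\<And>d. d \<ge> c \<Longrightarrow> L1_mat c d R"
    and "\<And>\<rho>. \<rho> > 0 \<Longrightarrow> AC_mat c (c + \<rho>) P"
    and "L1_loc {c<..} (\<lambda>x. op_norm (hderiv c P x ** matrix_inv (R x) ** hderiv c P x))"
    and "L1_loc {c<..} (\<lambda>x. op_norm (matrix_inv (R x)))"
    and "T_min_bounded_below c P Q R"
    and "\<exists>C::real. \<forall>\<^sub>F \<rho> in at_top.
           esssup (lebesgue_on {\<rho>/2..\<rho>}) (\<lambda>x. ereal (op_norm (mat_inv_sqrt (R x) ** P x ** mat_inv_sqrt (R x))))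
             \<le> ereal (C * \<rho>\<^sup>2)"
  shows "limit_point_case c P Q R"
proof -
  obtain \<gamma> where \<gamma>: "\<And>u. u \<in> D_min c P Q R \<Longrightarrow> Re (L2_ip c R u (L_expr c P Q R u)) \<ge> \<gamma> * Re (L2_ip c R u u)"
    using assms(13) unfolding T_min_bounded_below_def by blast
  let ?g = "\<lambda>x. op_norm (mat_inv_sqrt (R x) ** P x ** mat_inv_sqrt (R x))"
  obtain C \<rho>1 where C: "\<And>\<rho>. \<rho> \<ge> \<rho>1 \<Longrightarrow> esssup (lebesgue_on {\<rho>/2..\<rho>}) (\<lambda>x. ereal (?g x)) \<le> ereal (C * \<rho>\<^sup>2)"
    using assms(14) unfolding eventually_at_top_linorder by blast
  have growth: "AE x in lebesgue_on {c..}. \<rho>/2 \<le> x \<and> x \<le> \<rho> \<longrightarrow> ?g x \<le> C * \<rho>\<^sup>2" if "\<rho> \<ge> \<rho>1" for \<rho>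
  proof -
    have "AE x in lebesgue_on {\<rho>/2..\<rho>}. ereal (?g x) \<le> esssup (lebesgue_on {\<rho>/2..\<rho>}) (\<lambda>x. ereal (?g x))"
      by (rule esssup_AE)
    then have "AE x in lebesgue_on {\<rho>/2..\<rho>}. ?g x \<le> C * \<rho>\<^sup>2"
      by eventually_elim (use C[OF that] order_trans ereal_less_eq(3) in blast)
    then have "AE x in lebesgue. x \<in> {\<rho>/2..\<rho>} \<longrightarrow> ?g x \<le> C * \<rho>\<^sup>2"
      by (subst (asm) AE_restrict_space_iff) auto
    then have "AE x in lebesgue. x \<in> {c..} \<longrightarrow> \<rho>/2 \<le> x \<and> x \<le> \<rho> \<longrightarrow> ?g x \<le> C * \<rho>\<^sup>2"
      by eventually_elim auto
    then show ?thesis by (subst AE_restrict_space_iff) auto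
  qed
  interpret limit_point_growth c P Q R \<gamma> C \<rho>1
    by unfold_locales (rule assms \<gamma> growth; assumption?)+
  show ?thesis by (rule limit_point)
qed

end
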